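(* The satisfiability problem for the EQCONT fragment of the theory of strings (string terms built only from string variables and string constants; atomic predicates equality $t_1 = t_2$ and containment $t_1 \sqsupseteq t_2$; formulas built from these atoms using Boolean negation and conjunction) is NP-hard.
   Context: Strings are finite words over a finite alphabet $\Sigma$; $\epsilon$ denotes the empty string. An instance of the satisfiability problem consists of a finite alphabet $\Sigma$, a formula of the fragment, and for each string variable a natural-number bound on its length. Formulas are conjunctions of Boolean expressions, where a Boolean expression is $\mathit{true}$, $\mathit{false}$, the negation of a Boolean expression, or an atomic predicate. The instance is satisfiable iff there is an assignment of strings over $\Sigma$ to the variables, each respecting its length bound, under which the formula evaluates to true. Semantics: $t_1 = t_2$ holds iff both sides denote the same string; $t_1 \sqsupseteq t_2$ holds iff the string denoted by $t_2$ occurs as a contiguous substring of the string denoted by $t_1$ at some position (in particular every string contains $\epsilon$, and $\epsilon$ contains no nonempty string). *)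

theory Defs
  imports Main "HOL-Library.Sublist"
begin

text \<open>Alphabet Sigma = {0..<k} (letters are naturals), strings are nat lists,
  string variables are indexed by naturals.\<close>

datatype sterm = SVar nat | SConst "nat list"

datatype atom = Eq sterm sterm | Cont sterm sterm   \<comment> \<open>Cont t1 t2 : t1 contains t2\<close>

datatype bexp = BTrue | BFalse | BNot bexp | BAtom atom

text \<open>An instance: alphabet size k, length bounds (variable i has bound bnds!i,
  variables are 0..<length bnds), and a formula given as a conjunction (list) of
  Boolean expressions.\<close>
datatype inst = Inst (alph: nat) (bnds: "nat list") (phi: "bexp list")

fun tval :: "(nat \<Rightarrow> nat list) \<Rightarrow> sterm \<Rightarrow> nat list" where
  "tval \<sigma> (SVar x) = \<sigma> x"
| "tval \<sigma> (SConst w) = w"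

fun aval :: "(nat \<Rightarrow> nat list) \<Rightarrow> atom \<Rightarrow> bool" where
  "aval \<sigma> (Eq t1 t2) = (tval \<sigma> t1 = tval \<sigma> t2)"
| "aval \<sigma> (Cont t1 t2) = sublist (tval \<sigma> t2) (tval \<sigma> t1)"

fun bval :: "(nat \<Rightarrow> nat list) \<Rightarrow> bexp \<Rightarrow> bool" where
  "bval \<sigma> BTrue = True"
| "bval \<sigma> BFalse = False"
| "bval \<sigma> (BNot b) = (\<not> bval \<sigma> b)"
| "bval \<sigma> (BAtom a) = aval \<sigma> a"

fun term_ok :: "nat \<Rightarrow> nat \<Rightarrow> sterm \<Rightarrow> bool" where
  "term_ok k n (SVar x) = (x < n)"
| "term_ok k n (SConst w) = (set w \<subseteq> {..<k})"

fun atom_ok :: "nat \<Rightarrow> nat \<Rightarrow> atom \<Rightarrow> bool" where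
  "atom_ok k n (Eq t1 t2) = (term_ok k n t1 \<and> term_ok k n t2)"
| "atom_ok k n (Cont t1 t2) = (term_ok k n t1 \<and> term_ok k n t2)"

fun bexp_ok :: "nat \<Rightarrow> nat \<Rightarrow> bexp \<Rightarrow> bool" where
  "bexp_ok k n BTrue = True"
| "bexp_ok k n BFalse = True"
| "bexp_ok k n (BNot b) = bexp_ok k n b"
| "bexp_ok k n (BAtom a) = atom_ok k n a"

definition wf_inst :: "inst \<Rightarrow> bool" where
  "wf_inst I = (\<forall>b\<in>set (phi I). bexp_ok (alph I) (length (bnds I)) b)"

definition sat_inst :: "inst \<Rightarrow> bool" where
  "sat_inst I = (\<exists>\<sigma>. (\<forall>i<length (bnds I). length (\<sigma> i) \<le> bnds I ! i \<and> set (\<sigma> i) \<subseteq> {..<alph I})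
                     \<and> (\<forall>b\<in>set (phi I). bval \<sigma> b))"

fun bin :: "nat \<Rightarrow> bool list" where
  "bin n = (if n = 0 then [] else odd n # bin (n div 2))"

text \<open>Self-delimiting binary code of a natural number: doubled bits, then 01.\<close>
definition enc_nat :: "nat \<Rightarrow> bool list" where
  "enc_nat n = concat (map (\<lambda>b. [b, b]) (bin n)) @ [False, True]"

fun nt :: "sterm \<Rightarrow> nat list" where
  "nt (SVar x) = [0, x]"
| "nt (SConst w) = [1, length w] @ w"

fun na :: "atom \<Rightarrow> nat list" where
  "na (Eq t1 t2) = [0] @ nt t1 @ nt t2"
| "na (Cont t1 t2) = [1] @ nt t1 @ nt t2"

fun nb :: "bexp \<Rightarrow> nat list" where
  "nb BTrue = [0]"
| "nb BFalse = [1]"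
| "nb (BNot b) = [2] @ nb b"
| "nb (BAtom a) = [3] @ na a"

definition enc_inst :: "inst \<Rightarrow> bool list" where
  "enc_inst I = concat (map enc_nat
     ([alph I, length (bnds I)] @ bnds I @ [length (phi I)] @ concat (map nb (phi I))))"

definition EQCONT_SAT :: "bool list set" where
  "EQCONT_SAT = {enc_inst I | I. wf_inst I \<and> sat_inst I}"

datatype move = MoveL | MoveR | MoveN

text \<open>States 0..<nstates, start state 0, halting state 1.  Tape symbols
  0..<nsyms: 0 = blank, 1 = bit False, 2 = bit True.\<close>
record tm =
  nstates :: nat
  nsyms :: nat
  delta :: "nat \<Rightarrow> nat \<Rightarrow> nat \<times> nat \<times> move"

definition wf_tm :: "tm \<Rightarrow> bool" where
  "wf_tm M = (2 \<le> nstates M \<and> 3 \<le> nsyms M \<and>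
     (\<forall>q<nstates M. \<forall>s<nsyms M. case delta M q s of (q', w, m) \<Rightarrow> q' < nstates M \<and> w < nsyms M))"

text \<open>Configuration (state, reversed tape left of head, tape from head on).\<close>
type_synonym config = "nat \<times> nat list \<times> nat list"

definition head_sym :: "nat list \<Rightarrow> nat" where
  "head_sym rs = (case rs of [] \<Rightarrow> 0 | s # _ \<Rightarrow> s)"

definition step :: "tm \<Rightarrow> config \<Rightarrow> config" where
  "step M c = (case c of (q, ls, rs) \<Rightarrow>
     if q = 1 then c else
     (case delta M q (head_sym rs) of (q', w, m) \<Rightarrow>
       let rs' = w # tl rs in
       (case m of
          MoveN \<Rightarrow> (q', ls, rs')
        | MoveR \<Rightarrow> (q', w # ls, tl rs')
        | MoveL \<Rightarrow> (case ls of [] \<Rightarrow> (q', [], 0 # rs') | l # ls' \<Rightarrow> (q', ls', l # rs')))))"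

definition sym_of_bit :: "bool \<Rightarrow> nat" where
  "sym_of_bit b = (if b then 2 else 1)"

definition init_config :: "bool list \<Rightarrow> config" where
  "init_config x = (0, [], map sym_of_bit x)"

definition tm_output :: "config \<Rightarrow> bool list" where
  "tm_output c = map (\<lambda>s. s = 2) (takeWhile (\<lambda>s. s = 1 \<or> s = 2) (snd (snd c)))"

definition poly_time_computable :: "(bool list \<Rightarrow> bool list) \<Rightarrow> bool" where
  "poly_time_computable f = (\<exists>M (c::nat) (d::nat). wf_tm M \<and>
     (\<forall>x. \<exists>t. t \<le> c * (length x + 1) ^ d \<and>
        fst ((step M ^^ t) (init_config x)) = 1 \<and>
        tm_output ((step M ^^ t) (init_config x)) = f x))"

definition in_P :: "bool list set \<Rightarrow> bool" where
  "in_P L = (\<exists>f. poly_time_computable f \<and> (\<forall>x. x \<in> L \<longleftrightarrow> f x = [True]))"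

definition pair_enc :: "bool list \<Rightarrow> bool list \<Rightarrow> bool list" where
  "pair_enc x y = concat (map (\<lambda>b. [b, b]) x) @ [False, True] @ y"

definition in_NP :: "bool list set \<Rightarrow> bool" where
  "in_NP L = (\<exists>V (c::nat) (d::nat). in_P V \<and>
     (\<forall>x. x \<in> L \<longleftrightarrow> (\<exists>y. length y \<le> c * (length x + 1) ^ d \<and> pair_enc x y \<in> V)))"

definition NP_hard :: "bool list set \<Rightarrow> bool" where
  "NP_hard L' = (\<forall>L. in_NP L \<longrightarrow>
     (\<exists>f. poly_time_computable f \<and> (\<forall>x. x \<in> L \<longleftrightarrow> f x \<in> L')))"

end

(* Cook-Levin, directly into EQCONT. The run of the verifier M on (x, y) is laid out as one long
   row-after-row sequence of cells, each row of width w, so that cell p + w + 1 is a function of the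
   cells p, p + 1, p + 2; wrap-around at the row ends is harmless because the rows are padded with
   more blanks than the head can cross. Cell p is a string variable u_p of length at most 1 that must
   be a nonempty part of a constant listing the letters allowed at p. All letters are tagged with
   their position. The local rule at p is expressed by a variable w_p of length at most 4 that
   contains u_p, u_(p+1), u_(p+2), u_(p+w+1) and is contained in a constant that lists all admissible
   quadruples, separated by the letter 0: the four letters are distinct and nonzero, so w_p must be
   one of the listed quadruples. Rejecting cells are excluded from the quadruples; since M halts in
   time, the formula is satisfiable iff some y is accepted.

   For polynomial-time computability, a while language over stacks is simulated by a single-tape
   machine (one track per stack); all numbers of the instance are constants or of the form
   s + 2^k * v with v a counter, so that the binary codes come from binary counters. *)
theory Submission
  imports Defs "HOL-Library.Countable"
begin

section \<open>Unique decoding of instances\<close>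

text \<open>Terms have no concatenation, so a word equation cannot describe a row or tie
  neighbouring cells together: variables interact only through containment, and containment does not
  say where an occurrence lies. With position-tagged letters the letter itself says where it
  belongs. Negation never reaches a conjunction, so there is no disjunction either; every choice in
  the formula is a choice of an occurrence inside a constant, made for one cell or for one quadruple
  of cells.

  A single running index for all rows removes row and column arithmetic from the reduction: its
  inner loop increments four counters and fills in a template. The price is that rules at the row
  ends read cells of adjacent rows. The acceptance test is local as well: a halted machine is made
  to stay in place, so the formula need not know the halting time, and two adjacent cells decide
  whether the output is \<open>[True]\<close>.\<close>

declare bin.simps [simp del]

lemma bin_inj: "bin a = bin b \<Longrightarrow> a = b"
proof (induction a arbitrary: b rule: bin.induct)
  case (1 n)
  show ?case
  proof (cases "n = 0")
    case True
    then show ?thesis using 1(2) by (cases "b = 0") (simp_all add: bin.simps)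
  next
    case False
    then have b: "b \<noteq> 0" using 1(2) by (metis bin.simps list.discI)
    then have "odd n = odd b" "bin (n div 2) = bin (b div 2)"
      using 1(2) False by (simp_all add: bin.simps[of n] bin.simps[of b])
    then have "n mod 2 = b mod 2" "n div 2 = b div 2"
      using 1(1)[OF False] by (auto simp: odd_iff_mod_2_eq_one)
    then show ?thesis by (metis div_mult_mod_eq)
  qed
qed

text \<open>The terminator 01 is the first aligned pair with unequal bits, so it cannot be mistaken
  for a doubled bit.\<close>

lemma doubled_prefix_code:
  "concat (map (\<lambda>b. [b, b]) u) @ [False, True] @ r = concat (map (\<lambda>b. [b, b]) v) @ [False, True] @ r'
   \<Longrightarrow> u = v \<and> r = r'"
proof (induction u arbitrary: v)
  case Nil
  then show ?case by (cases v) auto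
next
  case (Cons a u)
  then show ?case by (cases v) auto
qed

lemma enc_nat_prefix_code: "enc_nat a @ r = enc_nat b @ r' \<Longrightarrow> a = b \<and> r = r'"
  using doubled_prefix_code[of "bin a" r "bin b" r'] bin_inj by (auto simp: enc_nat_def)

lemma concat_enc_nat_inj: "concat (map enc_nat ns) = concat (map enc_nat ms) \<Longrightarrow> ns = ms"
proof (induction ns arbitrary: ms)
  case Nil
  then show ?case by (cases ms) (auto simp: enc_nat_def)
next
  case (Cons n ns)
  then obtain m ms' where ms: "ms = m # ms'" by (cases ms) (auto simp: enc_nat_def)
  then show ?case using Cons enc_nat_prefix_code[of n "concat (map enc_nat ns)" m] by auto
qed

lemma nt_prefix_code: "nt t @ r = nt u @ r' \<Longrightarrow> t = u \<and> r = r'"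
  by (cases t; cases u) auto

lemma na_prefix_code: "na a @ r = na b @ r' \<Longrightarrow> a = b \<and> r = r'"
  by (cases a; cases b) (auto dest!: nt_prefix_code)

text \<open>Constructor tags, together with the length field of a constant, delimit every expression
  without separators.\<close>

lemma nb_prefix_code: "nb b @ r = nb c @ r' \<Longrightarrow> b = c \<and> r = r'"
proof (induction b arbitrary: c)
  case BTrue then show ?case by (cases c) auto
next
  case BFalse then show ?case by (cases c) auto
next
  case (BNot b) then show ?case by (cases c) auto
next
  case (BAtom a) then show ?case by (cases c) (auto dest!: na_prefix_code)
qed

lemma concat_nb_inj:
  "length bs = length cs \<Longrightarrow> concat (map nb bs) = concat (map nb cs) \<Longrightarrow> bs = cs"
proof (induction bs cs rule: list_induct2)
  case (Cons b bs c cs)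
  then show ?case using nb_prefix_code[of b "concat (map nb bs)" c "concat (map nb cs)"] by auto
qed auto

lemma enc_inst_inj: "enc_inst I = enc_inst J \<Longrightarrow> I = J"
proof -
  assume "enc_inst I = enc_inst J"
  then have "[alph I, length (bnds I)] @ bnds I @ [length (phi I)] @ concat (map nb (phi I)) =
    [alph J, length (bnds J)] @ bnds J @ [length (phi J)] @ concat (map nb (phi J))"
    unfolding enc_inst_def by (rule concat_enc_nat_inj)
  then show ?thesis by (intro inst.expand) (auto dest: concat_nb_inj)
qed

text \<open>The target language is a set of codes, so a code in it could a priori stem from another,
  satisfiable instance; injectivity of the encoding excludes this.\<close>

lemma enc_inst_in_EQCONT_SAT: "wf_inst I \<Longrightarrow> enc_inst I \<in> EQCONT_SAT \<longleftrightarrow> sat_inst I"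
  unfolding EQCONT_SAT_def using enc_inst_inj by blast

section \<open>Machines on a two-way infinite tape\<close>

text \<open>The default 0 is the blank: a list stands for a half tape continued by blanks, and an
  empty stack has top 0.\<close>

definition nth0 :: "nat list \<Rightarrow> nat \<Rightarrow> nat" where
  "nth0 xs j = (if j < length xs then xs ! j else 0)"

lemma nth0_simps [simp]: "nth0 [] j = 0" "nth0 (x # xs) 0 = x" "nth0 (x # xs) (Suc j) = nth0 xs j"
  by (auto simp: nth0_def)

lemma nth0_Cons: "nth0 (x # xs) j = (if j = 0 then x else nth0 xs (j - 1))"
  by (cases j) auto

lemma nth0_tl: "nth0 (tl xs) j = nth0 xs (Suc j)"
  by (cases xs) auto

lemma head_sym_nth0: "head_sym xs = nth0 xs 0"
  by (cases xs) (auto simp: head_sym_def)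

fun offset :: "move \<Rightarrow> int" where
  "offset MoveL = -1" | "offset MoveR = 1" | "offset MoveN = 0"

text \<open>Polymorphic in states and symbols, so that one notion of step serves both a
  \<open>tm\<close> and the structured machine \<open>tr\<close>. Absolute integer positions allow
  tapes to be compared pointwise.\<close>

definition fstep :: "('q \<Rightarrow> 's \<Rightarrow> 'q \<times> 's \<times> move) \<Rightarrow> 'q \<times> int \<times> (int \<Rightarrow> 's) \<Rightarrow> 'q \<times> int \<times> (int \<Rightarrow> 's)" where
  "fstep \<delta> c = (case c of (q, h, T) \<Rightarrow> case \<delta> q (T h) of (q', w, m) \<Rightarrow> (q', h + offset m, T(h := w)))"

text \<open>A self-loop in the halting state replaces the case distinction of \<open>step\<close>
  and freezes the configuration from the halting time on.\<close>

definition ndelta :: "tm \<Rightarrow> nat \<Rightarrow> nat \<Rightarrow> nat \<times> nat \<times> move" where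
  "ndelta M q s = (if q = 1 then (1, s, MoveN) else delta M q s)"

text \<open>A relation and not a function: it forgets trailing blanks of the two lists and leaves
  the origin free, which a \<open>config\<close> does not record.\<close>

definition tape_of :: "config \<Rightarrow> nat \<times> int \<times> (int \<Rightarrow> nat) \<Rightarrow> bool" where
  "tape_of c f = (case c of (q, ls, rs) \<Rightarrow> case f of (q', h, T) \<Rightarrow>
     q' = q \<and> (\<forall>p. T p = (if h \<le> p then nth0 rs (nat (p - h)) else nth0 ls (nat (h - 1 - p)))))"

lemma tape_of_step:
  assumes "tape_of c f" shows "tape_of (step M c) (fstep (ndelta M) f)"
proof -
  obtain q ls rs where c: "c = (q, ls, rs)" by (cases c)
  obtain h T where f: "f = (q, h, T)" using assms c by (cases f) (auto simp: tape_of_def)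
  have T: "T = (\<lambda>p. if h \<le> p then nth0 rs (nat (p - h)) else nth0 ls (nat (h - 1 - p)))"
    using assms by (auto simp: tape_of_def c f)
  show ?thesis
  proof (cases "q = 1")
    case True
    then show ?thesis using assms by (simp add: c f step_def fstep_def ndelta_def)
  next
    case False
    obtain q' w m where d: "delta M q (head_sym rs) = (q', w, m)" by (cases "delta M q (head_sym rs)")
    have Th: "T h = head_sym rs" by (simp add: T head_sym_nth0)
    have upd: "(T(h := w)) p = (if h \<le> p then nth0 (w # tl rs) (nat (p - h)) else nth0 ls (nat (h - 1 - p)))" for p
    proof (cases "h < p")
      case True
      then obtain j where j: "nat (p - h) = Suc j" by (metis diff_gt_0_iff_gt gr0_implies_Suc zero_less_nat_eq)
      with True show ?thesis by (simp add: T nth0_tl j)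
    qed (auto simp: T)
    show ?thesis
    proof (cases m)
      case MoveN
      then show ?thesis using False d Th upd by (simp add: c f step_def fstep_def ndelta_def tape_of_def)
    next
      case MoveR
      have "(T(h := w)) p = (if h + 1 \<le> p then nth0 (tl rs) (nat (p - (h + 1))) else nth0 (w # ls) (nat (h - p)))" for p
      proof (cases "h < p")
        case True
        then have "nat (p - h) = Suc (nat (p - (h + 1)))" by simp
        with True show ?thesis using upd[of p] by simp
      next
        case F: False
        show ?thesis
        proof (cases "p = h")
          case False
          with F have "nat (h - p) = Suc (nat (h - 1 - p))" by simp
          with F False show ?thesis using upd[of p] by simp
        qed (use upd[of p] in simp)
      qed
      then show ?thesis using MoveR False d Th
        by (simp add: c f step_def fstep_def ndelta_def tape_of_def)
    next
      case MoveL
      have "(T(h := w)) p = (if h - 1 \<le> p then nth0 (head_sym ls # w # tl rs) (nat (p - (h - 1)))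
          else nth0 (tl ls) (nat (h - 2 - p)))" for p
      proof (cases "p = h - 1")
        case True
        then show ?thesis using upd[of p] by (simp add: head_sym_nth0)
      next
        case False
        show ?thesis
        proof (cases "h \<le> p")
          case True
          then have "nat (p - (h - 1)) = Suc (nat (p - h))" by simp
          with True show ?thesis using upd[of p] by simp
        next
          case f2: False
          with False have "nat (h - 1 - p) = Suc (nat (h - 2 - p))" by simp
          with False f2 show ?thesis using upd[of p] by (simp add: nth0_tl)
        qed
      qed
      then show ?thesis using MoveL False d Th
        by (cases ls) (simp_all add: c f step_def fstep_def ndelta_def tape_of_def head_sym_nth0)
    qed
  qed
qed

lemma tape_of_steps: "tape_of c f \<Longrightarrow> tape_of ((step M ^^ t) c) ((fstep (ndelta M) ^^ t) f)"
  by (induction t) (auto intro: tape_of_step)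

definition init_tape :: "bool list \<Rightarrow> int \<Rightarrow> nat" where
  "init_tape x p = (if 0 \<le> p then nth0 (map sym_of_bit x) (nat p) else 0)"

lemma tape_of_init: "tape_of (init_config x) (0, 0, init_tape x)"
  by (auto simp: tape_of_def init_config_def init_tape_def)

lemma tm_output_eqI:
  assumes "tape_of c (q, h, T)" "\<And>j. T (h + int j) = nth0 (map sym_of_bit y) j"
  shows "tm_output c = y"
proof -
  obtain ls rs where c: "c = (q, ls, rs)" using assms(1) by (cases c) (auto simp: tape_of_def)
  have "nth0 rs j = nth0 (map sym_of_bit y) j" for j
    using assms(1) assms(2)[of j] by (simp add: c tape_of_def)
  then have "map (\<lambda>s. s = 2) (takeWhile (\<lambda>s. s = 1 \<or> s = 2) rs) = y"
  proof (induction y arbitrary: rs)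
    case Nil
    then have "nth0 rs 0 = 0" by simp
    then show ?case by (cases rs) auto
  next
    case (Cons b y)
    then obtain r rs' where rs: "rs = r # rs'"
      using Cons.prems[of 0] by (cases rs) (auto simp: sym_of_bit_def split: if_splits)
    have "r = sym_of_bit b" using Cons.prems[of 0] rs by simp
    moreover have "nth0 rs' j = nth0 (map sym_of_bit y) j" for j
      using Cons.prems[of "Suc j"] rs by simp
    then have "map (\<lambda>s. s = 2) (takeWhile (\<lambda>s. s = 1 \<or> s = 2) rs') = y" by (rule Cons.IH)
    ultimately show ?case using rs by (cases b) (simp_all add: sym_of_bit_def)
  qed
  then show ?thesis by (simp add: tm_output_def c)
qed

section \<open>A stack language simulated on one tape\<close>

type_synonym store = "nat \<Rightarrow> nat list"

datatype com =
    Skip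
  | Push nat nat
  | Pop nat
  | Seq com com (infixr ";;" 60)
  | Case nat "nat \<Rightarrow> com"
  | While nat "nat set" com

text \<open>The number counts commands and tests. Each adds at most one symbol to one stack, so it
  also bounds the growth of the stacks. \<open>exec_weaken\<close> turns it into an upper bound,
  which lets a loop use a uniform cost per round.\<close>

inductive exec :: "com \<Rightarrow> store \<Rightarrow> nat \<Rightarrow> store \<Rightarrow> bool" where
  exec_Skip: "exec Skip s 1 s"
| exec_Push: "exec (Push i a) s 1 (s(i := a # s i))"
| exec_Pop: "exec (Pop i) s 1 (s(i := tl (s i)))"
| exec_Seq: "exec c s m s' \<Longrightarrow> exec d s' m' s'' \<Longrightarrow> exec (c ;; d) s (m + m' + 1) s''"
| exec_Case: "exec (f (nth0 (s i) 0)) s m s' \<Longrightarrow> exec (Case i f) s (m + 1) s'"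
| exec_While_True: "nth0 (s i) 0 \<in> P \<Longrightarrow> exec c s m s' \<Longrightarrow> exec (While i P c) s' m' s'' \<Longrightarrow>
    exec (While i P c) s (m + m' + 1) s''"
| exec_While_False: "nth0 (s i) 0 \<notin> P \<Longrightarrow> exec (While i P c) s 1 s"
| exec_weaken: "exec c s m s' \<Longrightarrow> m \<le> m' \<Longrightarrow> exec c s m' s'"

text \<open>Pushed symbols are nonzero because the blank 0 marks the end of a stack. Only branches
  for symbols below \<open>S\<close> are checked, which keeps the compiled machine finite.\<close>

primrec ok_com :: "nat \<Rightarrow> nat \<Rightarrow> com \<Rightarrow> bool" where
  "ok_com K S Skip = True"
| "ok_com K S (Push i a) = (i < K \<and> 0 < a \<and> a < S)"
| "ok_com K S (Pop i) = (i < K)"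
| "ok_com K S (c ;; d) = (ok_com K S c \<and> ok_com K S d)"
| "ok_com K S (Case i f) = (i < K \<and> (\<forall>a<S. ok_com K S (f a)))"
| "ok_com K S (While i P c) = (i < K \<and> ok_com K S c)"

definition ok_store :: "nat \<Rightarrow> nat \<Rightarrow> store \<Rightarrow> bool" where
  "ok_store K S s \<longleftrightarrow> 1 < S \<and> (\<forall>i. set (s i) \<subseteq> {0<..<S}) \<and> (\<forall>i\<ge>K. s i = [])"

datatype ctl =
    Run "com list"
  | Ins nat nat "com list"
  | Ret "com list"
  | Seek nat "com list"
  | Del nat nat "com list"

text \<open>Stack \<open>i\<close> occupies track \<open>i\<close> of the tape, top at cell \<open>0\<close>; a cell is the function from
  tracks to symbols. Cells left of \<open>0\<close> are blank, which is how the head finds its way back.\<close>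

fun tr :: "ctl \<Rightarrow> (nat \<Rightarrow> nat) \<Rightarrow> ctl \<times> (nat \<Rightarrow> nat) \<times> move" where
  "tr (Run []) v = (Run [], v, MoveN)"
| "tr (Run (Skip # k)) v = (Run k, v, MoveN)"
| "tr (Run (Push i a # k)) v = (Ins i a k, v, MoveN)"
| "tr (Run (Pop i # k)) v = (Seek i k, v, MoveN)"
| "tr (Run (Seq c d # k)) v = (Run (c # d # k), v, MoveN)"
| "tr (Run (Case i f # k)) v = (Run (f (v i) # k), v, MoveN)"
| "tr (Run (While i P c # k)) v = (Run (if v i \<in> P then c # While i P c # k else k), v, MoveN)"
| "tr (Ins i a k) v = (if v i = 0 then (Ret k, v(i := a), MoveL) else (Ins i (v i) k, v(i := a), MoveR))"
| "tr (Ret k) v = (if v = (\<lambda>_. 0) then (Run k, v, MoveR) else (Ret k, v, MoveL))"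
| "tr (Seek i k) v = (if v i = 0 then (Del i 0 k, v, MoveL) else (Seek i k, v, MoveR))"
| "tr (Del i a k) v = (if v = (\<lambda>_. 0) then (Run k, v, MoveR) else (Del i (v i) k, v(i := a), MoveL))"

definition tape :: "store \<Rightarrow> int \<Rightarrow> nat \<Rightarrow> nat" where
  "tape s p i = (if 0 \<le> p then nth0 (s i) (nat p) else 0)"

section \<open>Sweeps of the head: insertion, return to the origin, deletion\<close>

definition go :: "nat \<Rightarrow> ctl \<times> int \<times> (int \<Rightarrow> nat \<Rightarrow> nat) \<Rightarrow> ctl \<times> int \<times> (int \<Rightarrow> nat \<Rightarrow> nat)" where
  "go t = fstep tr ^^ t"

lemma go_1 [simp]: "go (Suc 0) c = fstep tr c"
  by (simp add: go_def)

lemma go_add: "go t c = c' \<Longrightarrow> go t' c' = c'' \<Longrightarrow> go (t + t') c = c''"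
  by (subst add.commute) (simp add: go_def funpow_add)

lemma go_Suc: "fstep tr c = c' \<Longrightarrow> go t c' = c'' \<Longrightarrow> go (Suc t) c = c''"
  by (simp add: go_def funpow_swap1)

text \<open>The state carries one symbol: each cell of the track receives the symbol of its left
  neighbour until the first blank of the track is filled.\<close>

lemma go_Ins:
  assumes "0 \<notin> set ys" "\<And>j. T (h + int j) i = nth0 ys j"
  shows "go (Suc (length ys)) (Ins i a k, h, T) =
    (Ret k, h + int (length ys) - 1,
     \<lambda>p q. if q = i \<and> h \<le> p then nth0 (a # ys) (nat (p - h)) else T p q)"
  using assms
proof (induction ys arbitrary: h a T)
  case Nil
  have z: "T p i = 0" if "h \<le> p" for p using Nil(2)[of "nat (p - h)"] that by simp
  have "T(h := (T h)(i := a)) = (\<lambda>p q. if q = i \<and> h \<le> p then nth0 [a] (nat (p - h)) else T p q)"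
    using z by (auto simp: fun_eq_iff nth0_Cons)
  then show ?case using z by (simp add: fstep_def)
next
  case (Cons y ys)
  let ?T = "T(h := (T h)(i := a))"
  have y: "T h i = y" "y \<noteq> 0" using Cons.prems(2)[of 0] Cons.prems(1) by auto
  have step: "fstep tr (Ins i a k, h, T) = (Ins i y k, h + 1, ?T)"
    using y by (simp add: fstep_def)
  have "?T (h + 1 + int j) i = nth0 ys j" for j
    using Cons.prems(2)[of "Suc j"] by (simp add: algebra_simps)
  then have "go (Suc (length ys)) (Ins i y k, h + 1, ?T) = (Ret k, h + 1 + int (length ys) - 1,
      \<lambda>p q. if q = i \<and> h + 1 \<le> p then nth0 (y # ys) (nat (p - (h + 1))) else ?T p q)"
    by (intro Cons.IH) (use Cons.prems(1) in auto)
  also have "(\<lambda>p q. if q = i \<and> h + 1 \<le> p then nth0 (y # ys) (nat (p - (h + 1))) else ?T p q) =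
    (\<lambda>p q. if q = i \<and> h \<le> p then nth0 (a # y # ys) (nat (p - h)) else T p q)"
  proof (intro ext)
    fix p q
    show "(if q = i \<and> h + 1 \<le> p then nth0 (y # ys) (nat (p - (h + 1))) else ?T p q) =
      (if q = i \<and> h \<le> p then nth0 (a # y # ys) (nat (p - h)) else T p q)"
    proof (cases "h + 1 \<le> p")
      case True
      then have "nat (p - h) = Suc (nat (p - (h + 1)))" by simp
      then show ?thesis using True by auto
    qed auto
  qed
  finally have "go (Suc (Suc (length ys))) (Ins i a k, h, T) = (Ret k, h + 1 + int (length ys) - 1,
    \<lambda>p q. if q = i \<and> h \<le> p then nth0 (a # y # ys) (nat (p - h)) else T p q)"
    by (rule go_Suc[OF step])
  then show ?case by (simp add: algebra_simps)
qed

text \<open>The cells passed are nonblank on some track while cell -1 is blank on all of them, so an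
  all-blank cell locates the origin.\<close>

lemma go_Ret:
  assumes "\<And>p. 0 \<le> p \<Longrightarrow> p < int n \<Longrightarrow> T p \<noteq> (\<lambda>_. 0)" "T (- 1) = (\<lambda>_. 0)"
  shows "go (Suc n) (Ret k, int n - 1, T) = (Run k, 0, T)"
  using assms
proof (induction n)
  case 0
  then show ?case by (auto simp: fstep_def fun_eq_iff)
next
  case (Suc n)
  have "fstep tr (Ret k, int (Suc n) - 1, T) = (Ret k, int n - 1, T)"
    using Suc.prems(1)[of "int n"] by (simp add: fstep_def)
  from go_Suc[OF this Suc.IH] Suc.prems show ?case by simp
qed

lemma go_Seek:
  assumes "0 \<notin> set ys" "\<And>j. T (h + int j) i = nth0 ys j"
  shows "go (Suc (length ys)) (Seek i k, h, T) = (Del i 0 k, h + int (length ys) - 1, T)"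
  using assms
proof (induction ys arbitrary: h)
  case Nil
  then show ?case using Nil(2)[of 0] by (simp add: fstep_def)
next
  case (Cons y ys)
  have y: "T h i = y" "y \<noteq> 0" using Cons.prems(2)[of 0] Cons.prems(1) by auto
  have step: "fstep tr (Seek i k, h, T) = (Seek i k, h + 1, T)"
    using y by (simp add: fstep_def)
  have "T (h + 1 + int j) i = nth0 ys j" for j
    using Cons.prems(2)[of "Suc j"] by (simp add: algebra_simps)
  then have "go (Suc (length ys)) (Seek i k, h + 1, T) = (Del i 0 k, h + 1 + int (length ys) - 1, T)"
    by (intro Cons.IH) (use Cons.prems(1) in auto)
  then show ?case using go_Suc[OF step] by (simp add: algebra_simps)
qed

text \<open>The shift runs leftwards; the symbol leaving cell 0 is still carried when the blank cell
  -1 is met and is discarded there. In a pop the carried symbol starts as the blank that erases the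
  last cell.\<close>

lemma go_Del:
  assumes "\<And>p. 0 \<le> p \<Longrightarrow> p < int n \<Longrightarrow> T p i \<noteq> 0" "T (- 1) = (\<lambda>_. 0)"
  shows "go (Suc n) (Del i a k, int n - 1, T) =
    (Run k, 0, \<lambda>p q. if q = i \<and> 0 \<le> p \<and> p < int n then (if p = int n - 1 then a else T (p + 1) i) else T p q)"
  using assms
proof (induction n arbitrary: a T)
  case 0
  then show ?case by (auto simp: fstep_def fun_eq_iff)
next
  case (Suc n)
  let ?T = "T(int n := (T (int n))(i := a))"
  have nz: "T (int n) i \<noteq> 0" using Suc.prems(1) by simp
  then have "T (int n) \<noteq> (\<lambda>_. 0)" by metis
  then have step: "fstep tr (Del i a k, int (Suc n) - 1, T) = (Del i (T (int n) i) k, int n - 1, ?T)"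
    by (simp add: fstep_def)
  have "go (Suc n) (Del i (T (int n) i) k, int n - 1, ?T) =
    (Run k, 0, \<lambda>p q. if q = i \<and> 0 \<le> p \<and> p < int n
      then (if p = int n - 1 then T (int n) i else ?T (p + 1) i) else ?T p q)"
    by (rule Suc.IH) (use Suc.prems in auto)
  also have "(\<lambda>p q. if q = i \<and> 0 \<le> p \<and> p < int n
      then (if p = int n - 1 then T (int n) i else ?T (p + 1) i) else ?T p q) =
    (\<lambda>p q. if q = i \<and> 0 \<le> p \<and> p < int (Suc n)
      then (if p = int (Suc n) - 1 then a else T (p + 1) i) else T p q)"
    by (auto simp: fun_eq_iff)
  finally show ?case by (rule go_Suc[OF step])
qed

lemma tape_neg [simp]: "tape s (- 1) = (\<lambda>_. 0)"
  by (auto simp: tape_def fun_eq_iff)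

lemma tape_nonzero:
  assumes "0 \<notin> set (s i)" "0 \<le> p" "p < int (length (s i))" shows "tape s p i \<noteq> 0"
proof -
  have "nat p < length (s i)" using assms by simp
  then have "s i ! nat p \<noteq> 0" using assms(1) by (metis nth_mem)
  then show ?thesis using assms by (simp add: tape_def nth0_def)
qed

lemma go_Push:
  assumes "0 \<notin> set (s i)" "0 < a"
  shows "go (2 * length (s i) + 3) (Run (Push i a # k), 0, tape s) = (Run k, 0, tape (s(i := a # s i)))"
proof -
  let ?n = "length (s i)"
  have 1: "fstep tr (Run (Push i a # k), 0, tape s) = (Ins i a k, 0, tape s)"
    by (simp add: fstep_def)
  have "go (Suc ?n) (Ins i a k, 0, tape s) = (Ret k, 0 + int ?n - 1,
     \<lambda>p q. if q = i \<and> 0 \<le> p then nth0 (a # s i) (nat (p - 0)) else tape s p q)"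
    using assms by (intro go_Ins) (auto simp: tape_def)
  also have "(\<lambda>p q. if q = i \<and> 0 \<le> p then nth0 (a # s i) (nat (p - 0)) else tape s p q) =
      tape (s(i := a # s i))"
    by (auto simp: fun_eq_iff tape_def)
  finally have 2: "go (Suc ?n) (Ins i a k, 0, tape s) = (Ret k, int ?n - 1, tape (s(i := a # s i)))"
    by simp
  have 3: "go (Suc ?n) (Ret k, int ?n - 1, tape (s(i := a # s i))) = (Run k, 0, tape (s(i := a # s i)))"
  proof (rule go_Ret)
    fix p :: int assume "0 \<le> p" "p < int ?n"
    then have "tape (s(i := a # s i)) p i \<noteq> 0" using assms by (intro tape_nonzero) auto
    then show "tape (s(i := a # s i)) p \<noteq> (\<lambda>_. 0)" by metis
  qed simp
  \<comment> \<open>One step of dispatch and \<open>Suc ?n\<close> steps for each of the two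
    sweeps.\<close>
  have "2 * ?n + 3 = Suc (Suc ?n + Suc ?n)" by simp
  then show ?thesis using go_Suc[OF 1 go_add[OF 2 3]] by argo
qed

text \<open>On an empty stack the seek turns to cell -1 at once and nothing changes, in accordance
  with \<open>tl [] = []\<close>.\<close>

lemma go_Pop:
  assumes "0 \<notin> set (s i)"
  shows "go (2 * length (s i) + 3) (Run (Pop i # k), 0, tape s) = (Run k, 0, tape (s(i := tl (s i))))"
proof -
  let ?n = "length (s i)"
  have 1: "fstep tr (Run (Pop i # k), 0, tape s) = (Seek i k, 0, tape s)"
    by (simp add: fstep_def)
  have "go (Suc ?n) (Seek i k, 0, tape s) = (Del i 0 k, 0 + int ?n - 1, tape s)"
    using assms by (intro go_Seek) (auto simp: tape_def)
  then have 2: "go (Suc ?n) (Seek i k, 0, tape s) = (Del i 0 k, int ?n - 1, tape s)"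
    by simp
  have "go (Suc ?n) (Del i 0 k, int ?n - 1, tape s) = (Run k, 0,
     \<lambda>p q. if q = i \<and> 0 \<le> p \<and> p < int ?n then (if p = int ?n - 1 then 0 else tape s (p + 1) i) else tape s p q)"
    using assms by (intro go_Del tape_nonzero) auto
  also have "(\<lambda>p q. if q = i \<and> 0 \<le> p \<and> p < int ?n then (if p = int ?n - 1 then 0 else tape s (p + 1) i) else tape s p q)
      = tape (s(i := tl (s i)))"
  proof (intro ext)
    fix p q
    have "nat (p + 1) = Suc (nat p)" if "0 \<le> p" using that by simp
    then show "(if q = i \<and> 0 \<le> p \<and> p < int ?n then (if p = int ?n - 1 then 0 else tape s (p + 1) i) else tape s p q)
      = tape (s(i := tl (s i))) p q"
      by (auto simp: tape_def nth0_tl) (auto simp: nth0_def)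
  qed
  finally have 3: "go (Suc ?n) (Del i 0 k, int ?n - 1, tape s) = (Run k, 0, tape (s(i := tl (s i))))" .
  have "2 * ?n + 3 = Suc (Suc ?n + Suc ?n)" by simp
  then show ?thesis using go_Suc[OF 1 go_add[OF 2 3]] by argo
qed

section \<open>Simulation of whole programs with polynomial slowdown\<close>

lemma ok_store_upd: "ok_store K S s \<Longrightarrow> set xs \<subseteq> {0<..<S} \<Longrightarrow> i < K \<Longrightarrow> ok_store K S (s(i := xs))"
  by (auto simp: ok_store_def)

lemma ok_store_nonzero: "ok_store K S s \<Longrightarrow> 0 \<notin> set (s i)"
  by (fastforce simp: ok_store_def)

lemma nth0_less: "ok_store K S s \<Longrightarrow> nth0 (s i) j < S"
  using nth_mem[of j "s i"] by (fastforce simp: ok_store_def nth0_def)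

text \<open>No stack outgrows \<open>L + m\<close>, so each of the at most \<open>m\<close> commands
  costs at most two sweeps of that length. The quantifier over \<open>k\<close> stands inside, so
  that the time does not depend on the continuation.\<close>

lemma exec_go:
  assumes "exec c s m s'" "ok_com K S c" "ok_store K S s" "\<forall>i. length (s i) \<le> L"
  shows "ok_store K S s' \<and> (\<forall>i. length (s' i) \<le> L + m) \<and>
    (\<exists>t \<le> m * (2 * (L + m) + 3). \<forall>k. go t (Run (c # k), 0, tape s) = (Run k, 0, tape s'))"
  using assms
proof (induction arbitrary: L rule: exec.induct)
  case (exec_Skip s)
  have "\<forall>k. go 1 (Run (Skip # k), 0, tape s) = (Run k, 0, tape s)"
    by (simp add: fstep_def)
  then show ?case using exec_Skip by (auto intro!: exI[of _ 1] intro: le_SucI)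
next
  case (exec_Push i a s)
  have "0 \<notin> set (s i)" using exec_Push by (simp add: ok_store_nonzero)
  then have "\<forall>k. go (2 * length (s i) + 3) (Run (Push i a # k), 0, tape s) = (Run k, 0, tape (s(i := a # s i)))"
    using exec_Push by (intro allI go_Push) auto
  moreover have "ok_store K S (s(i := a # s i))"
    using exec_Push by (intro ok_store_upd) (auto simp: ok_store_def)
  moreover have "2 * length (s i) + 3 \<le> 1 * (2 * (L + 1) + 3)" using exec_Push(3) by (simp add: le_SucI)
  moreover have "\<forall>j. length ((s(i := a # s i)) j) \<le> L + 1"
    using exec_Push(3) by (auto intro: le_SucI)
  ultimately show ?case by blast
next
  case (exec_Pop i s)
  have "0 \<notin> set (s i)" using exec_Pop by (simp add: ok_store_nonzero)
  then have "\<forall>k. go (2 * length (s i) + 3) (Run (Pop i # k), 0, tape s) = (Run k, 0, tape (s(i := tl (s i))))"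
    by (intro allI go_Pop) auto
  moreover have "ok_store K S (s(i := tl (s i)))"
  proof (rule ok_store_upd)
    have "set (tl (s i)) \<subseteq> set (s i)" by (cases "s i") auto
    then show "set (tl (s i)) \<subseteq> {0<..<S}" using exec_Pop(2) by (force simp: ok_store_def)
  qed (use exec_Pop in auto)
  moreover have "2 * length (s i) + 3 \<le> 1 * (2 * (L + 1) + 3)" using exec_Pop(3) by (simp add: le_SucI)
  moreover have "\<forall>j. length ((s(i := tl (s i))) j) \<le> L + 1"
    using exec_Pop(3) by (auto intro: le_trans[OF diff_le_self] le_SucI)
  ultimately show ?case by blast
next
  case (exec_Seq c s m s' d m' s'')
  from exec_Seq.IH(1)[of L] exec_Seq.prems obtain t where t: "ok_store K S s'" "\<forall>i. length (s' i) \<le> L + m"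
    "t \<le> m * (2 * (L + m) + 3)" "\<And>k. go t (Run (c # k), 0, tape s) = (Run k, 0, tape s')" by auto
  from exec_Seq.IH(2)[of "L + m"] exec_Seq.prems t obtain t' where t': "ok_store K S s''"
    "\<forall>i. length (s'' i) \<le> L + m + m'" "t' \<le> m' * (2 * (L + m + m') + 3)"
    "\<And>k. go t' (Run (d # k), 0, tape s') = (Run k, 0, tape s'')" by auto
  have "go (Suc (t + t')) (Run ((c ;; d) # k), 0, tape s) = (Run k, 0, tape s'')" for k
    by (rule go_Suc[OF _ go_add[OF t(4) t'(4)]]) (simp add: fstep_def)
  moreover have "Suc (t + t') \<le> (m + m' + 1) * (2 * (L + (m + m' + 1)) + 3)"
  proof -
    have "t \<le> m * (2 * (L + (m + m' + 1)) + 3)" by (rule le_trans[OF t(3)]) simp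
    moreover have "t' \<le> m' * (2 * (L + (m + m' + 1)) + 3)" by (rule le_trans[OF t'(3)]) simp
    ultimately show ?thesis by (simp add: algebra_simps)
  qed
  moreover have "\<forall>i. length (s'' i) \<le> L + (m + m' + 1)" using t'(2) by (auto intro: le_trans)
  ultimately show ?case using t'(1) by blast
next
  case (exec_Case f s i m s')
  have "ok_com K S (f (nth0 (s i) 0))" using exec_Case.prems nth0_less by auto
  from exec_Case.IH[OF this, of L] exec_Case.prems obtain t where t: "ok_store K S s'" "\<forall>i. length (s' i) \<le> L + m"
    "t \<le> m * (2 * (L + m) + 3)" "\<And>k. go t (Run (f (nth0 (s i) 0) # k), 0, tape s) = (Run k, 0, tape s')" by auto
  have "go (Suc t) (Run (Case i f # k), 0, tape s) = (Run k, 0, tape s')" for k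
    by (rule go_Suc[OF _ t(4)]) (simp add: fstep_def tape_def)
  moreover have "Suc t \<le> (m + 1) * (2 * (L + (m + 1)) + 3)" using t(3) by (simp add: algebra_simps)
  moreover have "\<forall>i. length (s' i) \<le> L + (m + 1)" using t(2) by (auto intro: le_trans)
  ultimately show ?case using t(1) by blast
next
  case (exec_While_True s i P c m s' m' s'')
  from exec_While_True.IH(1)[of L] exec_While_True.prems obtain t where t: "ok_store K S s'" "\<forall>i. length (s' i) \<le> L + m"
    "t \<le> m * (2 * (L + m) + 3)" "\<And>k. go t (Run (c # k), 0, tape s) = (Run k, 0, tape s')" by auto
  from exec_While_True.IH(2)[of "L + m"] exec_While_True.prems t obtain t' where t': "ok_store K S s''"
    "\<forall>i. length (s'' i) \<le> L + m + m'" "t' \<le> m' * (2 * (L + m + m') + 3)"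
    "\<And>k. go t' (Run (While i P c # k), 0, tape s') = (Run k, 0, tape s'')" by auto
  have "go (Suc (t + t')) (Run (While i P c # k), 0, tape s) = (Run k, 0, tape s'')" for k
    by (rule go_Suc[OF _ go_add[OF t(4) t'(4)]]) (use exec_While_True.hyps in \<open>simp add: fstep_def tape_def\<close>)
  moreover have "Suc (t + t') \<le> (m + m' + 1) * (2 * (L + (m + m' + 1)) + 3)"
  proof -
    have "t \<le> m * (2 * (L + (m + m' + 1)) + 3)" by (rule le_trans[OF t(3)]) simp
    moreover have "t' \<le> m' * (2 * (L + (m + m' + 1)) + 3)" by (rule le_trans[OF t'(3)]) simp
    ultimately show ?thesis by (simp add: algebra_simps)
  qed
  moreover have "\<forall>i. length (s'' i) \<le> L + (m + m' + 1)" using t'(2) by (auto intro: le_trans)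
  ultimately show ?case using t'(1) by blast
next
  case (exec_While_False s i P c)
  have "\<forall>k. go 1 (Run (While i P c # k), 0, tape s) = (Run k, 0, tape s)"
    using exec_While_False by (simp add: fstep_def tape_def)
  then show ?case using exec_While_False by (auto intro!: exI[of _ 1] intro: le_SucI)
next
  case (exec_weaken c s m s' m')
  from exec_weaken.IH[of L] exec_weaken.prems obtain t where t: "ok_store K S s'" "\<forall>i. length (s' i) \<le> L + m"
    "t \<le> m * (2 * (L + m) + 3)" "\<forall>k. go t (Run (c # k), 0, tape s) = (Run k, 0, tape s')" by auto
  have "t \<le> m' * (2 * (L + m') + 3)"
    by (rule le_trans[OF t(3)]) (use exec_weaken.hyps in \<open>intro mult_le_mono; simp\<close>)
  moreover have "\<forall>i. length (s' i) \<le> L + m'" using t(2) exec_weaken.hyps by (auto intro: le_trans)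
  ultimately show ?case using t by blast
qed

section \<open>Compilation to Turing machines\<close>

definition pbounded :: "(bool list \<Rightarrow> nat) \<Rightarrow> bool" where
  "pbounded g \<longleftrightarrow> (\<exists>c d. \<forall>x. g x \<le> c * (length x + 1) ^ d)"

lemma pbounded_const: "pbounded (\<lambda>x. c)"
  unfolding pbounded_def by (rule exI[of _ c], rule exI[of _ 0]) simp

lemma pbounded_length: "pbounded length"
  unfolding pbounded_def by (rule exI[of _ 1], rule exI[of _ 1]) simp

lemma pbounded_mult: assumes "pbounded f" "pbounded g" shows "pbounded (\<lambda>x. f x * g x)"
proof -
  obtain c d c' d' where "\<And>x. f x \<le> c * (length x + 1) ^ d" "\<And>x. g x \<le> c' * (length x + 1) ^ d'"
    using assms unfolding pbounded_def by blast
  then have "f x * g x \<le> (c * (length x + 1) ^ d) * (c' * (length x + 1) ^ d')" for x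
    by (intro mult_le_mono)
  then have "f x * g x \<le> (c * c') * (length x + 1) ^ (d + d')" for x
    by (simp add: power_add mult.assoc mult.left_commute)
  then show ?thesis unfolding pbounded_def by blast
qed

lemma pbounded_add: assumes "pbounded f" "pbounded g" shows "pbounded (\<lambda>x. f x + g x)"
proof -
  obtain c d c' d' where 1: "\<And>x. f x \<le> c * (length x + 1) ^ d" "\<And>x. g x \<le> c' * (length x + 1) ^ d'"
    using assms unfolding pbounded_def by blast
  have "f x + g x \<le> (c + c') * (length x + 1) ^ (d + d')" for x
  proof -
    have "c * (length x + 1) ^ d \<le> c * (length x + 1) ^ (d + d')"
      "c' * (length x + 1) ^ d' \<le> c' * (length x + 1) ^ (d + d')"
      by (intro mult_le_mono2 power_increasing; simp)+
    then have "f x + g x \<le> c * (length x + 1) ^ (d + d') + c' * (length x + 1) ^ (d + d')"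
      using 1[of x] by (meson add_mono le_trans)
    then show ?thesis by (simp add: algebra_simps)
  qed
  then show ?thesis unfolding pbounded_def by blast
qed

lemma pbounded_power: "pbounded f \<Longrightarrow> pbounded (\<lambda>x. f x ^ d)"
  by (induction d) (simp_all add: pbounded_const pbounded_mult)

lemma pbounded_Suc: "pbounded f \<Longrightarrow> pbounded (\<lambda>x. Suc (f x))"
  using pbounded_add[OF _ pbounded_const[of 1]] by simp

lemmas pbounded_intros = pbounded_const pbounded_length pbounded_mult pbounded_add pbounded_power pbounded_Suc

text \<open>The control states reachable from \<open>c # k\<close> before \<open>k\<close> is reached.\<close>

primrec conts :: "com \<Rightarrow> nat \<Rightarrow> com list \<Rightarrow> com list set" where
  "conts Skip S k = {Skip # k}"
| "conts (Push i a) S k = {Push i a # k}"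
| "conts (Pop i) S k = {Pop i # k}"
| "conts (c ;; d) S k = insert ((c ;; d) # k) (conts c S (d # k) \<union> conts d S k)"
| "conts (Case i f) S k = insert (Case i f # k) (\<Union>a<S. conts (f a) S k)"
| "conts (While i P c) S k = insert (While i P c # k) (conts c S (While i P c # k))"

lemma finite_conts: "finite (conts c S k)"
  by (induction c arbitrary: k) auto

lemma start_conts: "c # k \<in> conts c S k"
  by (cases c) auto

lemma conts_ok:
  "r \<in> conts c S k \<Longrightarrow> ok_com K S c \<Longrightarrow> list_all (ok_com K S) k \<Longrightarrow> list_all (ok_com K S) r"
proof (induction c arbitrary: k)
  case (Seq c d)
  then show ?case using Seq.IH(1)[of "d # k"] Seq.IH(2)[of k] by auto
next
  case (Case i f)
  then show ?case by auto
next
  case (While i P c)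
  then show ?case using While.IH[of "While i P c # k"] by auto
qed auto

fun kont :: "ctl \<Rightarrow> com list" where
  "kont (Run k) = k" | "kont (Ins i a k) = k" | "kont (Ret k) = k" | "kont (Seek i k) = k" | "kont (Del i a k) = k"

text \<open>A loop re-enters with its own continuation, so continuations do not pile up during
  iteration. The branch chosen by \<open>Case\<close> is in the union because the symbol read is
  below \<open>S\<close>.\<close>

lemma conts_closed:
  "r \<in> conts c S k \<Longrightarrow> \<forall>i. v i < S \<Longrightarrow> kont (fst (tr (Run r) v)) \<in> insert k (conts c S k)"
proof (induction c arbitrary: k)
  case (Seq c d)
  consider "r = (c ;; d) # k" | "r \<in> conts c S (d # k)" | "r \<in> conts d S k" using Seq.prems(1) by auto
  then show ?case
  proof cases
    case 2
    from Seq.IH(1)[OF this Seq.prems(2)] start_conts[of d k S] show ?thesis by auto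
  next
    case 3
    from Seq.IH(2)[OF this Seq.prems(2)] show ?thesis by auto
  qed (use start_conts[of c "d # k" S] in auto)
next
  case (Case i f)
  consider "r = Case i f # k" | a where "a < S" "r \<in> conts (f a) S k" using Case.prems(1) by auto
  then show ?case
  proof cases
    case 1
    then show ?thesis using start_conts[of "f (v i)" k S] Case.prems(2) by auto
  next
    case 2
    from Case.IH[OF _ this(2) Case.prems(2)] 2(1) show ?thesis by auto
  qed
next
  case (While i P c)
  consider "r = While i P c # k" | "r \<in> conts c S (While i P c # k)" using While.prems(1) by auto
  then show ?case
  proof cases
    case 2
    from While.IH[OF this While.prems(2)] show ?thesis by auto
  qed (use start_conts[of c "While i P c # k" S] in auto)
qed auto

section \<open>The finite alphabet and state set of the compiled machine\<close>

definition Syms :: "nat \<Rightarrow> nat \<Rightarrow> (nat \<Rightarrow> nat) set" where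
  "Syms K S = {v. \<forall>i. (i \<in> {..<K} \<longrightarrow> v i \<in> {..<S}) \<and> (i \<notin> {..<K} \<longrightarrow> v i = 0)}"

fun ctl_args :: "nat \<Rightarrow> nat \<Rightarrow> ctl \<Rightarrow> bool" where
  "ctl_args K S (Ins i a k) = (i < K \<and> a < S)"
| "ctl_args K S (Seek i k) = (i < K)"
| "ctl_args K S (Del i a k) = (i < K \<and> a < S)"
| "ctl_args K S _ = True"

definition States :: "nat \<Rightarrow> nat \<Rightarrow> com \<Rightarrow> ctl set" where
  "States K S c = {q. ctl_args K S q \<and> kont q \<in> insert [] (conts c S [])}"

lemma finite_Syms: "finite (Syms K S)"
  unfolding Syms_def by (rule finite_set_of_finite_funs) auto

text \<open>An injection into a product, by which the state set is seen to be finite.\<close>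

fun ctl_code :: "ctl \<Rightarrow> nat \<times> nat \<times> nat \<times> com list" where
  "ctl_code (Run k) = (0, 0, 0, k)"
| "ctl_code (Ins i a k) = (1, i, a, k)"
| "ctl_code (Ret k) = (2, 0, 0, k)"
| "ctl_code (Seek i k) = (3, i, 0, k)"
| "ctl_code (Del i a k) = (4, i, a, k)"

lemma finite_States: "finite (States K S c)"
proof (rule finite_imageD)
  have "ctl_code q \<in> {..4} \<times> {..K} \<times> {..S} \<times> insert [] (conts c S [])" if "q \<in> States K S c" for q
    using that by (cases q) (auto simp: States_def)
  then have "ctl_code ` States K S c \<subseteq> {..4} \<times> {..K} \<times> {..S} \<times> insert [] (conts c S [])"
    by (rule image_subsetI)
  then show "finite (ctl_code ` States K S c)"
    by (rule finite_subset) (intro finite_cartesian_product finite_insert[THEN iffD2] finite_conts finite_atMost)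
  have "p = q" if "ctl_code p = ctl_code q" for p q
    using that by (cases p; cases q) auto
  then show "inj_on ctl_code (States K S c)" by (rule inj_onI)
qed

lemma Syms_upd: "v \<in> Syms K S \<Longrightarrow> i < K \<Longrightarrow> a < S \<Longrightarrow> v(i := a) \<in> Syms K S"
  by (auto simp: Syms_def)

lemma Syms_less: "v \<in> Syms K S \<Longrightarrow> 0 < S \<Longrightarrow> v i < S"
  by (cases "i < K") (auto simp: Syms_def)

lemma tr_closed:
  assumes "q \<in> States K S c" "v \<in> Syms K S" "ok_com K S c" "0 < S" "tr q v = (q', w, m)"
  shows "q' \<in> States K S c \<and> w \<in> Syms K S"
proof (cases q)
  case (Run r)
  show ?thesis
  proof (cases r)
    case Nil
    then show ?thesis using assms Run by auto
  next
    case (Cons e k)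
    then have r: "r \<in> conts c S []" using assms(1) Run by (auto simp: States_def)
    have "kont q' \<in> insert [] (conts c S [])"
      using conts_closed[OF r, of v] Syms_less[OF assms(2,4)] assms(5) Run by auto
    moreover have "ok_com K S e" using conts_ok[OF r assms(3)] Cons by simp
    ultimately show ?thesis using assms(2,5) Run Cons by (cases e) (auto simp: States_def)
  qed
next
  case (Ins i a k)
  then have "i < K" "a < S" "k \<in> insert [] (conts c S [])" using assms(1) by (auto simp: States_def)
  then show ?thesis using assms(5) Ins Syms_upd[OF assms(2)] Syms_less[OF assms(2,4), of i]
    by (cases "v i = 0") (auto simp: States_def)
next
  case (Ret k)
  then have "k \<in> insert [] (conts c S [])" using assms(1) by (auto simp: States_def)
  then show ?thesis using assms(2,5) Ret by (cases "v = (\<lambda>_. 0)") (auto simp: States_def)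
next
  case (Seek i k)
  then have "i < K" "k \<in> insert [] (conts c S [])" using assms(1) by (auto simp: States_def)
  then show ?thesis using assms(2,4,5) Seek by (cases "v i = 0") (auto simp: States_def)
next
  case (Del i a k)
  then have "i < K" "a < S" "k \<in> insert [] (conts c S [])" using assms(1) by (auto simp: States_def)
  then show ?thesis using assms(2,5) Del Syms_upd[OF assms(2)] Syms_less[OF assms(2,4), of i]
    by (cases "v = (\<lambda>_. 0)") (auto simp: States_def)
qed

text \<open>A \<open>tm\<close> reserves small numbers for the start state, the halting state, the
  blank and the two bits; an arbitrary numbering of a finite set would not respect them.\<close>

lemma finite_enumeration:
  assumes "finite A" "set xs \<subseteq> A" "distinct xs"
  shows "\<exists>e. bij_betw e A {..<card A} \<and> (\<forall>j<length xs. e (xs ! j) = j)"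
proof -
  obtain ys where ys: "set ys = A - set xs" "distinct ys"
    using finite_distinct_list[of "A - set xs"] assms(1) by auto
  let ?zs = "xs @ ys"
  have zs: "set ?zs = A" "distinct ?zs" using ys assms by auto
  then have len: "length ?zs = card A" using distinct_card[OF zs(2)] by simp
  have b: "bij_betw (\<lambda>i. ?zs ! i) {..<card A} A"
    by (rule bij_betw_nth[OF zs(2)]) (simp_all only: len zs(1))
  let ?e = "inv_into {..<card A} (\<lambda>i. ?zs ! i)"
  have "?e (xs ! j) = j" if "j < length xs" for j
  proof -
    have "?e (?zs ! j) = j" using b that len by (intro inv_into_f_f) (auto simp: bij_betw_def)
    then show ?thesis using that by (simp add: nth_append)
  qed
  then show ?thesis using bij_betw_inv_into[OF b] by blast
qed

definition single_store :: "bool list \<Rightarrow> store" where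
  "single_store x = (\<lambda>_. [])(0 := map sym_of_bit x)"

text \<open>Input and output occupy track 0 alone, so that their cells are exactly the ones numbered
  0, 1 and 2 for blank and bits.\<close>

lemma exec_poly_time_computable:
  assumes ok: "ok_com K S c" "2 < S" "0 < K"
    and ex: "\<And>x. exec c (single_store x) (B x) (single_store (f x))"
    and B: "pbounded B"
  shows "poly_time_computable f"
proof -
  let ?Q = "States K S c" and ?A = "Syms K S"
  let ?b = "\<lambda>n. (\<lambda>_ :: nat. 0 :: nat)(0 := n)"
  have "\<exists>e. bij_betw e ?Q {..<card ?Q} \<and> (\<forall>j<length [Run [c], Run []]. e ([Run [c], Run []] ! j) = j)"
    by (rule finite_enumeration[OF finite_States, where xs = "[Run [c], Run []]"]) (auto simp: States_def start_conts)
  then obtain e where e: "bij_betw e ?Q {..<card ?Q}"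
    and e': "\<forall>j<length [Run [c], Run []]. e ([Run [c], Run []] ! j) = j" by blast
  have e0: "e (Run [c]) = 0" "e (Run []) = 1" using e'[rule_format, of 0] e'[rule_format, of 1] by auto
  have "\<exists>g. bij_betw g ?A {..<card ?A} \<and> (\<forall>j<length [?b 0, ?b 1, ?b 2]. g ([?b 0, ?b 1, ?b 2] ! j) = j)"
    by (rule finite_enumeration[OF finite_Syms, where xs = "[?b 0, ?b 1, ?b 2]"]) (use ok in \<open>auto simp: Syms_def fun_eq_iff\<close>)
  then obtain g where g: "bij_betw g ?A {..<card ?A}"
    and g': "\<forall>j<length [?b 0, ?b 1, ?b 2]. g ([?b 0, ?b 1, ?b 2] ! j) = j" by blast
  have g0: "g (?b 0) = 0" "g (?b 1) = 1" "g (?b 2) = 2"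
    using g'[rule_format, of 0] g'[rule_format, of 1] g'[rule_format, of 2] by auto
  define M where "M = \<lparr>nstates = card ?Q, nsyms = card ?A,
    delta = \<lambda>q s. case tr (inv_into ?Q e q) (inv_into ?A g s) of (q', w, m) \<Rightarrow> (e q', g w, m)\<rparr>"
  have inv: "inv_into ?Q e (e q) = q" "inv_into ?A g (g v) = v" if "q \<in> ?Q" "v \<in> ?A" for q v
    using that e g by (auto simp: bij_betw_def)
  have im: "e q < card ?Q" "g v < card ?A" if "q \<in> ?Q" "v \<in> ?A" for q v
    using that e g by (auto simp: bij_betw_def)
  have Q0: "Run [c] \<in> ?Q" "Run [] \<in> ?Q" by (auto simp: States_def start_conts)
  have A0: "?b 0 \<in> ?A" "?b 2 \<in> ?A" using ok by (auto simp: Syms_def)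
  have wf: "wf_tm M"
    unfolding wf_tm_def
  proof (intro conjI allI impI)
    show "2 \<le> nstates M" using im(1)[OF Q0(2) A0(1)] e0 by (simp add: M_def)
    show "3 \<le> nsyms M" using im(2)[OF Q0(2) A0(2)] g0 by (simp add: M_def)
    fix q s assume qs: "q < nstates M" "s < nsyms M"
    have "inv_into ?Q e q \<in> ?Q" "inv_into ?A g s \<in> ?A"
      using qs e g by (auto simp: M_def bij_betw_def intro!: inv_into_into)
    then show "case delta M q s of (q', w, m) \<Rightarrow> q' < nstates M \<and> w < nsyms M"
      using tr_closed[of "inv_into ?Q e q" K S c "inv_into ?A g s"] ok im
      by (auto simp: M_def split: prod.split)
  qed
  define enc where "enc = (\<lambda>(q, h :: int, T). (e q, h, \<lambda>p :: int. g (T p)))"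
  define good where "good = (\<lambda>(q, h :: int, T). q \<in> ?Q \<and> (\<forall>p :: int. T p \<in> ?A))"
  \<comment> \<open>\<open>Run []\<close> loops under \<open>tr\<close> just as the halting state 1
    does under \<open>ndelta\<close>, so the two machines agree step for step, also after
    halting.\<close>
  have sim1: "good (fstep tr z) \<and> fstep (ndelta M) (enc z) = enc (fstep tr z)" if "good z" for z
  proof -
    obtain q h T where z: "z = (q, h, T)" by (cases z)
    have qT: "q \<in> ?Q" "\<And>p. T p \<in> ?A" using that by (auto simp: z good_def)
    obtain q' w m where t: "tr q (T h) = (q', w, m)" by (cases "tr q (T h)")
    have c': "q' \<in> ?Q" "w \<in> ?A" using tr_closed[OF qT(1) qT(2) ok(1) _ t] ok by auto
    have "ndelta M (e q) (g (T h)) = (e q', g w, m)"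
    proof (cases "q = Run []")
      case True
      then show ?thesis using t e0 by (auto simp: ndelta_def)
    next
      case False
      then have "e q \<noteq> 1" using e e0 Q0 qT by (metis bij_betw_def inj_on_eq_iff)
      then show ?thesis using t inv[OF qT(1) qT(2)] by (simp add: ndelta_def M_def)
    qed
    then show ?thesis using t c' qT by (auto simp: z good_def enc_def fstep_def)
  qed
  have sim: "good ((fstep tr ^^ t) z) \<and> (fstep (ndelta M) ^^ t) (enc z) = enc ((fstep tr ^^ t) z)" if "good z" for t z
    using that by (induction t) (auto simp: sim1)
  have cell: "g (tape (single_store x) p) = init_tape x p" for x p
  proof -
    have "tape (single_store x) p = ?b (init_tape x p)"
      by (auto simp: tape_def single_store_def init_tape_def fun_eq_iff)
    moreover have "init_tape x p = 0 \<or> init_tape x p = 1 \<or> init_tape x p = 2"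
      by (auto simp: init_tape_def nth0_def sym_of_bit_def)
    ultimately show ?thesis using g0 by (elim disjE) simp_all
  qed
  have enc_init: "enc (q, h, tape (single_store x)) = (e q, h, init_tape x)" for q h x
    by (simp add: enc_def cell)
  have main: "\<exists>t \<le> B x * (2 * (length x + B x) + 3). fst ((step M ^^ t) (init_config x)) = 1 \<and>
      tm_output ((step M ^^ t) (init_config x)) = f x" for x
  proof -
    have "ok_store K S (single_store x)" using ok
      by (auto simp: ok_store_def single_store_def sym_of_bit_def)
    moreover have "\<forall>i. length (single_store x i) \<le> length x" by (simp add: single_store_def)
    ultimately obtain t where t: "t \<le> B x * (2 * (length x + B x) + 3)"
      "go t (Run [c], 0, tape (single_store x)) = (Run [], 0, tape (single_store (f x)))"
      using exec_go[OF ex[of x] ok(1)] by blast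
    have "good (Run [c], 0, tape (single_store x))"
      using Q0 ok by (auto simp: good_def Syms_def tape_def single_store_def nth0_def sym_of_bit_def)
    from sim[OF this, of t] t(2) have "(fstep (ndelta M) ^^ t) (0, 0, init_tape x) = (1, 0, init_tape (f x))"
      by (simp add: enc_init e0 go_def)
    then have fin: "tape_of ((step M ^^ t) (init_config x)) (1, 0, init_tape (f x))"
      using tape_of_steps[OF tape_of_init[of x], of t M] by simp
    then have "fst ((step M ^^ t) (init_config x)) = 1" by (auto simp: tape_of_def split: prod.splits)
    moreover have "tm_output ((step M ^^ t) (init_config x)) = f x"
      by (rule tm_output_eqI[OF fin]) (simp add: init_tape_def)
    ultimately show ?thesis using t(1) by blast
  qed
  have "pbounded (\<lambda>x. B x * (2 * (length x + B x) + 3))"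
    by (intro pbounded_intros B)
  then obtain a d where "\<And>x. B x * (2 * (length x + B x) + 3) \<le> a * (length x + 1) ^ d"
    unfolding pbounded_def by blast
  then have "\<exists>t \<le> a * (length x + 1) ^ d. fst ((step M ^^ t) (init_config x)) = 1 \<and>
      tm_output ((step M ^^ t) (init_config x)) = f x" for x
    using main[of x] by (meson le_trans)
  then show ?thesis unfolding poly_time_computable_def using wf by blast
qed

section \<open>Counters, emission of numbers, and powers\<close>

lemma exec_eq: "exec c s m s' \<Longrightarrow> s' = s'' \<Longrightarrow> m \<le> m' \<Longrightarrow> exec c s m' s''"
  using exec_weaken by simp

text \<open>Inside the loop the branch for 0 is never taken; it keeps \<open>ok_com\<close> from
  demanding anything of \<open>g 0\<close>, which may push a blank.\<close>

definition Drain :: "nat \<Rightarrow> (nat \<Rightarrow> com) \<Rightarrow> com" where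
  "Drain i g = While i (- {0}) (Case i (\<lambda>a. if a = 0 then Skip else Pop i ;; g a))"

lemma ok_Drain: "i < K \<Longrightarrow> (\<And>a. 0 < a \<Longrightarrow> a < S \<Longrightarrow> ok_com K S (g a)) \<Longrightarrow> ok_com K S (Drain i g)"
  by (auto simp: Drain_def)

text \<open>\<open>F zs\<close> is a loop invariant indexed by the symbols consumed so far, with
  stack \<open>i\<close> overwritten by what is left. The extra 4 per round pay for loop test, case,
  pop and sequencing.\<close>

lemma exec_Drain:
  assumes "0 \<notin> set xs"
    and "\<And>zs a ys. xs = zs @ a # ys \<Longrightarrow> exec (g a) ((F zs)(i := ys)) m ((F (zs @ [a]))(i := ys))"
  shows "exec (Drain i g) ((F [])(i := xs)) (length xs * (m + 4) + 1) ((F xs)(i := []))"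
proof -
  have "exec (Drain i g) ((F zs)(i := ys)) (length ys * (m + 4) + 1) ((F xs)(i := []))" if "xs = zs @ ys" for zs ys
    using that
  proof (induction ys arbitrary: zs)
    case Nil
    have "exec (Drain i g) ((F zs)(i := [])) 1 ((F zs)(i := []))"
      unfolding Drain_def by (rule exec_While_False) simp
    then show ?case by (rule exec_eq) (use Nil in \<open>simp_all add: fun_eq_iff\<close>)
  next
    case (Cons a ys)
    let ?s = "(F zs)(i := a # ys)"
    have "a \<noteq> 0" using assms(1) Cons.prems by auto
    moreover have "exec (Case i (\<lambda>a. if a = 0 then Skip else Pop i ;; g a)) ?s (1 + m + 1 + 1) ((F (zs @ [a]))(i := ys))"
      using assms(2)[OF Cons.prems] exec_Pop[of i ?s] exec_Seq[of "Pop i" ?s 1] \<open>a \<noteq> 0\<close> by (intro exec_Case) simp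
    moreover have "exec (Drain i g) ((F (zs @ [a]))(i := ys)) (length ys * (m + 4) + 1) ((F xs)(i := []))"
      by (rule Cons.IH) (use Cons.prems in simp)
    ultimately have "exec (Drain i g) ?s ((1 + m + 1 + 1) + (length ys * (m + 4) + 1) + 1) ((F xs)(i := []))"
      unfolding Drain_def by (intro exec_While_True) auto
    then show ?case by (rule exec_weaken) simp
  qed
  from this[of "[]" xs] show ?thesis by (simp only: append_Nil simp_thms)
qed

text \<open>The shape of the store becomes a proof obligation, so the rule applies to stores in any
  syntactic form.\<close>

lemma exec_Drain_store:
  assumes "0 \<notin> set (s i)" "s = (F [])(i := s i)"
    and "\<And>zs a ys. s i = zs @ a # ys \<Longrightarrow> exec (g a) ((F zs)(i := ys)) m ((F (zs @ [a]))(i := ys))"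
    and "s' = (F (s i))(i := [])" "length (s i) * (m + 4) + 1 \<le> m'"
  shows "exec (Drain i g) s m' s'"
proof -
  have "exec (Drain i g) ((F [])(i := s i)) (length (s i) * (m + 4) + 1) ((F (s i))(i := []))"
    by (rule exec_Drain[OF assms(1)]) (rule assms(3))
  then show ?thesis
    by (subst assms(2)) (rule exec_eq[OF _ assms(4)[symmetric] assms(5)])
qed

lemma exec_SeqI: "exec c s m s' \<Longrightarrow> exec d s' m' s'' \<Longrightarrow> m + m' + 1 \<le> n \<Longrightarrow> exec (c ;; d) s n s''"
  using exec_Seq exec_weaken by blast

lemma exec_Move:
  assumes "0 \<notin> set (s i)" "i \<noteq> j"
  shows "exec (Drain i (Push j)) s (5 * length (s i) + 1) (s(i := [], j := rev (s i) @ s j))"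
proof (rule exec_Drain_store[where F = "\<lambda>zs. s(j := rev zs @ s j)" and m = 1])
  fix zs a ys
  show "exec (Push j a) ((s(j := rev zs @ s j))(i := ys)) 1 ((s(j := rev (zs @ [a]) @ s j))(i := ys))"
    using assms exec_Push[of j a "(s(j := rev zs @ s j))(i := ys)"] by (simp add: fun_upd_twist)
qed (use assms in \<open>auto simp: fun_eq_iff\<close>)

section \<open>Binary counters\<close>

lemma length_bin: "length (bin n) \<le> n"
proof (induction n rule: bin.induct)
  case (1 n)
  show ?case
  proof (cases "n = 0")
    case False
    then have "length (bin n) \<le> Suc (n div 2)" using 1 by (simp add: bin.simps[of n])
    also have "\<dots> \<le> n" using False by linarith
    finally show ?thesis .
  qed (simp add: bin.simps)
qed

fun binc :: "bool list \<Rightarrow> bool list" where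
  "binc [] = [True]"
| "binc (False # b) = True # b"
| "binc (True # b) = False # binc b"

lemma bin_Suc: "bin (Suc n) = binc (bin n)"
proof (induction n rule: bin.induct)
  case (1 n)
  show ?case
  proof (cases "n = 0")
    case True
    then show ?thesis by (simp add: bin.simps)
  next
    case False
    have b: "bin n = odd n # bin (n div 2)" "bin (Suc n) = odd (Suc n) # bin (Suc n div 2)"
      using False by (simp_all add: bin.simps[of n] bin.simps[of "Suc n"])
    show ?thesis
    proof (cases "odd n")
      case True
      then show ?thesis using b 1[OF False] by simp
    next
      case f2: False
      then show ?thesis using b by simp
    qed
  qed
qed

abbreviation bsym :: "nat \<Rightarrow> nat list" where
  "bsym n \<equiv> map sym_of_bit (bin n)"

lemma sym_of_bit_simps [simp]: "sym_of_bit True = 2" "sym_of_bit False = 1"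
  by (auto simp: sym_of_bit_def)

lemma zero_notin_sym [simp]: "0 \<notin> sym_of_bit ` A"
  by (auto simp: sym_of_bit_def)

text \<open>The least significant bit is on top. The leading run of ones becomes zeros parked on
  stack 3, the following zero or the end of the number becomes a one, and the parked zeros
  return.\<close>

definition Inc :: "nat \<Rightarrow> com" where
  "Inc i = While i {2} (Pop i ;; Push 3 1) ;; Case i (\<lambda>a. if a = 1 then Pop i else Skip) ;; Push i 2 ;; Drain 3 (Push i)"

lemma ok_Inc: "i < K \<Longrightarrow> 3 < K \<Longrightarrow> 2 < S \<Longrightarrow> ok_com K S (Inc i)"
  by (auto simp: Inc_def intro!: ok_Drain)

lemma binc_replicate: "binc (replicate r True @ b) = replicate r False @ binc b"
  by (induction r) auto

lemma exec_Inc: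
  assumes "s i = bsym n" "s 3 = []" "i \<noteq> 3"
  shows "exec (Inc i) s (9 * n + 11) (s(i := bsym (Suc n)))"
proof -
  obtain r b where rb: "bin n = replicate r True @ b" "b = [] \<or> (\<exists>b'. b = False # b')"
  proof -
    have "\<exists>r b. u = replicate r True @ b \<and> (b = [] \<or> (\<exists>b'. b = False # b'))" for u
    proof (induction u)
      case (Cons a u)
      then obtain r b where "u = replicate r True @ b" "b = [] \<or> (\<exists>b'. b = False # b')" by auto
      then show ?case
        by (cases a) (auto intro: exI[of _ "Suc r"] exI[of _ 0])
    qed auto
    then show ?thesis using that by blast
  qed
  let ?b = "map sym_of_bit b"
  have r: "r \<le> n" using length_bin[of n] rb(1) by simp
  have loop: "exec (While i {2} (Pop i ;; Push 3 1)) (s(i := replicate q 2 @ ?b, 3 := e)) (4 * q + 1)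
      (s(i := ?b, 3 := replicate q 1 @ e))" for q e
  proof (induction q arbitrary: e)
    case 0
    have "nth0 ?b 0 \<noteq> 2" using rb(2) by auto
    then have "nth0 ((s(i := ?b, 3 := e)) i) 0 \<notin> {2}" using assms(3) by simp
    then have "exec (While i {2} (Pop i ;; Push 3 1)) (s(i := ?b, 3 := e)) 1 (s(i := ?b, 3 := e))"
      by (rule exec_While_False)
    then show ?case by (simp only: replicate_0 append_Nil mult_0_right add_0)
  next
    case (Suc q)
    let ?s = "s(i := replicate (Suc q) 2 @ ?b, 3 := e)"
    have body: "exec (Pop i ;; Push 3 1) ?s (1 + 1 + 1) (s(i := replicate q 2 @ ?b, 3 := 1 # e))"
      using exec_Seq[OF exec_Pop[of i ?s] exec_Push[of 3 1]] assms(3)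
      by (simp add: fun_upd_twist)
    have "nth0 (?s i) 0 \<in> {2}" using assms(3) by simp
    from exec_While_True[OF this body Suc.IH]
    have "exec (While i {2} (Pop i ;; Push 3 1)) ?s ((1 + 1 + 1) + (4 * q + 1) + 1)
        (s(i := ?b, 3 := replicate q 1 @ 1 # e))" .
    then show ?case by (rule exec_eq) (simp_all add: fun_eq_iff replicate_app_Cons_same)
  qed
  have "s(i := replicate r 2 @ ?b, 3 := []) = s" using assms rb(1) by (auto simp: fun_eq_iff)
  then have 1: "exec (While i {2} (Pop i ;; Push 3 1)) s (4 * r + 1) (s(i := ?b, 3 := replicate r 1))"
    using loop[of r "[]"] by simp
  have 2: "exec (Case i (\<lambda>a. if a = 1 then Pop i else Skip)) (s(i := ?b, 3 := replicate r 1)) 2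
      (s(i := tl ?b, 3 := replicate r 1))"
  proof (cases b)
    case Nil
    have "exec (Case i (\<lambda>a. if a = 1 then Pop i else Skip)) (s(i := ?b, 3 := replicate r 1)) (1 + 1)
      (s(i := ?b, 3 := replicate r 1))"
      by (rule exec_Case) (use Nil assms(3) exec_Skip in simp)
    then show ?thesis by (rule exec_eq) (use Nil in simp_all)
  next
    case (Cons a b')
    have "exec (Case i (\<lambda>a. if a = 1 then Pop i else Skip)) (s(i := ?b, 3 := replicate r 1)) (1 + 1)
      ((s(i := ?b, 3 := replicate r 1))(i := tl ((s(i := ?b, 3 := replicate r 1)) i)))"
      by (rule exec_Case) (use Cons rb(2) assms(3) exec_Pop[of i "s(i := ?b, 3 := replicate r 1)"] in simp)
    then show ?thesis by (rule exec_eq) (use assms(3) in \<open>simp_all add: fun_eq_iff\<close>)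
  qed
  have 3: "exec (Push i 2) (s(i := tl ?b, 3 := replicate r 1)) 1 (s(i := 2 # tl ?b, 3 := replicate r 1))"
    using exec_Push[of i 2 "s(i := tl ?b, 3 := replicate r 1)"] assms(3) by (simp add: fun_upd_twist)
  have 4: "exec (Drain 3 (Push i)) (s(i := 2 # tl ?b, 3 := replicate r 1)) (5 * r + 1)
      (s(i := replicate r 1 @ 2 # tl ?b))"
    using exec_Move[of "s(i := 2 # tl ?b, 3 := replicate r 1)" 3 i] assms(2,3)
    by (auto elim!: exec_eq simp: fun_eq_iff)
  have "binc b = True # tl b" using rb(2) by auto
  then have "replicate r 1 @ 2 # tl ?b = bsym (Suc n)"
    by (simp add: bin_Suc rb(1) binc_replicate map_tl[symmetric])
  then show ?thesis unfolding Inc_def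
    using r by (intro exec_SeqI[OF 1 exec_SeqI[OF 2 exec_SeqI[OF 3 exec_eq[OF 4]]]]) auto
qed

section \<open>Emission of codes of numbers\<close>

definition emits :: "bool list \<Rightarrow> com" where
  "emits bs = foldr (\<lambda>b c. Push 1 (sym_of_bit b) ;; c) bs Skip"

lemma exec_emits: "exec (emits bs) s (2 * length bs + 1) (s(1 := rev (map sym_of_bit bs) @ s 1))"
proof (induction bs arbitrary: s)
  case Nil
  then show ?case using exec_Skip[of s] by (simp add: emits_def)
next
  case (Cons b bs)
  from exec_Seq[OF exec_Push[of 1 "sym_of_bit b" s] Cons[of "s(1 := sym_of_bit b # s 1)"]]
  show ?case by (auto simp: emits_def elim!: exec_eq)
qed

abbreviation doubled :: "'a list \<Rightarrow> 'a list" where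
  "doubled bs \<equiv> concat (map (\<lambda>b. [b, b]) bs)"

text \<open>Reading a counter destroys it, hence the copy on stack 3 from which it is restored.
  Doubling is compatible with the reversed output, a pair of equal bits being a palindrome.\<close>

definition EmitCtr :: "nat \<Rightarrow> com" where
  "EmitCtr c = Drain c (\<lambda>a. Push 1 a ;; Push 1 a ;; Push 3 a) ;; Drain 3 (Push c)"

lemma rev_doubled: "rev (doubled bs) = doubled (rev bs)"
  by (induction bs) auto

lemma exec_EmitCtr:
  assumes "s c = bsym n" "s 3 = []" "c \<noteq> 3" "c \<noteq> 1"
  shows "exec (EmitCtr c) s (14 * n + 3) (s(1 := rev (map sym_of_bit (doubled (bin n))) @ s 1))"
proof -
  let ?F = "\<lambda>zs. s(1 := rev (doubled zs) @ s 1, 3 := rev zs)"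
  have "exec (Drain c (\<lambda>a. Push 1 a ;; Push 1 a ;; Push 3 a)) s (length (s c) * (5 + 4) + 1)
    ((?F (s c))(c := []))"
  proof (rule exec_Drain_store[where F = ?F and m = 5])
    fix zs a ys
    show "exec (Push 1 a ;; Push 1 a ;; Push 3 a) ((?F zs)(c := ys)) 5 ((?F (zs @ [a]))(c := ys))"
      by (rule exec_eq[OF exec_SeqI[OF exec_Push exec_SeqI[OF exec_Push exec_Push order_refl] order_refl]])
        (use assms in \<open>auto simp: fun_eq_iff\<close>)
  qed (use assms in \<open>auto simp: fun_eq_iff\<close>)
  moreover have "exec (Drain 3 (Push c)) ((?F (s c))(c := [])) (5 * length (s c) + 1)
     (s(1 := rev (map sym_of_bit (doubled (bin n))) @ s 1))"
    by (rule exec_eq[OF exec_Move]) (use assms in \<open>auto simp: fun_eq_iff map_concat comp_def\<close>)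
  moreover have "(length (s c) * (5 + 4) + 1) + (5 * length (s c) + 1) + 1 \<le> 14 * n + 3"
    using length_bin[of n] assms(1) by simp
  ultimately show ?thesis unfolding EmitCtr_def by (rule exec_SeqI)
qed

fun low_bits :: "nat \<Rightarrow> nat \<Rightarrow> bool list" where
  "low_bits 0 s = []"
| "low_bits (Suc k) s = odd s # low_bits k (s div 2)"

lemma length_low_bits [simp]: "length (low_bits k s) = k"
  by (induction k arbitrary: s) auto

text \<open>With \<open>v = 0\<close> the binary code would drop leading zeros of the low part.
  Every counter used in a hole is therefore kept positive, and positions start at 1.\<close>

lemma bin_low_bits: "s < 2 ^ k \<Longrightarrow> 0 < v \<Longrightarrow> bin (s + 2 ^ k * v) = low_bits k s @ bin v"
proof (induction k arbitrary: s)
  case (Suc k)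
  have "(s + 2 * (2 ^ k * v)) div 2 = s div 2 + 2 ^ k * v" by simp
  then have "bin (s + 2 ^ Suc k * v) = odd s # bin (s div 2 + 2 ^ k * v)"
    using Suc.prems by (simp add: bin.simps[of "s + 2 * (2 ^ k * v)"] mult.assoc add.commute)
  then show ?case using Suc by simp
qed simp

text \<open>A template for a number: a constant, or \<open>k\<close> fixed low bits holding
  \<open>s\<close>, followed by the current value of counter \<open>c\<close>.\<close>

datatype tok = Lit nat | Hole nat nat nat

fun tok_num :: "(nat \<Rightarrow> nat) \<Rightarrow> tok \<Rightarrow> nat" where
  "tok_num env (Lit v) = v"
| "tok_num env (Hole k s c) = s + 2 ^ k * env c"

fun tok_ok :: "nat set \<Rightarrow> tok \<Rightarrow> bool" where
  "tok_ok C (Lit v) = True"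
| "tok_ok C (Hole k s c) = (s < 2 ^ k \<and> c \<in> C)"

fun EmitTok :: "tok \<Rightarrow> com" where
  "EmitTok (Lit v) = emits (enc_nat v)"
| "EmitTok (Hole k s c) = emits (doubled (low_bits k s)) ;; EmitCtr c ;; emits [False, True]"

fun tok_cost :: "tok \<Rightarrow> nat" where
  "tok_cost (Lit v) = 2 * length (enc_nat v) + 1"
| "tok_cost (Hole k s c) = 4 * k + 25"

lemma length_doubled [simp]: "length (doubled bs) = 2 * length bs"
  by (induction bs) auto

lemma exec_EmitTok:
  assumes "tok_ok C t" "\<And>c. c \<in> C \<Longrightarrow> s c = bsym (env c) \<and> 0 < env c \<and> env c \<le> M" "s 3 = []" "C \<inter> {1, 3} = {}"
  shows "exec (EmitTok t) s (tok_cost t * (M + 1)) (s(1 := rev (map sym_of_bit (enc_nat (tok_num env t))) @ s 1))"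
proof (cases t)
  case (Lit v)
  show ?thesis using exec_eq[OF exec_emits[of "enc_nat v" s] refl, of "tok_cost t * (M + 1)"] Lit by simp
next
  case (Hole k a c)
  then have c: "c \<in> C" "a < 2 ^ k" "c \<noteq> 1" "c \<noteq> 3" using assms by auto
  have v: "s c = bsym (env c)" "0 < env c" "env c \<le> M" using assms(2)[OF c(1)] by auto
  have e: "enc_nat (tok_num env t) = doubled (low_bits k a) @ doubled (bin (env c)) @ [False, True]"
    using Hole c v by (simp add: enc_nat_def bin_low_bits)
  let ?s1 = "s(1 := rev (map sym_of_bit (doubled (low_bits k a))) @ s 1)"
  let ?s2 = "?s1(1 := rev (map sym_of_bit (doubled (bin (env c)))) @ ?s1 1)"
  have "exec (EmitCtr c) ?s1 (14 * env c + 3) ?s2"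
    using v c assms(3) by (intro exec_EmitCtr) auto
  from exec_SeqI[OF exec_emits[of "doubled (low_bits k a)" s]
      exec_SeqI[OF this exec_emits[of "[False, True]" ?s2] order_refl] order_refl]
  show ?thesis unfolding e
    by (simp add: Hole) (erule exec_eq, use v in \<open>auto simp: algebra_simps\<close>)
qed

definition EmitToks :: "tok list \<Rightarrow> com" where
  "EmitToks ts = foldr (\<lambda>t c. EmitTok t ;; c) ts Skip"

definition toks_cost :: "tok list \<Rightarrow> nat" where
  "toks_cost ts = sum_list (map (\<lambda>t. tok_cost t + 1) ts) + 1"

lemma exec_EmitToks:
  assumes "list_all (tok_ok C) ts" "\<And>c. c \<in> C \<Longrightarrow> s c = bsym (env c) \<and> 0 < env c \<and> env c \<le> M" "s 3 = []" "C \<inter> {1, 3} = {}"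
  shows "exec (EmitToks ts) s (toks_cost ts * (M + 1))
    (s(1 := rev (map sym_of_bit (concat (map enc_nat (map (tok_num env) ts)))) @ s 1))"
  using assms(1-3)
proof (induction ts arbitrary: s)
  case Nil
  then show ?case using exec_eq[OF exec_Skip[of s], of s "M + 1"] by (simp add: EmitToks_def toks_cost_def)
next
  case (Cons t ts)
  let ?s = "s(1 := rev (map sym_of_bit (enc_nat (tok_num env t))) @ s 1)"
  have 1: "exec (EmitTok t) s (tok_cost t * (M + 1)) ?s"
    using Cons.prems assms(4) by (intro exec_EmitTok) auto
  have 2: "exec (EmitToks ts) ?s (toks_cost ts * (M + 1))
    (?s(1 := rev (map sym_of_bit (concat (map enc_nat (map (tok_num env) ts)))) @ ?s 1))"
  proof (rule Cons.IH)
    show "?s c = bsym (env c) \<and> 0 < env c \<and> env c \<le> M" if "c \<in> C" for c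
      using Cons.prems(2)[OF that] assms(4) that by auto
  qed (use Cons.prems in auto)
  have "exec (EmitToks (t # ts)) s (tok_cost t * (M + 1) + toks_cost ts * (M + 1) + 1)
    (?s(1 := rev (map sym_of_bit (concat (map enc_nat (map (tok_num env) ts)))) @ ?s 1))"
    using exec_Seq[OF 1 2] by (simp add: EmitToks_def)
  then show ?case
    by (rule exec_eq) (auto simp: toks_cost_def algebra_simps)
qed

lemma ok_emits: "1 < K \<Longrightarrow> 2 < S \<Longrightarrow> ok_com K S (emits bs)"
  by (induction bs) (auto simp: emits_def sym_of_bit_def)

lemma ok_EmitTok: "tok_ok C t \<Longrightarrow> C \<subseteq> {..<K} \<Longrightarrow> 3 < K \<Longrightarrow> 2 < S \<Longrightarrow> ok_com K S (EmitTok t)"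
  by (cases t) (auto simp: EmitCtr_def intro!: ok_emits ok_Drain)

lemma ok_EmitToks: "list_all (tok_ok C) ts \<Longrightarrow> C \<subseteq> {..<K} \<Longrightarrow> 3 < K \<Longrightarrow> 2 < S \<Longrightarrow> ok_com K S (EmitToks ts)"
  by (induction ts) (auto simp: EmitToks_def intro: ok_EmitTok)

section \<open>Unary multiplication and powers\<close>

definition Mul :: "nat \<Rightarrow> nat \<Rightarrow> com" where
  "Mul src dst = Drain dst (Push 3) ;;
     Drain 3 (\<lambda>_. Push dst 1 ;; Drain src (\<lambda>a. Push 2 a ;; Push dst 1) ;; Drain 2 (Push src))"

text \<open>Each old unit of \<open>dst\<close>, parked on stack 3, is replaced by one unit and one
  more per symbol of \<open>src\<close>. The factor \<open>length (s src) + 1\<close> is the base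
  occurring in the bounds of \<open>poly_time_computable\<close> and \<open>in_NP\<close>.\<close>

lemma exec_Mul:
  assumes "s dst = replicate q 1" "s 2 = []" "s 3 = []" "0 \<notin> set (s src)"
    and "src \<noteq> dst" "src \<notin> {2, 3}" "dst \<notin> {2, 3}"
  shows "exec (Mul src dst) s (q * (12 * length (s src) + 14) + 3)
    (s(dst := replicate (q * (length (s src) + 1)) 1))"
proof -
  let ?n = "length (s src)"
  let ?F = "\<lambda>zs :: nat list. s(dst := replicate (length zs * (?n + 1)) 1)"
  let ?s0 = "s(dst := [], 3 := replicate q 1)"
  have 1: "exec (Drain dst (Push 3)) s (5 * q + 1) ?s0"
    by (rule exec_eq[OF exec_Move]) (use assms in \<open>auto simp: fun_eq_iff\<close>)
  have 2: "exec (Drain 3 (\<lambda>_. Push dst 1 ;; Drain src (\<lambda>a. Push 2 a ;; Push dst 1) ;; Drain 2 (Push src))) ?s0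
     (q * (12 * ?n + 9) + 1) (s(dst := replicate (q * (?n + 1)) 1))"
  proof (rule exec_Drain_store[where F = ?F and m = "12 * ?n + 5"])
    fix zs a ys
    let ?s = "(?F zs)(3 := ys)"
    let ?q = "length zs * (?n + 1)"
    let ?G = "\<lambda>us. ?s(dst := replicate (length us + 1 + ?q) 1, 2 := rev us)"
    have a: "exec (Push dst 1) ?s 1 (?s(dst := replicate (1 + ?q) 1))"
      by (rule exec_eq[OF exec_Push]) (use assms in \<open>auto simp: fun_eq_iff\<close>)
    have b: "exec (Drain src (\<lambda>a. Push 2 a ;; Push dst 1)) (?s(dst := replicate (1 + ?q) 1)) (7 * ?n + 1)
      ((?G (s src))(src := []))"
    proof (rule exec_Drain_store[where F = ?G and m = 3])
      fix us b vs
      show "exec (Push 2 b ;; Push dst 1) ((?G us)(src := vs)) 3 ((?G (us @ [b]))(src := vs))"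
        by (rule exec_eq[OF exec_SeqI[OF exec_Push exec_Push order_refl]]) (use assms in \<open>auto simp: fun_eq_iff\<close>)
    qed (use assms in \<open>auto simp: fun_eq_iff\<close>)
    have c: "exec (Drain 2 (Push src)) ((?G (s src))(src := [])) (5 * ?n + 1) ((?F (zs @ [a]))(3 := ys))"
      by (rule exec_eq[OF exec_Move]) (use assms in \<open>auto simp: fun_eq_iff algebra_simps\<close>)
    show "exec (Push dst 1 ;; Drain src (\<lambda>a. Push 2 a ;; Push dst 1) ;; Drain 2 (Push src)) ?s (12 * ?n + 5)
        ((?F (zs @ [a]))(3 := ys))"
      by (rule exec_SeqI[OF a exec_SeqI[OF b c order_refl]]) simp
  qed (use assms in \<open>auto simp: fun_eq_iff\<close>)
  show ?thesis unfolding Mul_def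
    by (rule exec_SeqI[OF 1 2]) (simp add: algebra_simps)
qed

primrec Pow :: "nat \<Rightarrow> nat \<Rightarrow> nat \<Rightarrow> nat \<Rightarrow> com" where
  "Pow c src dst 0 = foldr (\<lambda>_ e. Push dst 1 ;; e) (replicate c ()) Skip"
| "Pow c src dst (Suc d) = Pow c src dst d ;; Mul src dst"

primrec pow_cost :: "nat \<Rightarrow> nat \<Rightarrow> nat \<Rightarrow> nat" where
  "pow_cost c n 0 = 2 * c + 1"
| "pow_cost c n (Suc d) = pow_cost c n d + c * (n + 1) ^ d * (12 * n + 14) + 4"

lemma exec_Pow:
  assumes "s dst = []" "s 2 = []" "s 3 = []" "0 \<notin> set (s src)"
    and "src \<noteq> dst" "src \<notin> {2, 3}" "dst \<notin> {2, 3}"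
  shows "exec (Pow c src dst d) s (pow_cost c (length (s src)) d)
    (s(dst := replicate (c * (length (s src) + 1) ^ d) 1))"
proof (induction d)
  case 0
  have "exec (foldr (\<lambda>_ e. Push dst 1 ;; e) (replicate c ()) Skip) s' (2 * c + 1)
    (s'(dst := replicate c 1 @ s' dst))" for s'
  proof (induction c arbitrary: s')
    case 0
    show ?case unfolding replicate_0 foldr_Nil id_apply by (rule exec_eq[OF exec_Skip]) auto
  next
    case (Suc c)
    show ?case unfolding replicate_Suc foldr_Cons comp_def
      by (rule exec_eq[OF exec_SeqI[OF exec_Push Suc order_refl]])
        (auto simp: fun_eq_iff replicate_app_Cons_same)
  qed
  from this[of s] show ?case unfolding Pow.simps pow_cost.simps
    by (rule exec_eq) (use assms(1) in \<open>auto simp: fun_eq_iff\<close>)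
next
  case (Suc d)
  let ?s = "s(dst := replicate (c * (length (s src) + 1) ^ d) 1)"
  have "exec (Mul src dst) ?s (c * (length (s src) + 1) ^ d * (12 * length (?s src) + 14) + 3)
    (?s(dst := replicate (c * (length (s src) + 1) ^ d * (length (?s src) + 1)) 1))"
    by (rule exec_Mul) (use assms in auto)
  from exec_SeqI[OF Suc this order_refl]
  show ?case unfolding Pow.simps
    by (rule exec_eq) (use assms in \<open>auto simp: algebra_simps\<close>)
qed

lemma ok_Pow: "2 < K \<Longrightarrow> 3 < K \<Longrightarrow> src < K \<Longrightarrow> dst < K \<Longrightarrow> 2 < S \<Longrightarrow> ok_com K S (Pow c src dst d)"
proof (induction d)
  case 0
  have "ok_com K S (foldr (\<lambda>_ e. Push dst 1 ;; e) (replicate c ()) Skip)"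
    using 0 by (induction c) auto
  then show ?case by simp
qed (auto simp: Mul_def intro!: ok_Drain)

lemma pbounded_pow_cost: "pbounded g \<Longrightarrow> pbounded (\<lambda>x. pow_cost c (g x) d)"
  by (induction d) (auto intro!: pbounded_const pbounded_add pbounded_mult pbounded_power pbounded_Suc)

section \<open>The program of the reduction\<close>

text \<open>Stores written as lists let simplification compute updates at literal indices.\<close>

definition mk :: "nat list list \<Rightarrow> store" where
  "mk xs i = (if i < length xs then xs ! i else [])"

lemma mk_simps [simp]: "mk (x # xs) 0 = x" "mk (x # xs) (Suc i) = mk xs i" "mk (x # xs) (numeral k) = mk xs (pred_numeral k)"
  by (auto simp: mk_def numeral_eq_Suc)

lemma mk_upd: "i < length xs \<Longrightarrow> (mk xs)(i := v) = mk (xs[i := v])"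
  by (auto simp: mk_def fun_eq_iff)

lemma list_update_numeral: "(x # xs)[numeral k := v] = x # xs[pred_numeral k := v]"
  by (simp add: numeral_eq_Suc)

lemmas store_simps = mk_upd list_update_numeral

text \<open>Emitted bits are pushed, so the code lies backwards on its stack until the final move
  turns it round.\<close>

definition out :: "nat list \<Rightarrow> nat list" where
  "out ns = rev (map sym_of_bit (concat (map enc_nat ns)))"

lemma out_Nil [simp]: "out [] = []"
  by (simp add: out_def)

lemma exec_EmitToks_out:
  assumes "list_all (tok_ok C) ts" "\<And>c. c \<in> C \<Longrightarrow> s c = bsym (env c) \<and> 0 < env c \<and> env c \<le> M" "s 3 = []" "C \<inter> {1, 3} = {}"
    "s 1 = out ns" "s' = s(1 := out (ns @ map (tok_num env) ts))" "toks_cost ts * (M + 1) \<le> m"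
  shows "exec (EmitToks ts) s m s'"
proof -
  have "exec (EmitToks ts) s (toks_cost ts * (M + 1))
    (s(1 := rev (map sym_of_bit (concat (map enc_nat (map (tok_num env) ts)))) @ s 1))"
    by (rule exec_EmitToks) (use assms(1-4) in auto)
  then show ?thesis
    by (rule exec_eq) (use assms(5-7) in \<open>auto simp: out_def comp_def\<close>)
qed

text \<open>Cells of the grid are described by class symbols: \<open>1\<close>, \<open>2\<close> for an input bit, \<open>3\<close>, \<open>4\<close> for an
  input bit under the initial head, \<open>5\<close> for a cell of the guessed witness, \<open>6\<close> for a blank, \<open>7\<close> for an
  arbitrary cell of a later row, and \<open>8\<close> for a position past the last row, which is left unconstrained.\<close>

definition input_row :: "bool list \<Rightarrow> nat \<Rightarrow> nat list" where
  "input_row x y = doubled (map sym_of_bit x) @ [1, 2] @ replicate y 5"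

fun mark_head :: "nat list \<Rightarrow> nat list" where
  "mark_head [] = []"
| "mark_head (a # l) = (a + 2) # l"

text \<open>Stack allocation: \<open>0\<close> input and final output, \<open>1\<close> emitted bits in reverse, \<open>2\<close> and \<open>3\<close> scratch,
  \<open>4\<close> to \<open>7\<close> counters for the positions \<open>p\<close>, \<open>p + 1\<close>, \<open>p + 2\<close>, \<open>p + w + 1\<close>, \<open>8\<close> and \<open>9\<close> counters for
  the number of cells and its successor, \<open>10\<close> the witness length in unary, \<open>11\<close> the input row,
  \<open>12\<close> to \<open>14\<close> the padding in unary, \<open>15\<close> the initial row, \<open>16\<close> and \<open>17\<close> the row width in
  unary, \<open>18\<close> the grid.\<close>

definition row_prog :: com where
  "row_prog = Drain 10 (\<lambda>_. Push 11 5) ;; Push 11 2 ;; Push 11 1 ;; Drain 0 (Push 2) ;;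
     Drain 2 (\<lambda>a. Push 11 a ;; Push 11 a) ;; Case 11 (\<lambda>a. if a \<le> 2 then Pop 11 ;; Push 11 (a + 2) else Skip)"

text \<open>A stack grows at its top, so the row is built from its right end: witness cells,
  separator, then the doubled input, which is first reversed into stack 2.\<close>

lemma exec_row_prog:
  "exec row_prog (mk [map sym_of_bit x, [], [], [], [], [], [], [], [], [], replicate y 1, [], [], [], [], [], [], [], []])
     (5 * y + 12 * length x + 14)
     (mk [[], [], [], [], [], [], [], [], [], [], [], mark_head (input_row x y), [], [], [], [], [], [], []])"
proof -
  let ?x = "map sym_of_bit x"
  let ?S = "\<lambda>X T Y I. mk [X, [], T, [], [], [], [], [], [], [], Y, I, [], [], [], [], [], [], []]"
  have 1: "exec (Drain 10 (\<lambda>_. Push 11 5)) (?S ?x [] (replicate y 1) []) (5 * y + 1) (?S ?x [] [] (replicate y 5))"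
  proof (rule exec_Drain_store[where F = "\<lambda>zs. ?S ?x [] [] (replicate (length zs) 5)" and m = 1])
    fix zs a ys
    show "exec (Push 11 5) ((?S ?x [] [] (replicate (length zs) 5))(10 := ys)) 1
        ((?S ?x [] [] (replicate (length (zs @ [a])) 5))(10 := ys))"
      by (rule exec_eq[OF exec_Push]) (simp_all add: store_simps)
  qed (simp_all add: store_simps)
  have 2: "exec (Push 11 2) (?S ?x [] [] (replicate y 5)) 1 (?S ?x [] [] (2 # replicate y 5))"
    by (rule exec_eq[OF exec_Push]) (simp_all add: store_simps)
  have 3: "exec (Push 11 1) (?S ?x [] [] (2 # replicate y 5)) 1 (?S ?x [] [] (1 # 2 # replicate y 5))"
    by (rule exec_eq[OF exec_Push]) (simp_all add: store_simps)
  have 4: "exec (Drain 0 (Push 2)) (?S ?x [] [] (1 # 2 # replicate y 5)) (5 * length x + 1)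
      (?S [] (rev ?x) [] (1 # 2 # replicate y 5))"
    by (rule exec_eq[OF exec_Move]) (simp_all add: store_simps)
  let ?I = "\<lambda>zs. rev (doubled zs) @ 1 # 2 # replicate y 5"
  have 5: "exec (Drain 2 (\<lambda>a. Push 11 a ;; Push 11 a)) (?S [] (rev ?x) [] (1 # 2 # replicate y 5)) (7 * length x + 1)
      (?S [] [] [] (input_row x y))"
  proof (rule exec_Drain_store[where F = "\<lambda>zs. ?S [] [] [] (?I zs)" and m = 3])
    fix zs a ys
    show "exec (Push 11 a ;; Push 11 a) ((?S [] [] [] (?I zs))(2 := ys)) 3 ((?S [] [] [] (?I (zs @ [a])))(2 := ys))"
      by (rule exec_eq[OF exec_SeqI[OF exec_Push exec_Push order_refl]]) (simp_all add: store_simps)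
  qed (simp_all add: store_simps input_row_def rev_doubled)
  \<comment> \<open>For empty input the first symbol is the 1 of the separator, so the head is
    marked on a bit in every case.\<close>
  obtain a l where al: "input_row x y = a # l" "a \<le> 2"
    by (cases x) (auto simp: input_row_def sym_of_bit_def)
  have 6: "exec (Case 11 (\<lambda>a. if a \<le> 2 then Pop 11 ;; Push 11 (a + 2) else Skip)) (?S [] [] [] (input_row x y)) (3 + 1)
      (?S [] [] [] (mark_head (input_row x y)))"
  proof (rule exec_Case)
    have "exec (Pop 11 ;; Push 11 (a + 2)) (?S [] [] [] (a # l)) 3 (?S [] [] [] ((a + 2) # l))"
      by (rule exec_eq[OF exec_SeqI[OF exec_Pop exec_Push order_refl]]) (simp_all add: store_simps)
    then show "exec (if nth0 (?S [] [] [] (input_row x y) 11) 0 \<le> 2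
          then Pop 11 ;; Push 11 (nth0 (?S [] [] [] (input_row x y) 11) 0 + 2) else Skip)
       (?S [] [] [] (input_row x y)) 3 (?S [] [] [] (mark_head (input_row x y)))"
      using al by simp
  qed
  show ?thesis unfolding row_prog_def
    by (rule exec_SeqI[OF 1 exec_SeqI[OF 2 exec_SeqI[OF 3 exec_SeqI[OF 4 exec_SeqI[OF 5 6 order_refl] order_refl] order_refl] order_refl]]) simp
qed


section \<open>Padding of the initial row and layout of the later rows\<close>

definition rows :: "nat \<Rightarrow> nat list \<Rightarrow> nat list" where
  "rows z I = replicate z 6 @ I @ replicate z 6"

definition rows_prog :: com where
  "rows_prog = Drain 12 (\<lambda>_. Push 13 1 ;; Push 14 1 ;; Push 15 6) ;; Drain 11 (Push 2) ;; Drain 2 (Push 15) ;;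
     Drain 13 (\<lambda>_. Push 15 6)"

lemma exec_rows_prog:
  assumes "0 \<notin> set I"
  shows "exec rows_prog (mk [[], [], [], [], [], [], [], [], [], [], [], I, replicate z 1, [], [], [], [], [], []])
     (14 * z + 10 * length I + 7)
     (mk [[], [], [], [], [], [], [], [], [], [], [], [], [], [], replicate z 1, rows z I, [], [], []])"
proof -
  let ?S = "\<lambda>T I Z Z1 Z2 R. mk [[], [], T, [], [], [], [], [], [], [], [], I, Z, Z1, Z2, R, [], [], []]"
  let ?u = "\<lambda>n. replicate n (1 :: nat)" and ?b = "\<lambda>n. replicate n (6 :: nat)"
  have 1: "exec (Drain 12 (\<lambda>_. Push 13 1 ;; Push 14 1 ;; Push 15 6)) (?S [] I (?u z) [] [] []) (9 * z + 1)
      (?S [] I [] (?u z) (?u z) (?b z))"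
  proof (rule exec_Drain_store[where F = "\<lambda>zs. ?S [] I [] (?u (length zs)) (?u (length zs)) (?b (length zs))" and m = 5])
    fix zs a ys
    show "exec (Push 13 1 ;; Push 14 1 ;; Push 15 6) ((?S [] I [] (?u (length zs)) (?u (length zs)) (?b (length zs)))(12 := ys)) 5
        ((?S [] I [] (?u (length (zs @ [a]))) (?u (length (zs @ [a]))) (?b (length (zs @ [a]))))(12 := ys))"
      by (rule exec_eq[OF exec_SeqI[OF exec_Push exec_SeqI[OF exec_Push exec_Push order_refl] order_refl]])
        (simp_all add: store_simps)
  qed (simp_all add: store_simps)
  have 2: "exec (Drain 11 (Push 2)) (?S [] I [] (?u z) (?u z) (?b z)) (5 * length I + 1)
      (?S (rev I) [] [] (?u z) (?u z) (?b z))"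
    by (rule exec_eq[OF exec_Move]) (use assms in \<open>simp_all add: store_simps\<close>)
  have 3: "exec (Drain 2 (Push 15)) (?S (rev I) [] [] (?u z) (?u z) (?b z)) (5 * length I + 1)
      (?S [] [] [] (?u z) (?u z) (I @ ?b z))"
    by (rule exec_eq[OF exec_Move]) (use assms in \<open>simp_all add: store_simps\<close>)
  have 4: "exec (Drain 13 (\<lambda>_. Push 15 6)) (?S [] [] [] (?u z) (?u z) (I @ ?b z)) (5 * z + 1)
      (?S [] [] [] [] (?u z) (rows z I))"
  proof (rule exec_Drain_store[where F = "\<lambda>zs. ?S [] [] [] [] (?u z) (?b (length zs) @ I @ ?b z)" and m = 1])
    fix zs a ys
    show "exec (Push 15 6) ((?S [] [] [] [] (?u z) (?b (length zs) @ I @ ?b z))(13 := ys)) 1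
        ((?S [] [] [] [] (?u z) (?b (length (zs @ [a])) @ I @ ?b z))(13 := ys))"
      by (rule exec_eq[OF exec_Push]) (simp_all add: store_simps)
  qed (simp_all add: store_simps rows_def)
  show ?thesis unfolding rows_prog_def
    by (rule exec_SeqI[OF 1 exec_SeqI[OF 2 exec_SeqI[OF 3 4 order_refl] order_refl]]) simp
qed

text \<open>The constraint at a cell mentions the cell \<open>length R + 1\<close> places further
  on; the trailing cells supply these variables for the last constrained positions.\<close>

definition grid :: "nat \<Rightarrow> nat list \<Rightarrow> nat list" where
  "grid z R = R @ replicate (z * length R) 7 @ replicate (length R + 1) 8"

definition grid_prog :: com where
  "grid_prog = Push 18 8 ;; Push 7 2 ;; Push 7 1 ;;
     Drain 15 (\<lambda>a. Push 2 a ;; Push 18 8 ;; Push 16 1 ;; Inc 7) ;;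
     Drain 14 (\<lambda>_. Drain 16 (\<lambda>_. Push 17 1 ;; Push 18 7) ;; Drain 17 (Push 16)) ;;
     Drain 16 (\<lambda>_. Skip) ;; Drain 2 (Push 18)"

lemma bsym_small: "bsym 0 = []" "bsym (Suc 0) = [2]" "bsym (Suc (Suc 0)) = [Suc 0, 2]" "bsym 3 = [2, 2]"
  by (simp_all add: bin.simps)

text \<open>Counter 7 starts at 2 and is incremented once per cell of the row. It ends at
  \<open>length R + 2\<close>, which is \<open>p + w + 1\<close> for the first position
  \<open>p = 1\<close>.\<close>

lemma exec_grid_prog:
  assumes "0 \<notin> set R"
  shows "exec grid_prog (mk [[], [], [], [], [], [], [], [], [], [], [], [], [], [], replicate z 1, R, [], [], []])
     (length R * (9 * length R + 49) + z * (12 * length R + 7) + 13)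
     (mk [[], [], [], [], [], [], [], bsym (length R + 2), [], [], [], [], [], [], [], [], [], [], grid z R])"
proof -
  let ?w = "length R"
  let ?S = "\<lambda>T D Z2 R V V2 K. mk [[], [], T, [], [], [], [], D, [], [], [], [], [], [], Z2, R, V, V2, K]"
  let ?u = "\<lambda>n. replicate n (1 :: nat)" and ?e = "\<lambda>n. replicate n (8 :: nat)" and ?f = "\<lambda>n. replicate n (7 :: nat)"
  have 1: "exec (Push 18 8) (?S [] [] (?u z) R [] [] []) 1 (?S [] [] (?u z) R [] [] [8])"
    by (rule exec_eq[OF exec_Push]) (simp_all add: store_simps)
  have 2: "exec (Push 7 2) (?S [] [] (?u z) R [] [] [8]) 1 (?S [] [2] (?u z) R [] [] [8])"
    by (rule exec_eq[OF exec_Push]) (simp_all add: store_simps)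
  have 3: "exec (Push 7 1) (?S [] [2] (?u z) R [] [] [8]) 1 (?S [] [1, 2] (?u z) R [] [] [8])"
    by (rule exec_eq[OF exec_Push]) (simp_all add: store_simps)
  let ?F = "\<lambda>zs. ?S (rev zs) (bsym (length zs + 2)) (?u z) [] (?u (length zs)) [] (?e (length zs + 1))"
  have 4: "exec (Drain 15 (\<lambda>a. Push 2 a ;; Push 18 8 ;; Push 16 1 ;; Inc 7)) (?S [] [1, 2] (?u z) R [] [] [8])
      (?w * (9 * ?w + 39) + 1) (?F R)"
  proof (rule exec_Drain_store[where F = ?F and m = "9 * ?w + 35"])
    fix zs a ys assume "(?S [] [1, 2] (?u z) R [] [] [8]) 15 = zs @ a # ys"
    then have R: "R = zs @ a # ys" by simp
    let ?S2 = "?S (a # rev zs) (bsym (length zs + 2)) (?u z) ys (?u (length zs + 1)) [] (?e (length zs + 2))"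
    have inc: "exec (Inc 7) ?S2 (9 * (length zs + 2) + 11) (?S2(7 := bsym (Suc (length zs + 2))))"
      by (rule exec_Inc) simp_all
    have "exec (Push 2 a ;; Push 18 8 ;; Push 16 1 ;; Inc 7) ((?F zs)(15 := ys)) (9 * (length zs + 2) + 17)
        (?S2(7 := bsym (Suc (length zs + 2))))"
    proof (rule exec_SeqI[OF exec_Push exec_SeqI[OF exec_Push exec_SeqI[OF exec_Push _ order_refl] order_refl]])
      show "exec (Inc 7) (((?F zs)(15 := ys))(2 := a # ((?F zs)(15 := ys)) 2,
          18 := 8 # (((?F zs)(15 := ys))(2 := a # ((?F zs)(15 := ys)) 2)) 18,
          16 := 1 # (((?F zs)(15 := ys))(2 := a # ((?F zs)(15 := ys)) 2,
          18 := 8 # (((?F zs)(15 := ys))(2 := a # ((?F zs)(15 := ys)) 2)) 18)) 16)) (9 * (length zs + 2) + 11)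
          (?S2(7 := bsym (Suc (length zs + 2))))"
        using inc by (simp add: store_simps)
    qed simp
    then show "exec (Push 2 a ;; Push 18 8 ;; Push 16 1 ;; Inc 7) ((?F zs)(15 := ys)) (9 * ?w + 35) ((?F (zs @ [a]))(15 := ys))"
      by (rule exec_eq) (use R in \<open>simp_all add: store_simps\<close>)
  qed (use assms in \<open>simp_all add: store_simps bsym_small\<close>)
  let ?D = "bsym (?w + 2)"
  let ?G = "\<lambda>zs. ?S (rev R) ?D [] [] (?u ?w) [] (?f (length zs * ?w) @ ?e (?w + 1))"
  have 5: "exec (Drain 14 (\<lambda>_. Drain 16 (\<lambda>_. Push 17 1 ;; Push 18 7) ;; Drain 17 (Push 16))) (?F R)
      (z * (12 * ?w + 7) + 1) (?G (?u z))"
  proof (rule exec_Drain_store[where F = ?G and m = "12 * ?w + 3"])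
    fix zs a ys
    let ?H = "\<lambda>us. ?S (rev R) ?D ys [] [] (?u (length us)) (?f (length us + length zs * ?w) @ ?e (?w + 1))"
    have a: "exec (Drain 16 (\<lambda>_. Push 17 1 ;; Push 18 7)) ((?G zs)(14 := ys)) (7 * ?w + 1) (?H (?u ?w))"
    proof (rule exec_Drain_store[where F = ?H and m = 3])
      fix us b vs
      show "exec (Push 17 1 ;; Push 18 7) ((?H us)(16 := vs)) 3 ((?H (us @ [b]))(16 := vs))"
        by (rule exec_eq[OF exec_SeqI[OF exec_Push exec_Push order_refl]]) (simp_all add: store_simps)
    qed (simp_all add: store_simps)
    have b: "exec (Drain 17 (Push 16)) (?H (?u ?w)) (5 * ?w + 1) ((?G (zs @ [a]))(14 := ys))"
      by (rule exec_eq[OF exec_Move]) (simp_all add: store_simps)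
    show "exec (Drain 16 (\<lambda>_. Push 17 1 ;; Push 18 7) ;; Drain 17 (Push 16)) ((?G zs)(14 := ys)) (12 * ?w + 3)
        ((?G (zs @ [a]))(14 := ys))"
      by (rule exec_SeqI[OF a b]) simp
  qed (simp_all add: store_simps)
  have 6: "exec (Drain 16 (\<lambda>_. Skip)) (?G (?u z)) (5 * ?w + 1)
      (?S (rev R) ?D [] [] [] [] (?f (z * ?w) @ ?e (?w + 1)))"
    by (rule exec_Drain_store[where F = "\<lambda>_. ?S (rev R) ?D [] [] [] [] (?f (z * ?w) @ ?e (?w + 1))" and m = 1])
      (simp_all only: exec_Skip, simp_all add: store_simps)
  have 7: "exec (Drain 2 (Push 18)) (?S (rev R) ?D [] [] [] [] (?f (z * ?w) @ ?e (?w + 1))) (5 * ?w + 1)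
      (?S [] ?D [] [] [] [] (grid z R))"
    by (rule exec_eq[OF exec_Move]) (use assms in \<open>simp_all add: store_simps grid_def\<close>)
  show ?thesis unfolding grid_prog_def
    by (rule exec_SeqI[OF 1 exec_SeqI[OF 2 exec_SeqI[OF 3 exec_SeqI[OF 4 exec_SeqI[OF 5 exec_SeqI[OF 6 7 order_refl]
      order_refl] order_refl] order_refl] order_refl]]) (simp add: algebra_simps)
qed

section \<open>Emission of the instance header and of one block per cell\<close>

definition head_env :: "nat \<Rightarrow> nat \<Rightarrow> nat" where
  "head_env n c = (if c = 8 then n else n + 1)"

definition head_nums :: "nat \<Rightarrow> tok list \<Rightarrow> tok list \<Rightarrow> nat \<Rightarrow> nat list" where
  "head_nums k hdr bnd n = map (tok_num (head_env n)) hdr @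
     concat (replicate (n + 1) (map (tok_num (head_env n)) bnd)) @ [2 ^ k * n]"

definition head_prog :: "nat \<Rightarrow> tok list \<Rightarrow> tok list \<Rightarrow> com" where
  "head_prog k hdr bnd = Push 9 2 ;; Drain 18 (\<lambda>a. Push 2 a ;; Inc 8 ;; Inc 9) ;; EmitToks hdr ;; EmitToks bnd ;;
     Drain 2 (\<lambda>a. Push 18 a ;; EmitToks bnd) ;; EmitToks [Hole k 0 8]"

text \<open>The grid serves as loop counter twice, first to count the cells and then to repeat the
  bounds; the second pass puts it back in its original order.\<close>

lemma exec_head_prog:
  assumes "list_all (tok_ok {8, 9}) hdr" "list_all (tok_ok {8, 9}) bnd" "0 \<notin> set K" "K \<noteq> []"
  shows "exec (head_prog k hdr bnd) (mk [[], [], [], [], [], [], [], D, [], [], [], [], [], [], [], [], [], [], K])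
     ((toks_cost hdr + toks_cost bnd + toks_cost [Hole k 0 8] + 9) * (length K + 2) +
       length K * (toks_cost bnd * (length K + 2) + 18 * length K + 60))
     (mk [[], out (head_nums k hdr bnd (length K)), [], [], [], [], [], D, bsym (length K), bsym (length K + 1),
       [], [], [], [], [], [], [], [], K])"
proof -
  let ?n = "length K"
  let ?S = "\<lambda>O1 T N P K. mk [[], O1, T, [], [], [], [], D, N, P, [], [], [], [], [], [], [], [], K]"
  let ?N = "bsym ?n" and ?P = "bsym (?n + 1)"
  have 1: "exec (Push 9 2) (?S [] [] [] [] K) 1 (?S [] [] [] [2] K)"
    by (rule exec_eq[OF exec_Push]) (simp_all add: store_simps)
  let ?F = "\<lambda>zs. ?S [] (rev zs) (bsym (length zs)) (bsym (length zs + 1)) []"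
  have 2: "exec (Drain 18 (\<lambda>a. Push 2 a ;; Inc 8 ;; Inc 9)) (?S [] [] [] [2] K) (?n * (18 * ?n + 47) + 1)
      (?S [] (rev K) ?N ?P [])"
  proof (rule exec_Drain_store[where F = ?F and m = "18 * ?n + 43"])
    fix zs a ys assume "(?S [] [] [] [2] K) 18 = zs @ a # ys"
    then have K: "K = zs @ a # ys" by simp
    let ?j = "length zs"
    have a: "exec (Push 2 a) ((?F zs)(18 := ys)) 1 (?S [] (a # rev zs) (bsym ?j) (bsym (?j + 1)) ys)"
      by (rule exec_eq[OF exec_Push]) (simp_all add: store_simps)
    have b: "exec (Inc 8) (?S [] (a # rev zs) (bsym ?j) (bsym (?j + 1)) ys) (9 * ?j + 11)
        (?S [] (a # rev zs) (bsym (?j + 1)) (bsym (?j + 1)) ys)"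
      by (rule exec_eq[OF exec_Inc[where n = ?j]]) (simp_all add: store_simps)
    have c: "exec (Inc 9) (?S [] (a # rev zs) (bsym (?j + 1)) (bsym (?j + 1)) ys) (9 * (?j + 1) + 11)
        ((?F (zs @ [a]))(18 := ys))"
      by (rule exec_eq[OF exec_Inc[where n = "?j + 1"]]) (simp_all add: store_simps)
    show "exec (Push 2 a ;; Inc 8 ;; Inc 9) ((?F zs)(18 := ys)) (18 * ?n + 43) ((?F (zs @ [a]))(18 := ys))"
      by (rule exec_SeqI[OF a exec_SeqI[OF b c order_refl]]) (use K in simp)
  qed (use assms(3) in \<open>simp_all add: store_simps bsym_small\<close>)
  let ?env = "head_env ?n"
  have env: "(?S x y ?N ?P z) c = bsym (?env c) \<and> 0 < ?env c \<and> ?env c \<le> ?n + 1" if "c \<in> {8, 9}" for x y z c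
    using that assms(4) by (auto simp: head_env_def)
  let ?h = "map (tok_num ?env) hdr" and ?b = "map (tok_num ?env) bnd"
  define bs where "bs j = concat (replicate j ?b)" for j
  have bs: "bs 0 = []" "bs (Suc j) = bs j @ ?b" for j
    using concat_append[of "replicate j ?b" "[?b]"] by (simp_all add: bs_def replicate_append_same del: concat_append)
  have 3: "exec (EmitToks hdr) (?S [] (rev K) ?N ?P []) (toks_cost hdr * (?n + 2)) (?S (out ?h) (rev K) ?N ?P [])"
    by (rule exec_EmitToks_out[OF assms(1) env, where ns = "[]"]) (simp_all add: store_simps)
  have 4: "exec (EmitToks bnd) (?S (out ?h) (rev K) ?N ?P []) (toks_cost bnd * (?n + 2)) (?S (out (?h @ ?b)) (rev K) ?N ?P [])"
    by (rule exec_EmitToks_out[OF assms(2) env]) (simp_all add: store_simps)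
  let ?G = "\<lambda>zs. ?S (out (?h @ bs (length zs + 1))) [] ?N ?P (rev zs)"
  have 5: "exec (Drain 2 (\<lambda>a. Push 18 a ;; EmitToks bnd)) (?S (out (?h @ ?b)) (rev K) ?N ?P [])
     (?n * (toks_cost bnd * (?n + 2) + 6) + 1) (?S (out (?h @ bs (?n + 1))) [] ?N ?P K)"
  proof (rule exec_Drain_store[where F = ?G and m = "toks_cost bnd * (?n + 2) + 2"])
    fix zs :: "nat list" and a ys
    let ?O = "out (?h @ bs (length zs + 1))"
    have a: "exec (Push 18 a) ((?G zs)(2 := ys)) 1 (?S ?O ys ?N ?P (a # rev zs))"
      by (rule exec_eq[OF exec_Push]) (simp_all add: store_simps)
    have b: "exec (EmitToks bnd) (?S ?O ys ?N ?P (a # rev zs)) (toks_cost bnd * (?n + 2)) ((?G (zs @ [a]))(2 := ys))"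
      by (rule exec_EmitToks_out[OF assms(2) env, where ns = "?h @ bs (length zs + 1)"]) (simp_all add: store_simps bs)
    show "exec (Push 18 a ;; EmitToks bnd) ((?G zs)(2 := ys)) (toks_cost bnd * (?n + 2) + 2) ((?G (zs @ [a]))(2 := ys))"
      by (rule exec_SeqI[OF a b]) simp
  qed (use assms(3) in \<open>simp_all add: store_simps bs\<close>)
  have 6: "exec (EmitToks [Hole k 0 8]) (?S (out (?h @ bs (?n + 1))) [] ?N ?P K)
      (toks_cost [Hole k 0 8] * (?n + 2)) (?S (out (head_nums k hdr bnd ?n)) [] ?N ?P K)"
    by (rule exec_EmitToks_out[where C = "{8, 9}", OF _ env, where ns = "?h @ bs (?n + 1)"])
      (simp_all add: store_simps head_nums_def head_env_def bs_def)
  show ?thesis unfolding head_prog_def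
    by (rule exec_SeqI[OF 1 exec_SeqI[OF 2 exec_SeqI[OF 3 exec_SeqI[OF 4 exec_SeqI[OF 5 6 order_refl] order_refl]
      order_refl] order_refl]]) (simp add: algebra_simps)
qed

definition body_env :: "nat \<Rightarrow> nat \<Rightarrow> nat \<Rightarrow> nat" where
  "body_env w p c = p + (if c = 4 then 0 else if c = 5 then 1 else if c = 6 then 2 else w + 1)"

definition body_nums :: "(nat \<Rightarrow> tok list) \<Rightarrow> nat \<Rightarrow> nat list \<Rightarrow> nat \<Rightarrow> nat list" where
  "body_nums tmpl w K n = concat (map (\<lambda>j. map (tok_num (body_env w (j + 1))) (tmpl (K ! j))) [0..<n])"

definition body_prog :: "(nat \<Rightarrow> tok list) \<Rightarrow> com" where
  "body_prog tmpl = Push 4 2 ;; Push 5 2 ;; Push 5 1 ;; Push 6 2 ;; Push 6 2 ;;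
     Drain 18 (\<lambda>a. EmitToks (tmpl a) ;; Inc 4 ;; Inc 5 ;; Inc 6 ;; Inc 7)"

text \<open>The pushes set counters 4, 5, 6 to 1, 2, 3, the positions for the first cell, while
  counter 7 is already in place. Afterwards all four advance with the cell.\<close>

lemma exec_body_prog:
  assumes "\<And>a. a \<in> set K \<Longrightarrow> list_all (tok_ok {4, 5, 6, 7}) (tmpl a)" "\<And>a. a \<in> set K \<Longrightarrow> toks_cost (tmpl a) \<le> tm"
    "0 \<notin> set K"
  shows "exec (body_prog tmpl) (mk [[], out ns, [], [], [], [], [], bsym (w + 2), N, P, [], [], [], [], [], [], [], [], K])
     (length K * (tm * (length K + w + 4) + 36 * (length K + w) + 120) + 20)
     (mk [[], out (ns @ body_nums tmpl w K (length K)), [], [], bsym (length K + 1), bsym (length K + 2), bsym (length K + 3),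
       bsym (length K + w + 2), N, P, [], [], [], [], [], [], [], [], []])"
proof -
  let ?n = "length K"
  let ?S = "\<lambda>O1 A B C D K. mk [[], O1, [], [], A, B, C, D, N, P, [], [], [], [], [], [], [], [], K]"
  let ?D = "bsym (w + 2)"
  have 1: "exec (Push 4 2) (?S (out ns) [] [] [] ?D K) 1 (?S (out ns) [2] [] [] ?D K)"
    by (rule exec_eq[OF exec_Push]) (simp_all add: store_simps)
  have 2: "exec (Push 5 2) (?S (out ns) [2] [] [] ?D K) 1 (?S (out ns) [2] [2] [] ?D K)"
    by (rule exec_eq[OF exec_Push]) (simp_all add: store_simps)
  have 3: "exec (Push 5 1) (?S (out ns) [2] [2] [] ?D K) 1 (?S (out ns) [2] [1, 2] [] ?D K)"
    by (rule exec_eq[OF exec_Push]) (simp_all add: store_simps)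
  have 4: "exec (Push 6 2) (?S (out ns) [2] [1, 2] [] ?D K) 1 (?S (out ns) [2] [1, 2] [2] ?D K)"
    by (rule exec_eq[OF exec_Push]) (simp_all add: store_simps)
  have 5: "exec (Push 6 2) (?S (out ns) [2] [1, 2] [2] ?D K) 1 (?S (out ns) [2] [1, 2] [2, 2] ?D K)"
    by (rule exec_eq[OF exec_Push]) (simp_all add: store_simps)
  let ?c = "tm * (?n + w + 4) + 36 * (?n + w) + 110"
  let ?O = "\<lambda>j. out (ns @ body_nums tmpl w K j)"
  let ?F = "\<lambda>zs. let j = length zs in ?S (?O j) (bsym (j + 1)) (bsym (j + 2)) (bsym (j + 3)) (bsym (j + w + 2)) []"
  have 6: "exec (Drain 18 (\<lambda>a. EmitToks (tmpl a) ;; Inc 4 ;; Inc 5 ;; Inc 6 ;; Inc 7)) (?S (out ns) [2] [1, 2] [2, 2] ?D K)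
     (?n * (?c + 4) + 1) (?S (?O ?n) (bsym (?n + 1)) (bsym (?n + 2)) (bsym (?n + 3)) (bsym (?n + w + 2)) [])"
  proof (rule exec_Drain_store[where F = ?F and m = ?c])
    fix zs a ys assume "(?S (out ns) [2] [1, 2] [2, 2] ?D K) 18 = zs @ a # ys"
    then have K: "K = zs @ a # ys" by simp
    let ?j = "length zs"
    have a: "a \<in> set K" "K ! ?j = a" "?j < ?n" using K by auto
    let ?T = "\<lambda>i1 i2 i3 i4. ?S (?O (?j + 1)) (bsym (?j + i1)) (bsym (?j + i2)) (bsym (?j + i3)) (bsym (?j + w + i4)) ys"
    have env: "((?F zs)(18 := ys)) c = bsym (body_env w (?j + 1) c) \<and> 0 < body_env w (?j + 1) c \<and>
        body_env w (?j + 1) c \<le> ?n + w + 3" if "c \<in> {4, 5, 6, 7}" for c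
      using that a(3) by (auto simp: body_env_def Let_def numeral_3_eq_3 add.commute add.left_commute)
    have le: "toks_cost (tmpl a) * (?n + w + 3 + 1) \<le> tm * (?n + w + 4)"
      using mult_le_mono1[OF assms(2)[OF a(1)], of "?n + w + 4"] by (simp only: add.assoc) simp
    have b1: "exec (EmitToks (tmpl a)) ((?F zs)(18 := ys)) (tm * (?n + w + 4)) (?T 1 2 3 2)"
      by (rule exec_EmitToks_out[OF assms(1)[OF a(1)] env, where ns = "ns @ body_nums tmpl w K ?j", OF _ _ _ _ _ le])
        (use a in \<open>simp_all add: Let_def store_simps body_nums_def\<close>)
    have b2: "exec (Inc 4) (?T 1 2 3 2) (9 * (?j + 1) + 11) (?T 2 2 3 2)"
      by (rule exec_eq[OF exec_Inc[where n = "?j + 1"]]) (simp_all add: store_simps)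
    have e: "?j + 3 = Suc (Suc (Suc ?j))" "?j + 4 = Suc (Suc (Suc (Suc ?j)))" by simp_all
    have b3: "exec (Inc 5) (?T 2 2 3 2) (9 * (?j + 2) + 11) (?T 2 3 3 2)"
      by (rule exec_eq[OF exec_Inc[where n = "?j + 2"]]) (simp_all add: store_simps e)
    have b4: "exec (Inc 6) (?T 2 3 3 2) (9 * (?j + 3) + 11) (?T 2 3 4 2)"
      by (rule exec_eq[OF exec_Inc[where n = "?j + 3"]]) (simp_all add: store_simps e)
    have b5: "exec (Inc 7) (?T 2 3 4 2) (9 * (?j + w + 2) + 11) ((?F (zs @ [a]))(18 := ys))"
      by (rule exec_eq[OF exec_Inc[where n = "?j + w + 2"]]) (simp_all add: store_simps Let_def e)
    show "exec (EmitToks (tmpl a) ;; Inc 4 ;; Inc 5 ;; Inc 6 ;; Inc 7) ((?F zs)(18 := ys)) ?c ((?F (zs @ [a]))(18 := ys))"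
      by (rule exec_SeqI[OF b1 exec_SeqI[OF b2 exec_SeqI[OF b3 exec_SeqI[OF b4 b5 order_refl] order_refl] order_refl]])
        (use a(3) in simp)
  qed (use assms(3) in \<open>simp_all add: store_simps bsym_small body_nums_def Let_def\<close>)
  show ?thesis unfolding body_prog_def
    by (rule exec_SeqI[OF 1 exec_SeqI[OF 2 exec_SeqI[OF 3 exec_SeqI[OF 4 exec_SeqI[OF 5 6 order_refl] order_refl]
      order_refl] order_refl]]) (simp add: algebra_simps)
qed

text \<open>The final store must be a \<open>single_store\<close>, since any other nonempty track
  would change the symbols read as output. The last move undoes the reversal of the code.\<close>

definition clear_prog :: com where
  "clear_prog = foldr (\<lambda>i c. Drain i (\<lambda>_. Skip) ;; c) [4, 5, 6, 7, 8, 9] (Drain 1 (Push 0))"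

lemma exec_clear: "0 \<notin> set (s i) \<Longrightarrow> length (s i) \<le> n \<Longrightarrow> exec (Drain i (\<lambda>_. Skip)) s (5 * n + 1) (s(i := []))"
  by (rule exec_Drain_store[where F = "\<lambda>_. s" and m = 1]) (auto intro: exec_Skip[unfolded One_nat_def] simp: fun_eq_iff)

lemma exec_clear_prog:
  assumes "a \<le> M" "b \<le> M" "c \<le> M" "d \<le> M" "e \<le> M" "f \<le> M"
  shows "exec clear_prog (mk [[], out ns, [], [], bsym a, bsym b, bsym c, bsym d, bsym e, bsym f, [], [], [], [], [], [], [], [], []])
     (30 * M + 5 * length (out ns) + 13)
     (single_store (concat (map enc_nat ns)))"
proof -
  let ?S = "\<lambda>O1 a b c d e f. mk [[], O1, [], [], a, b, c, d, e, f, [], [], [], [], [], [], [], [], []]"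
  have l: "length (bsym a) \<le> M" if "a \<le> M" for a using length_bin[of a] that by simp
  have 1: "exec (Drain 4 (\<lambda>_. Skip)) (?S (out ns) (bsym a) (bsym b) (bsym c) (bsym d) (bsym e) (bsym f)) (5 * M + 1)
      (?S (out ns) [] (bsym b) (bsym c) (bsym d) (bsym e) (bsym f))"
    by (rule exec_eq[OF exec_clear[where n = M]]) (use l[OF assms(1)] in \<open>simp_all add: store_simps\<close>)
  have 2: "exec (Drain 5 (\<lambda>_. Skip)) (?S (out ns) [] (bsym b) (bsym c) (bsym d) (bsym e) (bsym f)) (5 * M + 1)
      (?S (out ns) [] [] (bsym c) (bsym d) (bsym e) (bsym f))"
    by (rule exec_eq[OF exec_clear[where n = M]]) (use l[OF assms(2)] in \<open>simp_all add: store_simps\<close>)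
  have 3: "exec (Drain 6 (\<lambda>_. Skip)) (?S (out ns) [] [] (bsym c) (bsym d) (bsym e) (bsym f)) (5 * M + 1)
      (?S (out ns) [] [] [] (bsym d) (bsym e) (bsym f))"
    by (rule exec_eq[OF exec_clear[where n = M]]) (use l[OF assms(3)] in \<open>simp_all add: store_simps\<close>)
  have 4: "exec (Drain 7 (\<lambda>_. Skip)) (?S (out ns) [] [] [] (bsym d) (bsym e) (bsym f)) (5 * M + 1)
      (?S (out ns) [] [] [] [] (bsym e) (bsym f))"
    by (rule exec_eq[OF exec_clear[where n = M]]) (use l[OF assms(4)] in \<open>simp_all add: store_simps\<close>)
  have 5: "exec (Drain 8 (\<lambda>_. Skip)) (?S (out ns) [] [] [] [] (bsym e) (bsym f)) (5 * M + 1)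
      (?S (out ns) [] [] [] [] [] (bsym f))"
    by (rule exec_eq[OF exec_clear[where n = M]]) (use l[OF assms(5)] in \<open>simp_all add: store_simps\<close>)
  have 6: "exec (Drain 9 (\<lambda>_. Skip)) (?S (out ns) [] [] [] [] [] (bsym f)) (5 * M + 1)
      (?S (out ns) [] [] [] [] [] [])"
    by (rule exec_eq[OF exec_clear[where n = M]]) (use l[OF assms(6)] in \<open>simp_all add: store_simps\<close>)
  have "mk [v, [], [], [], [], [], [], [], [], [], [], [], [], [], [], [], [], [], []] = (\<lambda>_. [])(0 := v)" for v
    by (auto simp: fun_eq_iff mk_def nth_Cons split: nat.splits)
  then have 7: "exec (Drain 1 (Push 0)) (?S (out ns) [] [] [] [] [] []) (5 * length (out ns) + 1)
      (single_store (concat (map enc_nat ns)))"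
    by (intro exec_eq[OF exec_Move]) (simp_all add: store_simps single_store_def out_def)
  show ?thesis unfolding clear_prog_def foldr.simps comp_def id_def
    by (rule exec_SeqI[OF 1 exec_SeqI[OF 2 exec_SeqI[OF 3 exec_SeqI[OF 4 exec_SeqI[OF 5 exec_SeqI[OF 6 7 order_refl]
      order_refl] order_refl] order_refl] order_refl]]) simp
qed

text \<open>Bounds the length of the emitted code by the time spent on it, which avoids summing up
  token lengths.\<close>

lemma exec_length: "exec c s m s' \<Longrightarrow> length (s' i) \<le> length (s i) + m"
proof (induction rule: exec.induct)
  case (exec_Seq c s m s' d m' s'')
  then show ?case by linarith
next
  case (exec_While_True s j P c m s' m' s'')
  then show ?case by linarith
qed (simp_all add: le_diff_conv)

section \<open>Sizes of the grid and the total running time\<close>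

definition ylen :: "nat \<Rightarrow> nat \<Rightarrow> bool list \<Rightarrow> nat" where
  "ylen c d x = c * (length x + 1) ^ d"

definition irow :: "nat \<Rightarrow> nat \<Rightarrow> bool list \<Rightarrow> nat list" where
  "irow c d x = mark_head (input_row x (ylen c d x))"

text \<open>The initial row is as long as the longest \<open>pair_enc x y\<close> with an admissible
  witness, so with suitable constants the padding exceeds the running time on every such
  pair.\<close>

definition zlen :: "nat \<Rightarrow> nat \<Rightarrow> nat \<Rightarrow> nat \<Rightarrow> bool list \<Rightarrow> nat" where
  "zlen c d c' d' x = c' * (length (irow c d x) + 1) ^ d'"

definition first_rows :: "nat \<Rightarrow> nat \<Rightarrow> nat \<Rightarrow> nat \<Rightarrow> bool list \<Rightarrow> nat list" where
  "first_rows c d c' d' x = rows (zlen c d c' d' x) (irow c d x)"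

definition full_grid :: "nat \<Rightarrow> nat \<Rightarrow> nat \<Rightarrow> nat \<Rightarrow> bool list \<Rightarrow> nat list" where
  "full_grid c d c' d' x = grid (zlen c d c' d' x) (first_rows c d c' d' x)"

lemma length_irow: "length (irow c d x) = 2 * length x + 2 + ylen c d x"
proof -
  have "length (mark_head l) = length l" for l by (cases l) auto
  then show ?thesis by (simp add: irow_def input_row_def del: map_map)
qed

lemma set_irow: "set (irow c d x) \<subseteq> {1..5}"
  by (cases x) (auto simp: irow_def input_row_def sym_of_bit_def)

lemma length_first_rows: "length (first_rows c d c' d' x) = 2 * zlen c d c' d' x + length (irow c d x)"
  by (simp add: first_rows_def rows_def)

lemma set_first_rows: "set (first_rows c d c' d' x) \<subseteq> {1..6}"
  using set_irow[of c d x] by (auto simp: first_rows_def rows_def)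

lemma length_full_grid: "length (full_grid c d c' d' x) =
    2 * length (first_rows c d c' d' x) + zlen c d c' d' x * length (first_rows c d c' d' x) + 1"
  by (simp add: full_grid_def grid_def)

lemma set_full_grid: "set (full_grid c d c' d' x) \<subseteq> {1..8}"
  using set_first_rows[of c d c' d' x] by (auto simp: full_grid_def grid_def)

lemma pbounded_ylen: "pbounded (ylen c d)"
  unfolding ylen_def by (intro pbounded_mult pbounded_power pbounded_add pbounded_length pbounded_const)

lemma pbounded_irow: "pbounded (\<lambda>x. length (irow c d x))"
  unfolding length_irow by (intro pbounded_mult pbounded_add pbounded_length pbounded_const pbounded_ylen)

lemma pbounded_zlen: "pbounded (zlen c d c' d')"
  unfolding zlen_def by (intro pbounded_mult pbounded_power pbounded_add pbounded_irow pbounded_const)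

lemma pbounded_first_rows: "pbounded (\<lambda>x. length (first_rows c d c' d' x))"
  unfolding length_first_rows by (intro pbounded_mult pbounded_add pbounded_irow pbounded_const pbounded_zlen)

lemma pbounded_full_grid: "pbounded (\<lambda>x. length (full_grid c d c' d' x))"
  unfolding length_full_grid by (intro pbounded_mult pbounded_add pbounded_first_rows pbounded_const pbounded_zlen)

definition grid_nums :: "nat \<Rightarrow> nat \<Rightarrow> nat \<Rightarrow> nat \<Rightarrow> nat \<Rightarrow> tok list \<Rightarrow> tok list \<Rightarrow> (nat \<Rightarrow> tok list) \<Rightarrow> bool list \<Rightarrow> nat list" where
  "grid_nums c d c' d' k hdr bnd tmpl x = (let K = full_grid c d c' d' x; w = length (first_rows c d c' d' x) in
     head_nums k hdr bnd (length K) @ body_nums tmpl w K (length K))"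

definition reduction_prog :: "nat \<Rightarrow> nat \<Rightarrow> nat \<Rightarrow> nat \<Rightarrow> nat \<Rightarrow> tok list \<Rightarrow> tok list \<Rightarrow> (nat \<Rightarrow> tok list) \<Rightarrow> com" where
  "reduction_prog c d c' d' k hdr bnd tmpl = (Pow c 0 10 d ;; row_prog ;; Pow c' 11 12 d' ;; rows_prog ;; grid_prog ;;
     head_prog k hdr bnd ;; body_prog tmpl) ;; clear_prog"

lemma single_store_mk:
  "single_store x = mk [map sym_of_bit x, [], [], [], [], [], [], [], [], [], [], [], [], [], [], [], [], [], []]"
  by (auto simp: fun_eq_iff mk_def nth_Cons single_store_def split: nat.splits)

lemma poly_time_computable_grid_nums:
  assumes toks: "list_all (tok_ok {8, 9}) hdr" "list_all (tok_ok {8, 9}) bnd" "\<And>a. list_all (tok_ok {4, 5, 6, 7}) (tmpl a)"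
  shows "poly_time_computable (\<lambda>x. concat (map enc_nat (grid_nums c d c' d' k hdr bnd tmpl x)))"
proof -
  \<comment> \<open>A sum in place of a maximum over the cell classes.\<close>
  define tm where "tm = (\<Sum>a\<le>8. toks_cost (tmpl a))"
  have tm: "toks_cost (tmpl a) \<le> tm" if "a \<le> 8" for a
    unfolding tm_def using that by (intro member_le_sum) auto
  define N where "N x = length (full_grid c d c' d' x)" for x
  define w where "w x = length (first_rows c d c' d' x)" for x
  define C3 where "C3 = toks_cost hdr + toks_cost bnd + toks_cost [Hole k 0 8] + 9"
  define B1 where "B1 x = pow_cost c (length x) d + (5 * ylen c d x + 12 * length x + 14) +
    pow_cost c' (length (irow c d x)) d' + (14 * zlen c d c' d' x + 10 * length (irow c d x) + 7) +
    (w x * (9 * w x + 49) + zlen c d c' d' x * (12 * w x + 7) + 13) +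
    (C3 * (N x + 2) + N x * (toks_cost bnd * (N x + 2) + 18 * N x + 60)) +
    (N x * (tm * (N x + w x + 4) + 36 * (N x + w x) + 120) + 20) + 6" for x
  define B where "B x = B1 x + (30 * (N x + w x + 3) + 5 * B1 x + 13) + 1" for x
  let ?K = "\<lambda>x. full_grid c d c' d' x" and ?R = "\<lambda>x. first_rows c d c' d' x"
  have ex: "exec (reduction_prog c d c' d' k hdr bnd tmpl) (single_store x) (B x)
      (single_store (concat (map enc_nat (grid_nums c d c' d' k hdr bnd tmpl x))))" for x
  proof -
    have K: "0 \<notin> set (?K x)" "?K x \<noteq> []" "\<And>a. a \<in> set (?K x) \<Longrightarrow> a \<le> 8"
      using set_full_grid[of c d c' d' x] length_full_grid[of c d c' d' x] by auto
    have R: "0 \<notin> set (?R x)" using set_first_rows[of c d c' d' x] by auto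
    have I: "0 \<notin> set (irow c d x)" using set_irow[of c d x] by auto
    let ?hn = "head_nums k hdr bnd (N x)"
    have 1: "exec (Pow c 0 10 d) (single_store x) (pow_cost c (length x) d)
       (mk [map sym_of_bit x, [], [], [], [], [], [], [], [], [], replicate (ylen c d x) 1, [], [], [], [], [], [], [], []])"
      unfolding single_store_mk by (rule exec_eq[OF exec_Pow]) (simp_all add: store_simps ylen_def)
    have 2: "exec row_prog
       (mk [map sym_of_bit x, [], [], [], [], [], [], [], [], [], replicate (ylen c d x) 1, [], [], [], [], [], [], [], []])
       (5 * ylen c d x + 12 * length x + 14)
       (mk [[], [], [], [], [], [], [], [], [], [], [], irow c d x, [], [], [], [], [], [], []])"
      unfolding irow_def by (rule exec_row_prog)
    have 3: "exec (Pow c' 11 12 d') (mk [[], [], [], [], [], [], [], [], [], [], [], irow c d x, [], [], [], [], [], [], []])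
       (pow_cost c' (length (irow c d x)) d')
       (mk [[], [], [], [], [], [], [], [], [], [], [], irow c d x, replicate (zlen c d c' d' x) 1, [], [], [], [], [], []])"
      by (rule exec_eq[OF exec_Pow]) (use I in \<open>simp_all add: store_simps zlen_def\<close>)
    have 4: "exec rows_prog
       (mk [[], [], [], [], [], [], [], [], [], [], [], irow c d x, replicate (zlen c d c' d' x) 1, [], [], [], [], [], []])
       (14 * zlen c d c' d' x + 10 * length (irow c d x) + 7)
       (mk [[], [], [], [], [], [], [], [], [], [], [], [], [], [], replicate (zlen c d c' d' x) 1, ?R x, [], [], []])"
      unfolding first_rows_def by (rule exec_rows_prog[OF I])
    have 5: "exec grid_prog
       (mk [[], [], [], [], [], [], [], [], [], [], [], [], [], [], replicate (zlen c d c' d' x) 1, ?R x, [], [], []])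
       (w x * (9 * w x + 49) + zlen c d c' d' x * (12 * w x + 7) + 13)
       (mk [[], [], [], [], [], [], [], bsym (w x + 2), [], [], [], [], [], [], [], [], [], [], ?K x])"
      unfolding w_def full_grid_def by (rule exec_grid_prog[OF R])
    have 6: "exec (head_prog k hdr bnd)
       (mk [[], [], [], [], [], [], [], bsym (w x + 2), [], [], [], [], [], [], [], [], [], [], ?K x])
       (C3 * (N x + 2) + N x * (toks_cost bnd * (N x + 2) + 18 * N x + 60))
       (mk [[], out ?hn, [], [], [], [], [], bsym (w x + 2), bsym (N x), bsym (N x + 1),
         [], [], [], [], [], [], [], [], ?K x])"
      unfolding N_def C3_def by (rule exec_head_prog[OF toks(1,2) K(1,2)])
    have 7: "exec (body_prog tmpl)
       (mk [[], out ?hn, [], [], [], [], [], bsym (w x + 2), bsym (N x), bsym (N x + 1),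
         [], [], [], [], [], [], [], [], ?K x])
       (N x * (tm * (N x + w x + 4) + 36 * (N x + w x) + 120) + 20)
       (mk [[], out (?hn @ body_nums tmpl (w x) (?K x) (N x)), [], [], bsym (N x + 1), bsym (N x + 2), bsym (N x + 3),
         bsym (N x + w x + 2), bsym (N x), bsym (N x + 1), [], [], [], [], [], [], [], [], []])"
      unfolding N_def by (rule exec_body_prog[OF toks(3) tm K(1)]) (rule K(3))
    have 8: "exec (Pow c 0 10 d ;; row_prog ;; Pow c' 11 12 d' ;; rows_prog ;; grid_prog ;;
         head_prog k hdr bnd ;; body_prog tmpl) (single_store x) (B1 x)
       (mk [[], out (?hn @ body_nums tmpl (w x) (?K x) (N x)), [], [], bsym (N x + 1), bsym (N x + 2), bsym (N x + 3),
         bsym (N x + w x + 2), bsym (N x), bsym (N x + 1), [], [], [], [], [], [], [], [], []])"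
      by (rule exec_SeqI[OF 1 exec_SeqI[OF 2 exec_SeqI[OF 3 exec_SeqI[OF 4 exec_SeqI[OF 5 exec_SeqI[OF 6 7 order_refl]
        order_refl] order_refl] order_refl] order_refl]]) (simp add: B1_def)
    from exec_length[OF this, of 1] have len: "length (out (?hn @ body_nums tmpl (w x) (?K x) (N x))) \<le> B1 x"
      by (simp add: single_store_mk)
    have 9: "exec clear_prog
       (mk [[], out (?hn @ body_nums tmpl (w x) (?K x) (N x)), [], [], bsym (N x + 1), bsym (N x + 2), bsym (N x + 3),
         bsym (N x + w x + 2), bsym (N x), bsym (N x + 1), [], [], [], [], [], [], [], [], []])
       (30 * (N x + w x + 3) + 5 * length (out (?hn @ body_nums tmpl (w x) (?K x) (N x))) + 13)
       (single_store (concat (map enc_nat (?hn @ body_nums tmpl (w x) (?K x) (N x)))))"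
      by (rule exec_clear_prog) simp_all
    have "exec (reduction_prog c d c' d' k hdr bnd tmpl) (single_store x) (B x)
        (single_store (concat (map enc_nat (?hn @ body_nums tmpl (w x) (?K x) (N x)))))"
      unfolding reduction_prog_def by (rule exec_SeqI[OF 8 9]) (use len in \<open>simp add: B_def\<close>)
    then show ?thesis by (simp only: grid_nums_def Let_def w_def N_def)
  qed
  \<comment> \<open>Stacks 0 to 18; the symbols are 0 to 8, class 8 being the largest one
    pushed.\<close>
  have ok: "ok_com 19 9 (reduction_prog c d c' d' k hdr bnd tmpl)"
    using ok_EmitToks[OF toks(1), of 19 9] ok_EmitToks[OF toks(2), of 19 9] ok_EmitToks[OF toks(3), of 19 9]
      ok_EmitToks[of "{8}" "[Hole k 0 8]" 19 9]
    unfolding reduction_prog_def row_prog_def rows_prog_def grid_prog_def head_prog_def body_prog_def clear_prog_def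
    by (auto intro!: ok_Drain ok_Pow ok_Inc)
  have pN: "pbounded N" and pw: "pbounded w"
    unfolding N_def w_def by (rule pbounded_full_grid, rule pbounded_first_rows)
  have pB1: "pbounded B1" unfolding B1_def
    by (intro pbounded_add pbounded_mult pbounded_const pbounded_length pbounded_pow_cost pbounded_ylen pbounded_irow
      pbounded_zlen pN pw)
  have pB: "pbounded B" unfolding B_def
    by (intro pbounded_add pbounded_mult pbounded_const pN pw pB1)
  show ?thesis by (rule exec_poly_time_computable[OF ok _ _ ex pB]) simp_all
qed

section \<open>Local rules of a computation tableau\<close>

type_synonym cell = "nat \<times> nat \<times> bool"

text \<open>State numbers are shifted by one so that 0 can mean that the head is elsewhere.\<close>

definition cell_of :: "nat \<times> int \<times> (int \<Rightarrow> nat) \<Rightarrow> int \<Rightarrow> cell" where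
  "cell_of C j = (case C of (q, h, T) \<Rightarrow> (T j, if j = h then Suc q else 0, False))"

definition nxt :: "tm \<Rightarrow> cell \<Rightarrow> cell \<Rightarrow> cell \<Rightarrow> cell" where
  "nxt M a b c = (case (a, b, c) of ((sa, qa, _), (sb, qb, _), (sc, qc, _)) \<Rightarrow>
     if qb \<noteq> 0 then (case ndelta M (qb - 1) sb of (q', s, m) \<Rightarrow> (s, if m = MoveN then Suc q' else 0, False))
     else (sb,
       if qa \<noteq> 0 \<and> snd (snd (ndelta M (qa - 1) sa)) = MoveR then Suc (fst (ndelta M (qa - 1) sa))
       else if qc \<noteq> 0 \<and> snd (snd (ndelta M (qc - 1) sc)) = MoveL then Suc (fst (ndelta M (qc - 1) sc))
       else 0, False))"

text \<open>A cell can change only if the head is at distance at most one, and then one of the three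
  arguments carries the state.\<close>

lemma nxt_cell_of:
  "cell_of (fstep (ndelta M) C) j = nxt M (cell_of C (j - 1)) (cell_of C j) (cell_of C (j + 1))"
proof -
  obtain q h T where C: "C = (q, h, T)" by (cases C)
  obtain q' s m where d: "ndelta M q (T h) = (q', s, m)" by (cases "ndelta M q (T h)")
  consider "j = h" | "j = h + 1" | "j = h - 1" | "j \<noteq> h" "j \<noteq> h + 1" "j \<noteq> h - 1" by blast
  then show ?thesis
    by cases (cases m; simp add: C d cell_of_def nxt_def fstep_def)+
qed

text \<open>The witness flag belongs to the initial row only and must not influence the run;
  comparisons with true configurations are made after erasing it.\<close>

definition strip :: "cell \<Rightarrow> cell" where
  "strip c = (fst c, fst (snd c), False)"

lemma nxt_strip: "nxt M (strip a) (strip b) (strip c) = nxt M a b c"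
  by (cases a; cases b; cases c) (simp add: strip_def nxt_def)

lemma strip_cell_of: "strip (cell_of C j) = cell_of C j"
  by (simp add: strip_def cell_of_def split: prod.splits)

text \<open>The flag marks the cells of the initial row that hold the guessed witness; a marked blank
  must not be followed by a marked bit. A cell with head in the halting state must be accepting.\<close>

definition wrel :: "tm \<Rightarrow> cell \<Rightarrow> cell \<Rightarrow> cell \<Rightarrow> cell \<Rightarrow> bool" where
  "wrel M a b c d \<longleftrightarrow> d = nxt M a b c \<and>
     \<not> (snd (snd b) \<and> snd (snd c) \<and> fst b = 0 \<and> fst c \<noteq> 0) \<and>
     \<not> (fst (snd b) = 2 \<and> (fst b \<noteq> 2 \<or> fst c \<in> {1, 2}))"

section \<open>Configurations over time\<close>

definition conf :: "tm \<Rightarrow> bool list \<Rightarrow> nat \<Rightarrow> nat \<times> int \<times> (int \<Rightarrow> nat)" where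
  "conf M v t = (fstep (ndelta M) ^^ t) (0, 0, init_tape v)"

definition accepting :: "nat \<times> int \<times> (int \<Rightarrow> nat) \<Rightarrow> bool" where
  "accepting C = (case C of (q, h, T) \<Rightarrow> T h = 2 \<and> T (h + 1) \<notin> {1, 2})"

lemma conf_0: "conf M v 0 = (0, 0, init_tape v)"
  by (simp add: conf_def)

lemma conf_Suc: "conf M v (Suc t) = fstep (ndelta M) (conf M v t)"
  by (simp add: conf_def)

lemma conf_halted: "t \<le> t' \<Longrightarrow> fst (conf M v t) = 1 \<Longrightarrow> conf M v t' = conf M v t"
proof (induction t' rule: dec_induct)
  case (step n)
  then show ?case by (cases "conf M v t") (simp add: conf_Suc fstep_def ndelta_def)
qed simp

lemma conf_head: "\<bar>fst (snd (conf M v t))\<bar> \<le> int t"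
proof (induction t)
  case (Suc t)
  obtain q h T where C: "conf M v t = (q, h, T)" by (cases "conf M v t")
  obtain q' s m where d: "ndelta M q (T h) = (q', s, m)" by (cases "ndelta M q (T h)")
  show ?case using Suc by (cases m) (simp_all add: conf_Suc C fstep_def d)
qed (simp add: conf_0)

lemma conf_far: "\<bar>p\<bar> > int t \<Longrightarrow> snd (snd (conf M v t)) p = init_tape v p"
proof (induction t)
  case (Suc t)
  obtain q h T where C: "conf M v t = (q, h, T)" by (cases "conf M v t")
  obtain q' s m where d: "ndelta M q (T h) = (q', s, m)" by (cases "ndelta M q (T h)")
  have "\<bar>h\<bar> \<le> int t" using conf_head[of M v t] C by simp
  then have "p \<noteq> h" using Suc.prems by linarith
  then show ?case using Suc by (simp add: conf_Suc C fstep_def d)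
qed (simp add: conf_0)

lemma conf_bounded:
  assumes "wf_tm M"
  shows "fst (conf M v t) < nstates M \<and> (\<forall>p. snd (snd (conf M v t)) p < nsyms M)"
proof (induction t)
  case 0
  then show ?case using assms
    by (auto simp: conf_0 wf_tm_def init_tape_def nth0_def sym_of_bit_def)
next
  case (Suc t)
  obtain q h T where C: "conf M v t = (q, h, T)" by (cases "conf M v t")
  obtain q' s m where d: "ndelta M q (T h) = (q', s, m)" by (cases "ndelta M q (T h)")
  have qT: "q < nstates M" "\<And>p. T p < nsyms M" using Suc C by auto
  have "\<forall>q<nstates M. \<forall>s<nsyms M. case delta M q s of (q', s', m) \<Rightarrow> q' < nstates M \<and> s' < nsyms M"
    using assms by (simp add: wf_tm_def)
  from this[rule_format, OF qT(1) qT(2)]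
  have "case delta M q (T h) of (q', s, m) \<Rightarrow> q' < nstates M \<and> s < nsyms M" .
  then have "q' < nstates M \<and> s < nsyms M"
    using d qT by (cases "q = 1") (auto simp: ndelta_def)
  then show ?case using qT by (simp add: conf_Suc C fstep_def d)
qed

text \<open>A True bit under the head followed by a non-bit: two adjacent cells decide
  acceptance.\<close>

lemma tm_output_True:
  assumes "tape_of c C" shows "tm_output c = [True] \<longleftrightarrow> accepting C"
proof -
  obtain q ls rs where c: "c = (q, ls, rs)" by (cases c)
  obtain h T where C: "C = (q, h, T)" using assms c by (cases C) (auto simp: tape_of_def)
  have "T h = nth0 rs 0" "T (h + 1) = nth0 rs 1" using assms by (auto simp: c C tape_of_def)
  then show ?thesis
    by (cases rs; cases "tl rs") (auto simp: c C accepting_def tm_output_def)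
qed

text \<open>After a blank only blanks follow, so the nonblank symbols form an initial segment and
  spell a witness.\<close>

lemma sym_list_bits:
  assumes "\<And>i. i < n \<Longrightarrow> s i \<in> {0, 1, 2 :: nat}" "\<And>i. Suc i < n \<Longrightarrow> s i = 0 \<Longrightarrow> s (Suc i) = 0"
  shows "\<exists>y. length y \<le> n \<and> (\<forall>i<n. s i = nth0 (map sym_of_bit y) i)"
  using assms
proof (induction n arbitrary: s)
  case (Suc n)
  show ?case
  proof (cases "s 0 = 0")
    case True
    have "s i = 0" if "i < Suc n" for i
      using that by (induction i) (use True Suc.prems(2) in auto)
    then show ?thesis by (intro exI[of _ "[]"]) simp
  next
    case False
    have "\<exists>y. length y \<le> n \<and> (\<forall>i<n. s (Suc i) = nth0 (map sym_of_bit y) i)"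
      by (rule Suc.IH) (use Suc.prems in auto)
    then obtain y where y: "length y \<le> n" "\<forall>i<n. s (Suc i) = nth0 (map sym_of_bit y) i" by blast
    obtain b where b: "sym_of_bit b = s 0"
      using False Suc.prems(1)[of 0] that[of True] that[of False] by auto
    have "s i = nth0 (map sym_of_bit (b # y)) i" if "i < Suc n" for i
      using that y(2) by (cases i) (simp_all add: b)
    then show ?thesis using y(1) by (intro exI[of _ "b # y"]) simp
  qed
qed (intro exI[of _ "[]"], simp)

definition prefix_bits :: "bool list \<Rightarrow> bool list" where
  "prefix_bits x = doubled x @ [False, True]"

lemma pair_enc_prefix_bits: "pair_enc x y = prefix_bits x @ y"
  by (simp add: pair_enc_def prefix_bits_def)

lemma length_prefix_bits: "length (prefix_bits x) = 2 * length x + 2"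
  by (simp add: prefix_bits_def)

locale tableau =
  fixes M :: tm and x :: "bool list" and Y z w m :: nat and R :: "nat list" and cls :: "nat \<Rightarrow> cell set"
  assumes wf: "wf_tm M"
    and R_def: "R = rows z (mark_head (input_row x Y))"
    and m_def: "m = 2 * length x + 2 + Y"
    and w_def: "w = 2 * z + m"
    and z_pos: "0 < z"
    and cls: "cls 1 = {(1, 0, False)}" "cls 2 = {(2, 0, False)}" "cls 3 = {(1, 1, False)}" "cls 4 = {(2, 1, False)}"
      "cls 5 = {(0, 0, True), (1, 0, True), (2, 0, True)}" "cls 6 = {(0, 0, False)}"
begin

lemma m_pos: "0 < m"
  by (simp add: m_def)

text \<open>The witness columns: tape cell 0 sits in column \<open>z\<close>, and the next
  \<open>2 * length x + 2\<close> columns hold the encoded input and the separator, starting with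
  column \<open>z\<close> itself.\<close>

definition guess :: "nat \<Rightarrow> bool" where
  "guess r \<longleftrightarrow> z + 2 * length x + 2 \<le> r \<and> r < z + m"

lemma input_row_nth:
  "i < m \<Longrightarrow> input_row x Y ! i = (if i < 2 * length x + 2 then sym_of_bit (prefix_bits x ! i) else 5)"
proof -
  assume "i < m"
  have "input_row x Y = map sym_of_bit (prefix_bits x) @ replicate Y 5"
    by (simp add: input_row_def prefix_bits_def map_concat comp_def)
  then show ?thesis using \<open>i < m\<close> by (auto simp: nth_append length_prefix_bits m_def)
qed

lemma length_R: "length (input_row x Y) = m" "length (mark_head (input_row x Y)) = m" "length R = w"
proof -
  show m: "length (input_row x Y) = m" by (simp add: input_row_def m_def del: map_map)
  have "length (mark_head l) = length l" for l by (cases l) auto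
  then show "length (mark_head (input_row x Y)) = m" "length R = w"
    using m by (auto simp: R_def rows_def w_def)
qed

lemma mark_head_nth: "i < length l \<Longrightarrow> mark_head l ! i = (if i = 0 then l ! 0 + 2 else l ! i)"
  by (cases l; cases i) auto

lemma R_nth:
  assumes "r < w"
  shows "R ! r = (if z \<le> r \<and> r < z + m then (if guess r then 5
     else sym_of_bit (prefix_bits x ! (r - z)) + (if r = z then 2 else 0)) else 6)"
proof -
  consider "r < z" | "z \<le> r" "r < z + m" | "z + m \<le> r" by linarith
  then show ?thesis
  proof cases
    case 2
    then have rz: "r - z < m" by linarith
    then have "R ! r = mark_head (input_row x Y) ! (r - z)"
      using 2 by (simp add: R_def rows_def nth_append length_R)
    also have "\<dots> = (if r - z = 0 then input_row x Y ! 0 + 2 else input_row x Y ! (r - z))"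
      using rz by (simp add: mark_head_nth length_R)
    finally have "R ! r = \<dots>" .
    moreover have "guess r \<longleftrightarrow> \<not> r - z < 2 * length x + 2" using 2 by (auto simp: guess_def)
    ultimately show ?thesis using 2 rz m_pos input_row_nth[of "r - z"] input_row_nth[of 0] by auto
  qed (use assms in \<open>auto simp: R_def rows_def nth_append length_R w_def\<close>)
qed

text \<open>Outside the witness columns the initial configuration does not depend on
  \<open>y\<close>: the padding is blank and the prefix of the pair code is determined by
  \<open>x\<close>.\<close>

lemma cls_R:
  assumes "r < w" "length y \<le> Y" "\<not> guess r"
  shows "cls (R ! r) = {cell_of (conf M (pair_enc x y) 0) (int r - int z)}"
proof -
  have lv: "length (pair_enc x y) \<le> m" using assms(2) by (simp add: pair_enc_prefix_bits length_prefix_bits m_def)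
  show ?thesis
  proof (cases "z \<le> r \<and> r < z + m")
    case True
    then have r: "r - z < length (prefix_bits x)" using assms(3) by (auto simp: guess_def length_prefix_bits)
    then have it: "init_tape (pair_enc x y) (int r - int z) = sym_of_bit (prefix_bits x ! (r - z))"
      using True by (simp add: init_tape_def nth0_def pair_enc_prefix_bits nth_append nat_diff_distrib')
    have "cls (Suc 0) = {(1, 0, False)}" "cls (Suc (Suc 0)) = {(2, 0, False)}"
      "cls (Suc (Suc (Suc 0))) = {(1, 1, False)}"
      using cls(1-3) by (simp_all add: numeral_2_eq_2 numeral_3_eq_3)
    then show ?thesis using R_nth[OF assms(1)] True assms(3) it
      by (cases "prefix_bits x ! (r - z)"; cases "r = z") (simp_all add: conf_0 cell_of_def cls)
  next
    case False
    then have "init_tape (pair_enc x y) (int r - int z) = 0"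
      using lv by (auto simp: init_tape_def nth0_def)
    then show ?thesis using R_nth[OF assms(1)] False m_pos by (auto simp: conf_0 cell_of_def cls)
  qed
qed

lemma cls_guess: "guess r \<Longrightarrow> r < w \<Longrightarrow> cls (R ! r) = {(0, 0, True), (1, 0, True), (2, 0, True)}"
  using R_nth[of r] cls(5) by (auto simp: guess_def)

text \<open>At the row ends the local rule reads cells of other rows, so nothing is claimed there.
  Such errors travel inwards by one column per row. The padding is wide enough that at the halting
  time the head and its right neighbour still lie in the trusted columns.\<close>

lemma sound:
  assumes D: "\<And>r. r < w \<Longrightarrow> D r \<in> cls (R ! r)"
    and win: "\<And>i. i + w + 1 < (z + 1) * w \<Longrightarrow> wrel M (D i) (D (i + 1)) (D (i + 2)) (D (i + w + 1))"
    and halt: "\<And>y. length y \<le> Y \<Longrightarrow> \<exists>t. 2 * t + 2 \<le> z \<and> fst (conf M (pair_enc x y) t) = 1"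
  shows "\<exists>y t. length y \<le> Y \<and> fst (conf M (pair_enc x y) t) = 1 \<and> accepting (conf M (pair_enc x y) t)"
proof -
  let ?g = "\<lambda>i. z + 2 * length x + 2 + i"
  have g: "guess (?g i)" "?g i < w" if "i < Y" for i
    unfolding guess_def using that m_def w_def by linarith+
  have big: "2 * w \<le> (z + 1) * w" using z_pos by simp
  have Dg: "D (?g i) \<in> {(0, 0, True), (1, 0, True), (2, 0, True)}" if "i < Y" for i
    using D[OF g(2)[OF that]] cls_guess[OF g[OF that]] by simp
  have "\<exists>y. length y \<le> Y \<and> (\<forall>i<Y. fst (D (?g i)) = nth0 (map sym_of_bit y) i)"
  proof (rule sym_list_bits)
    show "fst (D (?g i)) \<in> {0, 1, 2}" if "i < Y" for i using Dg[OF that] by auto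
    show "fst (D (?g (Suc i))) = 0" if "Suc i < Y" "fst (D (?g i)) = 0" for i
    proof -
      \<comment> \<open>The window starts one cell early, which makes the guessed cell its middle
        and the next guessed cell its third entry, the pair that the flag condition of
        \<open>wrel\<close> tests.\<close>
      have "?g i - 1 + w + 1 < 2 * w" using g(2)[of i] that(1) by linarith
      then have "wrel M (D (?g i - 1)) (D (?g i - 1 + 1)) (D (?g i - 1 + 2)) (D (?g i - 1 + w + 1))"
        by (rule win[OF less_le_trans[OF _ big]])
      moreover have "?g i - 1 + 1 = ?g i" "?g i - 1 + 2 = ?g (Suc i)" by simp_all
      ultimately show ?thesis using Dg[of i] Dg[of "Suc i"] that by (auto simp: wrel_def)
    qed
  qed
  then obtain y where y: "length y \<le> Y" "\<And>i. i < Y \<Longrightarrow> fst (D (?g i)) = nth0 (map sym_of_bit y) i" by blast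
  let ?C = "conf M (pair_enc x y)"
  \<comment> \<open>Tape cell \<open>j\<close> sits in column \<open>z + j\<close>; the hypotheses
    keep this column at least \<open>t\<close> places inside the first and the last column.\<close>
  have row: "t \<le> z \<Longrightarrow> int t \<le> j + int z \<Longrightarrow> j + int t < int z + int m \<Longrightarrow>
      strip (D (nat (int (t * w) + int z + j))) = cell_of (?C t) j" for t j
  proof (induction t arbitrary: j)
    case 0
    define r where "r = nat (int z + j)"
    have r: "r < w" "int r - int z = j" using 0 by (auto simp: r_def w_def)
    have "strip (D r) = cell_of (?C 0) j"
    proof (cases "guess r")
      case True
      then have "z + 2 * length x + 2 \<le> r" "r < z + m" by (simp_all add: guess_def)
      then have "r = ?g (r - (z + 2 * length x + 2))" "r - (z + 2 * length x + 2) < Y"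
        using m_def by linarith+
      then obtain i where i: "r = ?g i" "i < Y" by blast
      have "j = int (length (prefix_bits x) + i)" using i(1) r(2) by (simp add: length_prefix_bits)
      then have "init_tape (pair_enc x y) j = nth0 (map sym_of_bit y) i"
        by (simp add: init_tape_def nth0_def pair_enc_prefix_bits nth_append del: of_nat_add)
      moreover have "j \<noteq> 0" using \<open>j = _\<close> by (simp add: length_prefix_bits)
      ultimately show ?thesis using Dg[OF i(2)] y(2)[OF i(2)] i(1)
        by (auto simp: conf_0 cell_of_def strip_def)
    next
      case False
      then show ?thesis using D[OF r(1)] cls_R[OF r(1) y(1) False] r(2) strip_cell_of by simp
    qed
    then show ?case by (simp add: r_def)
  next
    case (Suc t)
    \<comment> \<open>The index of the left neighbour, so that the cell below the middle one is
      \<open>i + w + 1\<close>.\<close>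
    define i where "i = nat (int (t * w) + int z + j - 1)"
    have nn: "0 \<le> int (t * w)" by simp
    have i: "int i = int (t * w) + int z + j - 1" unfolding i_def using Suc.prems nn by linarith
    have j: "int z + j < int w" using Suc.prems(3) by (simp add: w_def)
    have "int (i + w + 1) < int ((t + 1) * w + w)" using i j by (simp add: algebra_simps)
    also have "(t + 1) * w + w = (t + 2) * w" by simp
    also have "int ((t + 2) * w) \<le> int ((z + 1) * w)" using Suc.prems(1) by (intro of_nat_mono mult_le_mono1) simp
    finally have "i + w + 1 < (z + 1) * w" by linarith
    from win[OF this] have "D (i + w + 1) = nxt M (D i) (D (i + 1)) (D (i + 2))" by (simp add: wrel_def)
    also have "\<dots> = nxt M (strip (D i)) (strip (D (i + 1))) (strip (D (i + 2)))" by (simp add: nxt_strip)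
    also have "strip (D i) = cell_of (?C t) (j - 1)"
      using Suc.IH[of "j - 1"] Suc.prems by (simp add: i_def algebra_simps)
    also have "i + 1 = nat (int (t * w) + int z + j)" using i by linarith
    also have "strip (D (nat (int (t * w) + int z + j))) = cell_of (?C t) j"
      using Suc.IH[of j] Suc.prems by simp
    also have "i + 2 = nat (int (t * w) + int z + (j + 1))" using i by linarith
    also have "strip (D (nat (int (t * w) + int z + (j + 1)))) = cell_of (?C t) (j + 1)"
      using Suc.IH[of "j + 1"] Suc.prems by simp
    finally have "D (i + w + 1) = cell_of (?C (Suc t)) j" by (simp add: nxt_cell_of conf_Suc)
    moreover have "i + w + 1 = nat (int (Suc t * w) + int z + j)" using i by (simp add: algebra_simps)
    ultimately show ?case by (simp add: strip_cell_of)
  qed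
  obtain t where t: "2 * t + 2 \<le> z" "fst (?C t) = 1" using halt[OF y(1)] by blast
  obtain h T where C: "?C t = (1, h, T)" using t(2) by (cases "?C t") auto
  have h: "\<bar>h\<bar> \<le> int t" using conf_head[of M "pair_enc x y" t] C by simp
  have nn: "0 \<le> int (t * w)" by simp
  define i where "i = nat (int (t * w) + int z + h - 1)"
  have i: "int i = int (t * w) + int z + h - 1" unfolding i_def using t(1) h nn by linarith
  have b: "strip (D (i + 1)) = cell_of (?C t) h"
  proof -
    have "i + 1 = nat (int (t * w) + int z + h)" using i by linarith
    moreover have "int t \<le> h + int z" "h + int t < int z + int m" using h t(1) by linarith+
    ultimately show ?thesis using row[of t h] t(1) by simp
  qed
  have c: "strip (D (i + 2)) = cell_of (?C t) (h + 1)"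
  proof -
    have "i + 2 = nat (int (t * w) + int z + (h + 1))" using i by linarith
    moreover have "int t \<le> h + 1 + int z" "h + 1 + int t < int z + int m" using h t(1) by linarith+
    ultimately show ?thesis using row[of t "h + 1"] t(1) by simp
  qed
  \<comment> \<open>The window at the head of the halting row has its fourth cell one row below,
    still inside the grid because \<open>t + 2 \<le> z + 1\<close>.\<close>
  have "int (i + w + 1) < int ((t + 2) * w)"
    using i h t(1) w_def by (simp add: algebra_simps)
  also have "int ((t + 2) * w) \<le> int ((z + 1) * w)" using t(1) by (intro of_nat_mono mult_le_mono1) simp
  finally have "wrel M (D i) (D (i + 1)) (D (i + 2)) (D (i + w + 1))" by (intro win) linarith
  moreover have "fst (D (i + 1)) = T h" "fst (snd (D (i + 1))) = 2" "fst (D (i + 2)) = T (h + 1)"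
    using b c by (auto simp: strip_def cell_of_def C)
  ultimately have "accepting (?C t)" by (auto simp: wrel_def accepting_def C)
  then show ?thesis using y(1) t(2) by blast
qed

text \<open>Defined at every index, also past the grid, so that the local rule holds without end
  conditions.\<close>

definition trace :: "bool list \<Rightarrow> nat \<Rightarrow> cell" where
  "trace y i = (let C = cell_of (conf M (pair_enc x y) (i div w)) (int (i mod w) - int z) in
     if i < w \<and> guess i then (fst C, 0, True) else C)"

text \<open>The end columns are blank and without head in every row, because the run freezes at time
  \<open>T\<close> and \<open>2 * T + 2 \<le> z\<close>. A neighbour read from the adjacent row
  therefore looks like the true neighbour on the tape.\<close>

lemma complete:
  assumes y: "length y \<le> Y"
    and T: "2 * T + 2 \<le> z" "fst (conf M (pair_enc x y) T) = 1" "accepting (conf M (pair_enc x y) T)"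
  shows "fst (trace y i) < nsyms M \<and> fst (snd (trace y i)) \<le> nstates M"
    and "r < w \<Longrightarrow> trace y r \<in> cls (R ! r)"
    and "wrel M (trace y i) (trace y (i + 1)) (trace y (i + 2)) (trace y (i + w + 1))"
proof -
  let ?C = "conf M (pair_enc x y)"
  have w_pos: "0 < w" using m_pos by (simp add: w_def)
  have lv: "length (pair_enc x y) \<le> m" using y by (simp add: pair_enc_prefix_bits length_prefix_bits m_def)
  \<comment> \<open>Here \<open>t\<close> is arbitrary: after time \<open>T\<close> the
    configuration is still that of time \<open>T\<close>.\<close>
  have blank: "cell_of (?C t) j = (0, 0, False)" if "\<bar>j\<bar> > int T" "j < 0 \<or> int m \<le> j" for t j
  proof -
    have i: "init_tape (pair_enc x y) j = 0" using that(2) lv by (auto simp: init_tape_def nth0_def)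
    obtain t' where t': "t' \<le> T" "?C t = ?C t'"
      using conf_halted[OF _ T(2), of t] by (cases "t \<le> T") auto
    obtain q h U where C: "?C t' = (q, h, U)" by (cases "?C t'")
    have "U j = 0" "h \<noteq> j"
      using conf_far[of t' j M "pair_enc x y"] conf_head[of M "pair_enc x y" t'] that t'(1) i C by auto
    then show ?thesis by (simp add: t'(2) C cell_of_def)
  qed
  have strip_trace: "strip (trace y i) = cell_of (?C (i div w)) (int (i mod w) - int z)" for i
  proof (cases "i < w \<and> guess i")
    case True
    then have "int (i mod w) - int z \<noteq> 0" by (auto simp: guess_def)
    then show ?thesis using True by (simp add: trace_def strip_def conf_0 cell_of_def Let_def)
  qed (auto simp: trace_def Let_def strip_cell_of)
  \<comment> \<open>\<open>k\<close> ranges one column beyond both row ends, which covers all cells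
    of a window that crosses a row boundary.\<close>
  have at: "strip (trace y i) = cell_of (?C t) (k - int z)"
    if p: "int i = int (t * w) + k" "- 1 \<le> k" "k \<le> int w" for i t k
  proof -
    consider "k = - 1" | "k = int w" | "0 \<le> k" "k < int w" using \<open>-1 \<le> k\<close> \<open>k \<le> int w\<close> by linarith
    then show ?thesis
    proof cases
      case 1
      then obtain t' where t': "t = Suc t'" using p(1) by (cases t) auto
      then have "int (i + 1) = int (Suc t' * w)" using p(1) 1 by simp
      then have "i + 1 = Suc t' * w" by (simp only: of_nat_eq_iff)
      then have i: "i = t' * w + (w - 1)" using w_pos by simp
      have "(t' * w + u) div w = t'" "(t' * w + u) mod w = u" if "u < w" for u using that by simp_all
      from this[OF diff_less[OF zero_less_one w_pos]]
      have "i div w = t'" "i mod w = w - 1" by (simp_all only: i)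
      then have "strip (trace y i) = cell_of (?C t') (int (w - 1) - int z)" by (simp add: strip_trace)
      also have "\<dots> = (0, 0, False)" by (rule blank) (use T(1) w_def m_pos in auto)
      also have "\<dots> = cell_of (?C t) (k - int z)" by (rule blank[symmetric]) (use T(1) 1 in auto)
      finally show ?thesis .
    next
      case 2
      then have "int i = int (Suc t * w)" using p(1) by simp
      then have "i = Suc t * w" by (simp only: of_nat_eq_iff)
      then have "i div w = Suc t" "i mod w = 0" using w_pos by simp_all
      then have "strip (trace y i) = cell_of (?C (Suc t)) (int 0 - int z)" by (simp add: strip_trace)
      also have "\<dots> = (0, 0, False)" by (rule blank) (use T(1) in auto)
      also have "\<dots> = cell_of (?C t) (k - int z)" by (rule blank[symmetric]) (use T(1) 2 w_def in auto)
      finally show ?thesis .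
    next
      case 3
      then have "i = t * w + nat k" using p(1) by linarith
      then have "i div w = t" "i mod w = nat k" using 3 w_pos by simp_all
      then show ?thesis using 3 by (simp add: strip_trace)
    qed
  qed
  show "fst (trace y i) < nsyms M \<and> fst (snd (trace y i)) \<le> nstates M"
    using conf_bounded[OF wf, of "pair_enc x y" "i div w"]
    by (auto simp: trace_def Let_def cell_of_def split: prod.splits)
  show "trace y r \<in> cls (R ! r)" if r: "r < w"
  proof (cases "guess r")
    case True
    have "init_tape (pair_enc x y) (int r - int z) \<in> {0, 1, 2}"
      by (auto simp: init_tape_def nth0_def sym_of_bit_def)
    then show ?thesis using True r by (auto simp: trace_def cls_guess conf_0 cell_of_def)
  next
    case False
    then show ?thesis using r by (simp add: cls_R[OF r y] trace_def)
  qed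
  define t where "t = (i + 1) div w"
  define k where "k = int ((i + 1) mod w)"
  have k: "int (i + 1) = int (t * w) + k" "0 \<le> k" "k < int w"
    unfolding t_def k_def of_nat_add[symmetric] div_mult_mod_eq using w_pos by simp_all
  let ?j = "k - int z"
  have a: "strip (trace y i) = cell_of (?C t) (?j - 1)"
    using at[of i t "k - 1"] k by (simp add: algebra_simps)
  have b: "strip (trace y (i + 1)) = cell_of (?C t) ?j"
    using at[of "i + 1" t k] k by simp
  have c: "strip (trace y (i + 2)) = cell_of (?C t) (?j + 1)"
    using at[of "i + 2" t "k + 1"] k by (simp add: algebra_simps)
  have "strip (trace y (i + w + 1)) = cell_of (?C (Suc t)) ?j"
    using at[of "i + w + 1" "Suc t" k] k by (simp add: algebra_simps)
  \<comment> \<open>Flags occur in row 0 only, and this index lies beyond it.\<close>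
  moreover have "strip (trace y (i + w + 1)) = trace y (i + w + 1)"
    by (simp add: trace_def Let_def strip_cell_of)
  ultimately have d: "trace y (i + w + 1) = nxt M (trace y i) (trace y (i + 1)) (trace y (i + 2))"
    by (simp add: conf_Suc nxt_cell_of a[symmetric] b[symmetric] c[symmetric] nxt_strip)
  have F1: "fst (trace y (i + 2)) = 0"
    if "snd (snd (trace y (i + 1)))" "snd (snd (trace y (i + 2)))" "fst (trace y (i + 1)) = 0"
  proof -
    have g: "i + 1 < w \<and> guess (i + 1)" "i + 2 < w \<and> guess (i + 2)"
      using that by (auto simp: trace_def Let_def cell_of_def split: prod.splits if_splits)
    have tr: "fst (trace y i') = nth0 (map sym_of_bit (pair_enc x y)) (i' - z)" if "i' < w \<and> guess i'" for i'
      using that by (auto simp: trace_def conf_0 cell_of_def init_tape_def guess_def nat_diff_distrib')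
    have "nth0 (map sym_of_bit (pair_enc x y)) (i + 1 - z) = 0" using tr[OF g(1)] that(3) by simp
    then have "length (pair_enc x y) \<le> i + 1 - z"
      by (auto simp: nth0_def sym_of_bit_def split: if_splits)
    then have "length (pair_enc x y) \<le> i + 2 - z" by linarith
    then show ?thesis using tr[OF g(2)] by (simp add: nth0_def)
  qed
  \<comment> \<open>A head in the halting state shows that the row displays the configuration of
    time \<open>T\<close>, which is accepting.\<close>
  have F2: "fst (trace y (i + 1)) = 2 \<and> fst (trace y (i + 2)) \<notin> {1, 2}"
    if "fst (snd (trace y (i + 1))) = 2"
  proof -
    obtain q h U where C: "?C t = (q, h, U)" by (cases "?C t")
    have "fst (snd (cell_of (?C t) ?j)) = 2" using that b by (metis strip_def fst_conv snd_conv)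
    then have j: "?j = h" "q = 1" by (auto simp: C cell_of_def split: if_splits)
    have "?C t = ?C T"
      using conf_halted[of t T M "pair_enc x y"] conf_halted[of T t M "pair_enc x y"] T(2) C j
      by (cases "t \<le> T") auto
    then have "U h = 2" "U (h + 1) \<notin> {1, 2}" using T(3) C by (auto simp: accepting_def)
    moreover have "fst (trace y (i + 1)) = U h" "fst (trace y (i + 2)) = U (h + 1)"
      using arg_cong[OF b, of fst] arg_cong[OF c, of fst] j by (simp_all add: strip_def cell_of_def C)
    ultimately show ?thesis by simp
  qed
  show "wrel M (trace y i) (trace y (i + 1)) (trace y (i + 2)) (trace y (i + w + 1))"
    unfolding wrel_def
  proof (intro conjI notI; (elim conjE)?)
    show "trace y (i + w + 1) = nxt M (trace y i) (trace y (i + 1)) (trace y (i + 2))" by (rule d)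
    show False if "snd (snd (trace y (i + 1)))" "snd (snd (trace y (i + 2)))" "fst (trace y (i + 1)) = 0"
        "fst (trace y (i + 2)) \<noteq> 0"
      using that(4) F1[OF that(1-3)] by (rule notE)
    show False if "fst (snd (trace y (i + 1))) = 2" "fst (trace y (i + 1)) \<noteq> 2 \<or> fst (trace y (i + 2)) \<in> {1, 2}"
      using that(2) F2[OF that(1)] by (elim disjE conjE) (erule (1) notE)+
  qed
qed

end

section \<open>The EQCONT instance of a tableau\<close>

text \<open>Four distinct nonzero letters leave no room for the separator 0, and a factor of length
  4 that avoids 0 can only be the last four letters of one block.\<close>

lemma window_sublist:
  assumes "sublist u (concat (map (\<lambda>(a, b, c, d). [0, l1 a, l2 b, l3 c, l4 d]) rl))"
    and "length u \<le> 4" "{l1 a0, l2 b0, l3 c0, l4 d0} \<subseteq> set u" "card {l1 a0, l2 b0, l3 c0, l4 d0} = 4"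
    and "0 \<notin> {l1 a0, l2 b0, l3 c0, l4 d0 :: nat}"
  shows "\<exists>(a, b, c, d) \<in> set rl. u = [l1 a, l2 b, l3 c, l4 d]"
proof -
  let ?S = "{l1 a0, l2 b0, l3 c0, l4 d0}"
  have "card (set u) \<le> 4" using card_length[of u] assms(2) by linarith
  then have "set u = ?S" using card_subset_eq[OF _ assms(3)] card_mono[OF _ assms(3)] assms(4) by fastforce
  then have u: "0 \<notin> set u" "length u = 4" using assms(2,4,5) card_length[of u] by auto
  show ?thesis using assms(1)
  proof (induction rl)
    case Nil
    then show ?case using u by simp
  next
    case (Cons q rl)
    obtain a b c d where q: "q = (a, b, c, d)" by (cases q)
    let ?blk = "[0, l1 a, l2 b, l3 c, l4 d]" and ?rest = "concat (map (\<lambda>(a, b, c, d). [0, l1 a, l2 b, l3 c, l4 d]) rl)"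
    have rest: "?rest = [] \<or> (\<exists>r. ?rest = 0 # r)" by (cases rl) auto
    have "v = []" if "prefix v r" "0 \<notin> set v" "r = [] \<or> (\<exists>r'. r = 0 # r')" for v r :: "nat list"
      using that by (cases v) auto
    note pre = this[OF _ _ rest]
    have "sublist u (?blk @ ?rest)" using Cons.prems q by simp
    then consider "sublist u ?blk" | "sublist u ?rest" | u1 u2 where "u = u1 @ u2" "suffix u1 ?blk" "prefix u2 ?rest"
      by (auto simp only: sublist_append)
    then show ?case
    proof cases
      case 2
      then show ?thesis using Cons.IH by auto
    next
      case 3
      \<comment> \<open>A factor reaching into the rest would contain the 0 with which the rest
        begins.\<close>
      then have "u2 = []" using pre u(1) by auto
      then have "suffix u ?blk" using 3 by simp
      then obtain v where v: "?blk = v @ u" by (auto simp: suffix_def)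
      from arg_cong[OF v, of length] u(2) have "length v = 1" by simp
      then obtain e where "v = [e]" by (cases v) auto
      then show ?thesis using v q by auto
    next
      case 1
      then obtain v v' where v: "?blk = v @ u @ v'" by (auto simp: sublist_def)
      from arg_cong[OF v, of length] u(2) have l: "length v + length v' = 1" by simp
      show ?thesis
      proof (cases v)
        case Nil
        then show ?thesis using v u by (cases u) auto
      next
        case (Cons e v'')
        then have "v = [e]" "v' = []" using l by auto
        then show ?thesis using v q by auto
      qed
    qed
  qed
qed

text \<open>\<open>3 \<le> k\<close> makes a block of \<open>2 ^ k\<close> conjuncts large enough
  for the seven proper ones; \<open>e\<close> numbers the cells in \<open>k\<close> bits.\<close>

locale eqcont_grid =
  fixes k :: nat and e :: "cell \<Rightarrow> nat" and cl :: "cell list" and rl :: "(cell \<times> cell \<times> cell \<times> cell) list"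
    and al :: "nat \<Rightarrow> cell list"
  assumes k: "3 \<le> k" and e_less: "c \<in> set cl \<Longrightarrow> e c < 2 ^ k" and e_inj: "inj e"
    and al: "set (al a) \<subseteq> set cl" and rl: "set rl \<subseteq> set cl \<times> set cl \<times> set cl \<times> set cl"
begin

definition letter :: "nat \<Rightarrow> cell \<Rightarrow> nat" where
  "letter p c = e c + 2 ^ k * p"

text \<open>Padding with trivial conjuncts (and, in \<open>bound_blk\<close>, with unused variables) makes the numbers
  of conjuncts and of variables multiples of \<open>2 ^ k\<close>, hence printable like letters.\<close>

definition blk :: "nat \<Rightarrow> nat \<Rightarrow> nat \<Rightarrow> nat \<Rightarrow> nat \<Rightarrow> bexp list" where
  "blk a p1 p2 p3 p4 = (if a = 8 then replicate (2 ^ k) BTrue else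
    [BNot (BAtom (Eq (SVar (2 ^ k * p1)) (SConst []))),
     BAtom (Cont (SConst (map (letter p1) (al a))) (SVar (2 ^ k * p1))),
     BAtom (Cont (SConst (concat (map (\<lambda>(a, b, c, d). [0, letter p1 a, letter p2 b, letter p3 c, letter p4 d]) rl)))
       (SVar (1 + 2 ^ k * p1))),
     BAtom (Cont (SVar (1 + 2 ^ k * p1)) (SVar (2 ^ k * p1))),
     BAtom (Cont (SVar (1 + 2 ^ k * p1)) (SVar (2 ^ k * p2))),
     BAtom (Cont (SVar (1 + 2 ^ k * p1)) (SVar (2 ^ k * p3))),
     BAtom (Cont (SVar (1 + 2 ^ k * p1)) (SVar (2 ^ k * p4)))] @ replicate (2 ^ k - 7) BTrue)"

definition bound_blk :: "nat list" where
  "bound_blk = [1, 4] @ replicate (2 ^ k - 2) 0"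

text \<open>Cell \<open>j\<close> of the list has position \<open>j + 1\<close>. Letters and
  variables are laid out for the positions 0 to \<open>length K\<close>, so that a number
  \<open>r + 2 ^ k * p\<close> needs no shift; hence the \<open>length K + 1\<close> blocks of
  bounds.\<close>

definition grid_inst :: "nat \<Rightarrow> nat list \<Rightarrow> inst" where
  "grid_inst w K = Inst (2 ^ k * (length K + 1)) (concat (replicate (length K + 1) bound_blk))
     (concat (map (\<lambda>j. blk (K ! j) (j + 1) (j + 2) (j + 3) (j + w + 2)) [0..<length K]))"

definition hdr_toks :: "tok list" where
  "hdr_toks = [Hole k 0 9, Hole k 0 9]"

definition bnd_toks :: "tok list" where
  "bnd_toks = map Lit bound_blk"

definition cont_toks :: "nat \<Rightarrow> tok list" where
  "cont_toks c = [Lit 3, Lit 1, Lit 0, Hole k 1 4, Lit 0, Hole k 0 c]"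

text \<open>The numbers that \<open>nb\<close> writes for \<open>blk\<close>, with the four
  positions read from counters 4 to 7. Each quadruple takes five letters with its separator, whence
  the length field \<open>5 * length rl\<close>.\<close>

definition blk_toks :: "nat \<Rightarrow> tok list" where
  "blk_toks a = (if a = 8 then replicate (2 ^ k) (Lit 0) else
     [Lit 2, Lit 3, Lit 0, Lit 0, Hole k 0 4, Lit 1, Lit 0] @
     [Lit 3, Lit 1, Lit 1, Lit (length (al a))] @ map (\<lambda>c. Hole k (e c) 4) (al a) @ [Lit 0, Hole k 0 4] @
     [Lit 3, Lit 1, Lit 1, Lit (5 * length rl)] @
       concat (map (\<lambda>(a, b, c, d). [Lit 0, Hole k (e a) 4, Hole k (e b) 5, Hole k (e c) 6, Hole k (e d) 7]) rl) @
       [Lit 0, Hole k 1 4] @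
     cont_toks 4 @ cont_toks 5 @ cont_toks 6 @ cont_toks 7 @ replicate (2 ^ k - 7) (Lit 0))"

lemma two_k: "8 \<le> (2 :: nat) ^ k"
  using power_increasing[OF k, of "2 :: nat"] by simp

lemma length_blk: "length (blk a p1 p2 p3 p4) = 2 ^ k"
proof -
  obtain n where "(2 :: nat) ^ k = 8 + n" using two_k le_Suc_ex by blast
  then show ?thesis by (simp add: blk_def)
qed

lemma length_bound_blk: "length bound_blk = 2 ^ k"
proof -
  obtain n where "(2 :: nat) ^ k = 8 + n" using two_k le_Suc_ex by blast
  then show ?thesis by (simp add: bound_blk_def)
qed

lemma length_concat_const: "(\<And>x. x \<in> set xs \<Longrightarrow> length (f x) = n) \<Longrightarrow> length (concat (map f xs)) = n * length xs"
  by (induction xs) auto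

lemma toks_ok: "list_all (tok_ok {8, 9}) hdr_toks" "list_all (tok_ok {8, 9}) bnd_toks"
  "list_all (tok_ok {4, 5, 6, 7}) (blk_toks a)"
proof -
  show "list_all (tok_ok {8, 9}) hdr_toks" by (simp add: hdr_toks_def)
  show "list_all (tok_ok {8, 9}) bnd_toks" by (simp add: bnd_toks_def list_all_iff)
  have "(1 :: nat) < 2 ^ k" using two_k by linarith
  moreover have "e c < 2 ^ k" if "c \<in> set (al a)" for c using that al e_less by blast
  moreover have "e a < 2 ^ k \<and> e b < 2 ^ k \<and> e c < 2 ^ k \<and> e d < 2 ^ k" if "(a, b, c, d) \<in> set rl" for a b c d
    using that rl e_less by blast
  ultimately show "list_all (tok_ok {4, 5, 6, 7}) (blk_toks a)"
    by (auto simp: blk_toks_def cont_toks_def list_all_iff)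
qed

lemma blk_toks_nums:
  "map (tok_num (body_env w p)) (blk_toks a) = concat (map nb (blk a p (p + 1) (p + 2) (p + w + 1)))"
proof -
  have env: "body_env w p 4 = p" "body_env w p 5 = p + 1" "body_env w p 6 = p + 2" "body_env w p 7 = p + w + 1"
    by (simp_all add: body_env_def)
  have "length (concat (map (\<lambda>(a, b, c, d). [0, letter p a, letter (p + 1) b, letter (p + 2) c, letter (p + w + 1) d]) rl)) = 5 * length rl"
    by (rule length_concat_const) auto
  moreover have "map (tok_num (body_env w p)) (concat (map (\<lambda>(a, b, c, d). [Lit 0, Hole k (e a) 4, Hole k (e b) 5, Hole k (e c) 6, Hole k (e d) 7]) rl)) =
      concat (map (\<lambda>(a, b, c, d). [0, letter p a, letter (p + 1) b, letter (p + 2) c, letter (p + w + 1) d]) rl)"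
    by (induction rl) (auto simp: env letter_def)
  moreover have "map (tok_num (body_env w p)) (map (\<lambda>c. Hole k (e c) 4) l) = map (letter p) l" for l
    by (simp add: env letter_def)
  moreover have "concat (replicate n [0]) = replicate n (0 :: nat)" for n by (induction n) auto
  ultimately show ?thesis
    by (simp add: blk_toks_def blk_def cont_toks_def env del: map_map)
qed

lemma grid_nums_enc:
  assumes "w = length (first_rows c d c' d' x)"
  shows "concat (map enc_nat (grid_nums c d c' d' k hdr_toks bnd_toks blk_toks x)) =
    enc_inst (grid_inst w (full_grid c d c' d' x))"
proof -
  let ?K = "full_grid c d c' d' x"
  let ?n = "length ?K"
  have h: "head_nums k hdr_toks bnd_toks ?n =
      [2 ^ k * (?n + 1), 2 ^ k * (?n + 1)] @ concat (replicate (?n + 1) bound_blk) @ [2 ^ k * ?n]"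
    by (simp add: head_nums_def hdr_toks_def head_env_def bnd_toks_def comp_def)
  have "length (concat (replicate m bound_blk)) = 2 ^ k * m" for m
    by (induction m) (simp_all add: length_bound_blk)
  then have lb: "length (bnds (grid_inst w ?K)) = 2 ^ k * (?n + 1)" by (simp only: grid_inst_def inst.sel)
  have lp: "length (phi (grid_inst w ?K)) = 2 ^ k * ?n"
    unfolding grid_inst_def inst.sel by (subst length_concat_const[where n = "2 ^ k"]) (simp_all add: length_blk)
  have "concat (map (\<lambda>j. concat (map nb (f j))) js) = concat (map nb (concat (map f js)))"
    for f :: "nat \<Rightarrow> bexp list" and js by (induction js) auto
  moreover have "j + 1 + 1 = j + 2" "j + 1 + 2 = j + 3" "j + 1 + w + 1 = j + w + 2" for j by simp_all
  ultimately have b: "body_nums blk_toks w ?K ?n = concat (map nb (phi (grid_inst w ?K)))"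
    unfolding body_nums_def grid_inst_def inst.sel blk_toks_nums by (simp only:)
  have "grid_nums c d c' d' k hdr_toks bnd_toks blk_toks x =
      [alph (grid_inst w ?K), length (bnds (grid_inst w ?K))] @ bnds (grid_inst w ?K) @
        [length (phi (grid_inst w ?K))] @ concat (map nb (phi (grid_inst w ?K)))"
    unfolding grid_nums_def Let_def assms[symmetric] h b lb lp by (simp add: grid_inst_def)
  then show ?thesis by (simp only: enc_inst_def)
qed

end

lemma concat_replicate_nth:
  "q < n \<Longrightarrow> r < length b \<Longrightarrow> concat (replicate n b) ! (length b * q + r) = b ! r"
proof (induction n arbitrary: q)
  case (Suc n)
  then show ?case by (cases q) (simp_all add: nth_append)
qed simp

lemma sublist_singleton: "sublist [v] u \<longleftrightarrow> v \<in> set u"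
  by (auto simp: sublist_def in_set_conv_decomp)

section \<open>Satisfying assignments correspond to locally correct labellings of the grid\<close>

context eqcont_grid
begin

text \<open>Quotient and remainder modulo \<open>2 ^ k\<close> recover the position and the number
  of the cell.\<close>

lemma letter_inj: "letter p c = letter p' c' \<longleftrightarrow> p = p' \<and> c = c'" if "c \<in> set cl" "c' \<in> set cl"
proof
  assume eq: "letter p c = letter p' c'"
  then have "letter p c div 2 ^ k = letter p' c' div 2 ^ k" "letter p c mod 2 ^ k = letter p' c' mod 2 ^ k" by simp_all
  then have "p = p'" "e c = e c'" using e_less that by (simp_all add: letter_def)
  then show "p = p' \<and> c = c'" using e_inj by (auto dest: injD)
qed simp

lemma letter_bound: "c \<in> set cl \<Longrightarrow> p \<le> n \<Longrightarrow> letter p c < 2 ^ k * (n + 1)"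
proof -
  assume "c \<in> set cl" "p \<le> n"
  then have "letter p c < 2 ^ k * (p + 1)" using e_less by (simp add: letter_def)
  also have "\<dots> \<le> 2 ^ k * (n + 1)" using \<open>p \<le> n\<close> by (intro mult_le_mono2) simp
  finally show ?thesis .
qed

lemma letter_pos: "0 < p \<Longrightarrow> letter p c \<noteq> 0"
  by (simp add: letter_def)

lemma var_bound: "(p :: nat) \<le> n \<Longrightarrow> r < 8 \<Longrightarrow> r + 2 ^ k * p < 2 ^ k * (n + 1)"
proof -
  assume "p \<le> n" "r < 8"
  then have "r + 2 ^ k * p < 2 ^ k * (p + 1)" using two_k by simp
  also have "\<dots> \<le> 2 ^ k * (n + 1)" using \<open>p \<le> n\<close> by (intro mult_le_mono2) simp
  finally show ?thesis .
qed

lemma length_bnds: "length (bnds (grid_inst w K)) = 2 ^ k * (length K + 1)"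
proof -
  have "length (concat (replicate m bound_blk)) = 2 ^ k * m" for m
    by (induction m) (simp_all add: length_bound_blk)
  then show ?thesis by (simp only: grid_inst_def inst.sel)
qed

lemma bnds_nth:
  assumes "p \<le> length K" "r < 2 ^ k" shows "bnds (grid_inst w K) ! (2 ^ k * p + r) = bound_blk ! r"
  using concat_replicate_nth[of p "length K + 1" r bound_blk] assms
  by (simp only: grid_inst_def inst.sel length_bound_blk)

lemma bound_blk_nth: "bound_blk ! 0 = 1" "bound_blk ! 1 = 4"
  by (simp_all add: bound_blk_def)

lemma phi_grid: "b \<in> set (phi (grid_inst w K)) \<longleftrightarrow>
    (\<exists>j<length K. b \<in> set (blk (K ! j) (j + 1) (j + 2) (j + 3) (j + w + 2)))"
  by (auto simp: grid_inst_def)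

lemma bexp_ok_blk:
  assumes "p1 \<le> n" "p2 \<le> n" "p3 \<le> n" "p4 \<le> n" "b \<in> set (blk a p1 p2 p3 p4)"
  shows "bexp_ok (2 ^ k * (n + 1)) (2 ^ k * (n + 1)) b"
proof (cases "a = 8")
  case False
  have v: "2 ^ k * p < 2 ^ k * (n + 1)" "1 + 2 ^ k * p < 2 ^ k * (n + 1)" if "p \<le> n" for p
    using var_bound[OF that, of 0] var_bound[OF that, of 1] by simp_all
  have 1: "letter p c < 2 ^ k * (n + 1)" if "c \<in> set (al a)" "p \<le> n" for c p
    using letter_bound that al by blast
  have 2: "letter p1 a < 2 ^ k * (n + 1) \<and> letter p2 b < 2 ^ k * (n + 1) \<and> letter p3 c < 2 ^ k * (n + 1) \<and>
      letter p4 d < 2 ^ k * (n + 1)" if "(a, b, c, d) \<in> set rl" for a b c d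
    using that rl assms(1-4) letter_bound by blast
  have 3: "set (map (letter p1) (al a)) \<subseteq> {..<2 ^ k * (n + 1)}"
    using 1 assms(1) by (auto simp del: mult_Suc_right)
  have 4: "set (concat (map (\<lambda>(a, b, c, d). [0, letter p1 a, letter p2 b, letter p3 c, letter p4 d]) rl)) \<subseteq> {..<2 ^ k * (n + 1)}"
    using 2 by (fastforce simp del: mult_Suc_right)
  show ?thesis using assms(5) False v[OF assms(1)] v[OF assms(2)] v[OF assms(3)] v[OF assms(4)] 3 4
    unfolding blk_def by (auto simp only: if_False if_True set_append list.set Un_iff insert_iff empty_iff bexp_ok.simps
      atom_ok.simps term_ok.simps set_replicate_conv_if simp_thms empty_subsetI split: if_splits)
qed (use assms(5) in \<open>auto simp: blk_def\<close>)

lemma wf_grid: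
  assumes "\<And>j. j < length K \<Longrightarrow> K ! j \<noteq> 8 \<Longrightarrow> j + w + 2 \<le> length K" "1 \<le> w"
  shows "wf_inst (grid_inst w K)"
  unfolding wf_inst_def length_bnds
proof
  fix b assume "b \<in> set (phi (grid_inst w K))"
  then obtain j where j: "j < length K" "b \<in> set (blk (K ! j) (j + 1) (j + 2) (j + 3) (j + w + 2))"
    unfolding phi_grid by blast
  have "bexp_ok (2 ^ k * (length K + 1)) (2 ^ k * (length K + 1)) b"
  proof (cases "K ! j = 8")
    case True
    then show ?thesis using j(2) by (auto simp: blk_def)
  next
    case False
    then show ?thesis using assms(1)[OF j(1) False] assms(2) j by (intro bexp_ok_blk[OF _ _ _ _ j(2)]) linarith+
  qed
  then show "bexp_ok (alph (grid_inst w K)) (2 ^ k * (length K + 1)) b" by (simp add: grid_inst_def)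
qed

lemma blk_sat:
  assumes "a \<noteq> 8"
  shows "(\<forall>b\<in>set (blk a p1 p2 p3 p4). bval \<sigma> b) \<longleftrightarrow>
    \<sigma> (2 ^ k * p1) \<noteq> [] \<and> sublist (\<sigma> (2 ^ k * p1)) (map (letter p1) (al a)) \<and>
    sublist (\<sigma> (1 + 2 ^ k * p1))
      (concat (map (\<lambda>(a, b, c, d). [0, letter p1 a, letter p2 b, letter p3 c, letter p4 d]) rl)) \<and>
    (\<forall>p\<in>{p1, p2, p3, p4}. sublist (\<sigma> (2 ^ k * p)) (\<sigma> (1 + 2 ^ k * p1)))"
  using assms by (auto simp: blk_def)

text \<open>Being nonempty with length bound 1, a cell variable is one letter of its constant. The
  window variable is then a listed quadruple, and the position tags tell which of its entries
  belongs to which cell.\<close>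

lemma sat_sound:
  assumes sat: "sat_inst (grid_inst w K)" and A: "A \<le> length K" "\<And>j. j < A \<Longrightarrow> K ! j \<noteq> 8" and w: "2 \<le> w"
  shows "\<exists>D. (\<forall>j<A. D j \<in> set (al (K ! j))) \<and>
    (\<forall>j. j + w + 1 < A \<longrightarrow> (D j, D (j + 1), D (j + 2), D (j + w + 1)) \<in> set rl)"
proof -
  obtain \<sigma> where len: "\<And>i. i < 2 ^ k * (length K + 1) \<Longrightarrow> length (\<sigma> i) \<le> bnds (grid_inst w K) ! i"
    and val: "\<And>b. b \<in> set (phi (grid_inst w K)) \<Longrightarrow> bval \<sigma> b"
    using sat unfolding sat_inst_def length_bnds by blast
  have len1: "length (\<sigma> (2 ^ k * p)) \<le> 1" and len4: "length (\<sigma> (1 + 2 ^ k * p)) \<le> 4" if "p \<le> length K" for p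
  proof -
    have k2: "0 < (2 :: nat) ^ k" "1 < (2 :: nat) ^ k" using two_k by linarith+
    have v: "2 ^ k * p < 2 ^ k * (length K + 1)" "1 + 2 ^ k * p < 2 ^ k * (length K + 1)"
      using var_bound[OF that, of 0] var_bound[OF that, of 1] by simp_all
    show "length (\<sigma> (2 ^ k * p)) \<le> 1"
      using len[OF v(1)] bnds_nth[OF that k2(1), of w] by (simp only: add_0_right bound_blk_nth)
    show "length (\<sigma> (1 + 2 ^ k * p)) \<le> 4"
      using len[OF v(2)] bnds_nth[OF that k2(2), of w] by (simp only: add.commute[of 1] bound_blk_nth)
  qed
  have blk: "\<forall>b\<in>set (blk (K ! j) (j + 1) (j + 2) (j + 3) (j + w + 2)). bval \<sigma> b" if "j < A" for j
    using val that A(1) unfolding phi_grid by (meson less_le_trans)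
  have "\<exists>c. c \<in> set (al (K ! j)) \<and> \<sigma> (2 ^ k * (j + 1)) = [letter (j + 1) c]" if "j < A" for j
  proof -
    have s: "\<sigma> (2 ^ k * (j + 1)) \<noteq> []" "sublist (\<sigma> (2 ^ k * (j + 1))) (map (letter (j + 1)) (al (K ! j)))"
      using blk[OF that] unfolding blk_sat[OF A(2)[OF that]] by simp_all
    moreover have "length (\<sigma> (2 ^ k * (j + 1))) \<le> 1" using len1[of "j + 1"] that A(1) by simp
    ultimately obtain v where v: "\<sigma> (2 ^ k * (j + 1)) = [v]" by (cases "\<sigma> (2 ^ k * (j + 1))") auto
    then show ?thesis using s(2) by (auto simp: sublist_singleton)
  qed
  then obtain D where D: "\<And>j. j < A \<Longrightarrow> D j \<in> set (al (K ! j))" "\<And>j. j < A \<Longrightarrow> \<sigma> (2 ^ k * (j + 1)) = [letter (j + 1) (D j)]"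
    by metis
  have "(D j, D (j + 1), D (j + 2), D (j + w + 1)) \<in> set rl" if j: "j + w + 1 < A" for j
  proof -
    have jA: "j < A" "j + 1 < A" "j + 2 < A" "j + w + 1 < A" using j w by simp_all
    have cl: "D i \<in> set cl" if "i < A" for i using D(1)[OF that] al by blast
    let ?u = "\<sigma> (1 + 2 ^ k * (j + 1))"
    have b: "sublist ?u (concat (map (\<lambda>(a, b, c, d). [0, letter (j + 1) a, letter (j + 2) b, letter (j + 3) c, letter (j + w + 2) d]) rl))"
      "\<And>p. p \<in> {j + 1, j + 2, j + 3, j + w + 2} \<Longrightarrow> sublist (\<sigma> (2 ^ k * p)) ?u"
      using blk[OF jA(1)] unfolding blk_sat[OF A(2)[OF jA(1)]] by blast+
    have in_u: "letter (i + 1) (D i) \<in> set ?u" if "i \<in> {j, j + 1, j + 2, j + w + 1}" for i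
    proof -
      have "i < A" using that jA by blast
      moreover have "i + 1 \<in> {j + 1, j + 2, j + 3, j + w + 2}" using that by auto
      ultimately show ?thesis using b(2)[of "i + 1"] D(2)[of i] by (simp add: sublist_singleton)
    qed
    have neq: "letter p c \<noteq> letter p' c'" if "p \<noteq> p'" "c \<in> set cl" "c' \<in> set cl" for p p' c c'
      using letter_inj that by blast
    have "\<exists>(a, b, c, d) \<in> set rl. ?u = [letter (j + 1) a, letter (j + 2) b, letter (j + 3) c, letter (j + w + 2) d]"
    proof (rule window_sublist[OF b(1)])
      show "length ?u \<le> 4" using len4[of "j + 1"] jA(1) A(1) by simp
      show "{letter (j + 1) (D j), letter (j + 2) (D (j + 1)), letter (j + 3) (D (j + 2)), letter (j + w + 2) (D (j + w + 1))} \<subseteq> set ?u"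
        using in_u[of j] in_u[of "j + 1"] in_u[of "j + 2"] in_u[of "j + w + 1"] by (simp add: numeral_eq_Suc)
      \<comment> \<open>\<open>2 \<le> w\<close> keeps the position \<open>j + w + 2\<close> apart
        from \<open>j + 3\<close>.\<close>
      show "card {letter (j + 1) (D j), letter (j + 2) (D (j + 1)), letter (j + 3) (D (j + 2)), letter (j + w + 2) (D (j + w + 1))} = 4"
        using neq cl[OF jA(1)] cl[OF jA(2)] cl[OF jA(3)] cl[OF jA(4)] w by simp
      show "0 \<notin> {letter (j + 1) (D j), letter (j + 2) (D (j + 1)), letter (j + 3) (D (j + 2)), letter (j + w + 2) (D (j + w + 1))}"
        using letter_pos by simp
    qed
    then obtain a b' c d where abcd: "(a, b', c, d) \<in> set rl"
      "?u = [letter (j + 1) a, letter (j + 2) b', letter (j + 3) c, letter (j + w + 2) d]" by blast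
    have cl4: "a \<in> set cl" "b' \<in> set cl" "c \<in> set cl" "d \<in> set cl" using abcd(1) rl by blast+
    have "D j = a" using in_u[unfolded abcd(2), of j] cl4 cl[OF jA(1)] w by (simp add: letter_inj)
    moreover have "D (j + 1) = b'" using in_u[unfolded abcd(2), of "j + 1"] cl4 cl[OF jA(2)] w by (simp add: letter_inj)
    moreover have "D (j + 2) = c" using in_u[unfolded abcd(2), of "j + 2"] cl4 cl[OF jA(3)] w by (simp add: letter_inj)
    moreover have "D (j + w + 1) = d" using in_u[unfolded abcd(2), of "j + w + 1"] cl4 cl[OF jA(4)] w by (simp add: letter_inj)
    ultimately show ?thesis using abcd(1) by simp
  qed
  then show ?thesis using D(1) by blast
qed

lemma sat_complete:
  assumes D: "\<And>i. D i \<in> set cl" "\<And>j. j < A \<Longrightarrow> D j \<in> set (al (K ! j))"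
      "\<And>j. (D j, D (j + 1), D (j + 2), D (j + w + 1)) \<in> set rl"
    and A: "\<And>j. j < length K \<Longrightarrow> K ! j \<noteq> 8 \<Longrightarrow> j < A" "A + w + 1 \<le> length K" and w: "1 \<le> w"
  shows "sat_inst (grid_inst w K)"
proof -
  \<comment> \<open>Remainder 0 is the cell variable of a position and remainder 1 its window
    variable; the others have bound 0 and stay empty. Windows past \<open>A\<close> stay empty too,
    since their letters could leave the alphabet.\<close>
  define \<sigma> where "\<sigma> i = (let p = i div 2 ^ k; r = i mod 2 ^ k in
    if 0 < p \<and> r = 0 then [letter p (D (p - 1))]
    else if 0 < p \<and> p \<le> A \<and> r = 1 then [letter p (D (p - 1)), letter (p + 1) (D p), letter (p + 2) (D (p + 1)), letter (p + w + 1) (D (p + w))]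
    else [])" for i
  have k2: "0 < (2 :: nat) ^ k" "1 < (2 :: nat) ^ k" using two_k by linarith+
  have u: "\<sigma> (2 ^ k * p) = [letter p (D (p - 1))]" if "0 < p" for p
    using that by (simp add: \<sigma>_def)
  have divmod: "(1 + 2 ^ k * p) div 2 ^ k = p" "(1 + 2 ^ k * p) mod 2 ^ k = 1" for p :: nat
    using div_mult_self2[of "2 ^ k" 1 p] mod_mult_self2[of 1 "2 ^ k" p] div_less[OF k2(2)] mod_less[OF k2(2)] k2(1)
    by (simp_all only: add_0_right)
  have uw: "\<sigma> (1 + 2 ^ k * p) = [letter p (D (p - 1)), letter (p + 1) (D p), letter (p + 2) (D (p + 1)), letter (p + w + 1) (D (p + w))]"
    if "0 < p" "p \<le> A" for p
    unfolding \<sigma>_def divmod Let_def using that by simp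
  have 1: "length (\<sigma> i) \<le> bnds (grid_inst w K) ! i \<and> set (\<sigma> i) \<subseteq> {..<alph (grid_inst w K)}"
    if "i < 2 ^ k * (length K + 1)" for i
  proof -
    define p where "p = i div 2 ^ k"
    define r where "r = i mod 2 ^ k"
    have i: "i = 2 ^ k * p + r" "r < 2 ^ k" using k2 by (simp_all add: p_def r_def)
    have p: "p \<le> length K" using that k2 unfolding p_def by (metis Suc_eq_plus1 less_Suc_eq_le less_mult_imp_div_less mult.commute)
    have bn: "bnds (grid_inst w K) ! i = bound_blk ! r" unfolding i(1) by (rule bnds_nth[OF p i(2)])
    have al: "alph (grid_inst w K) = 2 ^ k * (length K + 1)" by (simp add: grid_inst_def)
    consider "0 < p \<and> r = 0" | "0 < p \<and> p \<le> A \<and> r = 1" | "\<sigma> i = []"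
      unfolding \<sigma>_def p_def[symmetric] r_def[symmetric] Let_def by argo
    then show ?thesis
    proof cases
      case 1
      then have "\<sigma> i = [letter p (D (p - 1))]" unfolding i(1) using u[of p] by simp
      then show ?thesis using 1 letter_bound[OF D(1) p] bound_blk_nth by (simp add: bn al del: mult_Suc_right)
    next
      case 2
      have pb: "p + 1 \<le> length K" "p + 2 \<le> length K" "p + w + 1 \<le> length K" using 2 A(2) w by linarith+
      have "\<sigma> i = [letter p (D (p - 1)), letter (p + 1) (D p), letter (p + 2) (D (p + 1)), letter (p + w + 1) (D (p + w))]"
        unfolding i(1) using uw[of p] 2 by (simp add: add.commute)
      then show ?thesis using 2 letter_bound[OF D(1) p] letter_bound[OF D(1) pb(1)] letter_bound[OF D(1) pb(2)]
          letter_bound[OF D(1) pb(3)] bound_blk_nth by (simp add: bn al del: mult_Suc_right)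
    qed simp
  qed
  have "bval \<sigma> b" if b: "b \<in> set (phi (grid_inst w K))" for b
  proof -
    obtain j where j: "j < length K" "b \<in> set (blk (K ! j) (j + 1) (j + 2) (j + 3) (j + w + 2))"
      using b unfolding phi_grid by blast
    show ?thesis
    proof (cases "K ! j = 8")
      case True
      then show ?thesis using j(2) by (auto simp: blk_def)
    next
      case False
      then have jA: "j < A" using A(1) j(1) by blast
      let ?u = "[letter (j + 1) (D j), letter (j + 2) (D (j + 1)), letter (j + 3) (D (j + 2)), letter (j + w + 2) (D (j + w + 1))]"
      have uj: "\<sigma> (1 + 2 ^ k * (j + 1)) = ?u" using uw[of "j + 1"] jA by (simp add: numeral_eq_Suc)
      have u4: "\<sigma> (2 ^ k * (j + 1)) = [letter (j + 1) (D j)]" "\<sigma> (2 ^ k * (j + 2)) = [letter (j + 2) (D (j + 1))]"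
        "\<sigma> (2 ^ k * (j + 3)) = [letter (j + 3) (D (j + 2))]" "\<sigma> (2 ^ k * (j + w + 2)) = [letter (j + w + 2) (D (j + w + 1))]"
        using u[of "j + 1"] u[of "j + 2"] u[of "j + 3"] u[of "j + w + 2"] by (simp_all add: numeral_eq_Suc)
      obtain r1 r2 where r: "rl = r1 @ (D j, D (j + 1), D (j + 2), D (j + w + 1)) # r2"
        using D(3)[of j] by (meson split_list)
      have "sublist ?u (concat (map (\<lambda>(a, b, c, d). [0, letter (j + 1) a, letter (j + 2) b, letter (j + 3) c, letter (j + w + 2) d]) rl))"
      proof -
        have "concat (map (\<lambda>(a, b, c, d). [0, letter (j + 1) a, letter (j + 2) b, letter (j + 3) c, letter (j + w + 2) d]) rl) =
          (concat (map (\<lambda>(a, b, c, d). [0, letter (j + 1) a, letter (j + 2) b, letter (j + 3) c, letter (j + w + 2) d]) r1) @ [0]) @ ?u @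
          concat (map (\<lambda>(a, b, c, d). [0, letter (j + 1) a, letter (j + 2) b, letter (j + 3) c, letter (j + w + 2) d]) r2)"
          by (simp add: r)
        then show ?thesis unfolding sublist_def by blast
      qed
      moreover have "\<forall>p\<in>{j + 1, j + 2, j + 3, j + w + 2}. sublist (\<sigma> (2 ^ k * p)) ?u"
        using u4 by (simp only: ball_simps sublist_singleton list.set insert_iff simp_thms)
      moreover have "sublist (\<sigma> (2 ^ k * (j + 1))) (map (letter (j + 1)) (al (K ! j)))"
        unfolding u4(1) sublist_singleton using D(2)[OF jA] by simp
      ultimately have "\<forall>b\<in>set (blk (K ! j) (j + 1) (j + 2) (j + 3) (j + w + 2)). bval \<sigma> b"
        unfolding blk_sat[OF False] uj using u4(1) by simp
      then show ?thesis using j(2) by blast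
    qed
  qed
  then show ?thesis unfolding sat_inst_def length_bnds using 1 by blast
qed

end

section \<open>NP-hardness\<close>

theorem theorem1:
  shows "NP_hard EQCONT_SAT"
  unfolding NP_hard_def
proof (intro allI impI)
  fix L :: "bool list set"
  assume "in_NP L"
  then obtain V c d where V: "in_P V"
    and L: "\<And>x. x \<in> L \<longleftrightarrow> (\<exists>y. length y \<le> c * (length x + 1) ^ d \<and> pair_enc x y \<in> V)"
    unfolding in_NP_def by blast
  obtain f where f: "poly_time_computable f" "\<And>v. v \<in> V \<longleftrightarrow> f v = [True]"
    using V unfolding in_P_def by blast
  obtain M a b where wf: "wf_tm M"
    and M: "\<And>v. \<exists>t \<le> a * (length v + 1) ^ b. fst ((step M ^^ t) (init_config v)) = 1 \<and>
      tm_output ((step M ^^ t) (init_config v)) = f v"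
    using f(1) unfolding poly_time_computable_def by blast
  have run: "\<exists>t \<le> a * (length v + 1) ^ b. fst (conf M v t) = 1 \<and> (v \<in> V \<longleftrightarrow> accepting (conf M v t))" for v
  proof -
    obtain t where t: "t \<le> a * (length v + 1) ^ b" "fst ((step M ^^ t) (init_config v)) = 1"
      "tm_output ((step M ^^ t) (init_config v)) = f v" using M by blast
    have tp: "tape_of ((step M ^^ t) (init_config v)) (conf M v t)"
      unfolding conf_def by (rule tape_of_steps[OF tape_of_init])
    then have "fst (conf M v t) = 1" using t(2) by (auto simp: tape_of_def split: prod.splits)
    then show ?thesis using t tm_output_True[OF tp] f(2) by auto
  qed
  \<comment> \<open>\<open>nstates M\<close> is included because states are shifted by one.\<close>
  define Cells where "Cells = {0..<nsyms M} \<times> {0..nstates M} \<times> (UNIV :: bool set)"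
  have fin: "finite Cells" by (simp add: Cells_def)
  have M3: "3 \<le> nsyms M" "2 \<le> nstates M" using wf by (simp_all add: wf_tm_def)
  obtain cl where cl: "set cl = Cells" using finite_list[OF fin] by blast
  define Rel where "Rel = {(p, q, r, s). p \<in> Cells \<and> q \<in> Cells \<and> r \<in> Cells \<and> s \<in> Cells \<and> wrel M p q r s}"
  have "finite Rel" by (rule finite_subset[of _ "Cells \<times> Cells \<times> Cells \<times> Cells"]) (auto simp: Rel_def fin)
  then obtain rl where rl_Rel: "set rl = Rel" using finite_list by blast
  define e :: "cell \<Rightarrow> nat" where "e = to_nat"
  \<comment> \<open>Any upper bound of the cell numbers will do as the number of bits, since
    \<open>n < 2 ^ n\<close>; 3 is what a block of conjuncts needs.\<close>
  define k where "k = Max (insert 3 (e ` Cells))"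
  have e_less: "e u < 2 ^ k" if "u \<in> Cells" for u
  proof -
    have "e u \<le> k" unfolding k_def using fin that by (intro Max_ge) auto
    then show ?thesis using less_exp[of k] by linarith
  qed
  have k3: "3 \<le> k" unfolding k_def using fin by (intro Max_ge) auto
  \<comment> \<open>Class 7 admits every cell and class 8 has no constraint. Like \<open>cl\<close>,
    \<open>rl\<close> and \<open>k\<close>, this depends on the verifier alone, so it is a constant
    of the reduction program.\<close>
  define al :: "nat \<Rightarrow> cell list" where "al n = (if n = 1 then [(1, 0, False)] else if n = 2 then [(2, 0, False)]
    else if n = 3 then [(1, 1, False)] else if n = 4 then [(2, 1, False)]
    else if n = 5 then [(0, 0, True), (1, 0, True), (2, 0, True)]
    else if n = 6 then [(0, 0, False)] else if n = 7 then cl else [])" for n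
  interpret eqcont_grid k e cl rl al
  proof
    show "set (al n) \<subseteq> set cl" for n using M3 by (auto simp: al_def cl Cells_def)
    show "set rl \<subseteq> set cl \<times> set cl \<times> set cl \<times> set cl" by (auto simp: rl_Rel cl Rel_def)
  qed (use k3 e_less in \<open>auto simp: cl e_def\<close>)
  \<comment> \<open>Gives \<open>2 * t + 2 \<le> z\<close> for every running time \<open>t\<close>:
    \<open>t\<close> columns for the path of the head, \<open>t\<close> for the shrinking of the
    trusted columns, and slack for the neighbours.\<close>
  define a2 where "a2 = 2 * a + 2"
  let ?K = "full_grid c d a2 b" and ?R = "first_rows c d a2 b" and ?z = "zlen c d a2 b"
  define red where "red x = enc_inst (grid_inst (length (?R x)) (?K x))" for x
  have "poly_time_computable (\<lambda>x. concat (map enc_nat (grid_nums c d a2 b k hdr_toks bnd_toks blk_toks x)))"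
    by (rule poly_time_computable_grid_nums) (rule toks_ok)+
  then have poly: "poly_time_computable red"
    by (simp add: grid_nums_enc[OF refl] red_def[abs_def])
  have "x \<in> L \<longleftrightarrow> red x \<in> EQCONT_SAT" for x
  proof -
    define Y where "Y = ylen c d x"
    define z where "z = ?z x"
    define m where "m = 2 * length x + 2 + Y"
    define w where w_len: "w = length (?R x)"
    define A where "A = (z + 1) * w"
    have irow: "length (irow c d x) = m" by (simp add: length_irow m_def Y_def)
    have w: "w = 2 * z + m" by (simp add: w_len z_def length_first_rows irow)
    have zval: "z = (2 * a + 2) * (m + 1) ^ b" by (simp add: z_def zlen_def irow a2_def)
    have time: "2 * t + 2 \<le> z" if "length y \<le> Y" "t \<le> a * (length (pair_enc x y) + 1) ^ b" for t y
    proof -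
      have "length (pair_enc x y) \<le> m" using that(1) by (simp add: pair_enc_prefix_bits length_prefix_bits m_def)
      then have "(length (pair_enc x y) + 1) ^ b \<le> (m + 1) ^ b" by (intro power_mono) auto
      then have "t \<le> a * (m + 1) ^ b" using that(2) by (meson le_trans mult_le_mono2)
      moreover have "1 \<le> (m + 1) ^ b" by simp
      ultimately show ?thesis unfolding zval add_mult_distrib by linarith
    qed
    have z_pos: "0 < z" by (simp add: zval)
    interpret tableau M x Y z w m "?R x" "\<lambda>n. set (al n)"
    proof
      show "?R x = rows z (mark_head (input_row x Y))" by (simp only: first_rows_def irow_def Y_def z_def)
    qed (use wf m_def w z_pos in \<open>simp_all add: al_def\<close>)
    have lenK: "length (?K x) = A + w + 1"
      unfolding length_full_grid A_def z_def[symmetric] w_len[symmetric] by simp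
    have Keq: "?K x = ?R x @ replicate (z * w) 7 @ replicate (w + 1) 8"
      by (simp only: full_grid_def grid_def z_def w_len)
    have lenR: "length (?R x) = w" by (simp only: w_len)
    have K: "?K x ! j = (if j < w then ?R x ! j else if j < A then 7 else 8)" if "j < length (?K x)" for j
      using that unfolding lenK Keq by (auto simp: nth_append lenR A_def simp del: replicate.simps)
    have R8: "?R x ! j \<noteq> 8" if "j < w" for j
    proof -
      have "?R x ! j \<in> set (?R x)" using that by (simp add: lenR)
      then have "?R x ! j \<in> {1..6}" using set_first_rows by blast
      then show ?thesis by auto
    qed
    have wA: "w \<le> A" by (simp add: A_def)
    have w2: "2 \<le> w" by (simp add: w m_def)
    have wfI: "wf_inst (grid_inst w (?K x))"
    proof (rule wf_grid)
      show "j + w + 2 \<le> length (?K x)" if "j < length (?K x)" "?K x ! j \<noteq> 8" for j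
        using that K[of j] wA by (auto simp: lenK split: if_splits)
    qed (use w2 in simp)
    have "x \<in> L \<longleftrightarrow> sat_inst (grid_inst w (?K x))"
    proof
      assume "x \<in> L"
      then obtain y where y: "length y \<le> Y" "pair_enc x y \<in> V" unfolding L Y_def ylen_def by blast
      then obtain T where T: "T \<le> a * (length (pair_enc x y) + 1) ^ b" "fst (conf M (pair_enc x y) T) = 1"
        "accepting (conf M (pair_enc x y) T)" using run by blast
      note comp = complete[OF y(1) time[OF y(1) T(1)] T(2,3)]
      have cells: "trace y i \<in> Cells" for i using comp(1)[of i] by (cases "trace y i") (auto simp: Cells_def)
      show "sat_inst (grid_inst w (?K x))"
      proof (rule sat_complete[where D = "trace y" and A = A])
        show "trace y i \<in> set cl" for i using cells by (simp add: cl)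
        show "trace y j \<in> set (al (?K x ! j))" if "j < A" for j
        proof (cases "j < w")
          case True
          then show ?thesis using K[of j] comp(2)[of j] that by (simp add: lenK)
        next
          case False
          then show ?thesis using K[of j] that cells by (simp add: lenK al_def cl)
        qed
        show "(trace y j, trace y (j + 1), trace y (j + 2), trace y (j + w + 1)) \<in> set rl" for j
          using comp(3) cells by (simp add: rl_Rel Rel_def)
        show "j < A" if "j < length (?K x)" "?K x ! j \<noteq> 8" for j
          using K[OF that(1)] that(2) wA by (auto split: if_splits)
      qed (use w2 in \<open>simp_all add: lenK\<close>)
    next
      assume sat: "sat_inst (grid_inst w (?K x))"
      have "?K x ! j \<noteq> 8" if "j < A" for j using K[of j] R8[of j] that by (simp add: lenK)
      from sat_sound[OF sat _ this w2, of A] obtain D where D: "\<And>j. j < A \<Longrightarrow> D j \<in> set (al (?K x ! j))"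
        "\<And>j. j + w + 1 < A \<Longrightarrow> (D j, D (j + 1), D (j + 2), D (j + w + 1)) \<in> set rl"
        by (auto simp: lenK)
      have "\<exists>y t. length y \<le> Y \<and> fst (conf M (pair_enc x y) t) = 1 \<and> accepting (conf M (pair_enc x y) t)"
      proof (rule sound)
        show "D r \<in> set (al (?R x ! r))" if "r < w" for r
          using D(1)[of r] K[of r] that wA by (simp add: lenK)
        show "wrel M (D i) (D (i + 1)) (D (i + 2)) (D (i + w + 1))" if "i + w + 1 < (z + 1) * w" for i
          using D(2)[of i] that by (simp add: A_def rl_Rel Rel_def)
        show "\<exists>t. 2 * t + 2 \<le> z \<and> fst (conf M (pair_enc x y) t) = 1" if "length y \<le> Y" for y
          using run[of "pair_enc x y"] time[OF that] by blast
      qed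
      then obtain y t where y: "length y \<le> Y" "fst (conf M (pair_enc x y) t) = 1" "accepting (conf M (pair_enc x y) t)"
        by blast
      obtain T where T: "fst (conf M (pair_enc x y) T) = 1" "pair_enc x y \<in> V \<longleftrightarrow> accepting (conf M (pair_enc x y) T)"
        using run by blast
      \<comment> \<open>Any two halting times show the same configuration, so the verdict read from
        the tableau is the verdict of the verifier.\<close>
      have "conf M (pair_enc x y) T = conf M (pair_enc x y) t"
        using conf_halted[of T t M "pair_enc x y"] conf_halted[of t T M "pair_enc x y"] T(1) y(2) by (cases "T \<le> t") auto
      then have "pair_enc x y \<in> V" using T(2) y(3) by simp
      then show "x \<in> L" using y(1) unfolding L Y_def ylen_def by blast
    qed
    then show ?thesis using enc_inst_in_EQCONT_SAT[OF wfI] by (simp add: red_def w_len)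
  qed
  then show "\<exists>f. poly_time_computable f \<and> (\<forall>x. (x \<in> L) = (f x \<in> EQCONT_SAT))" using poly by blast
qed

end
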